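(* Let $t\in(0,\tfrac12)$, let $\boldsymbol{\theta}\subseteq(0,\pi/6)$ be a set having $0$ as a limit point, and let $\rho_0\geq 4\left(\frac{1-t}{1-2t}\right)^2$. Let $\boldsymbol{\sigma}:\boldsymbol{\theta}\to(1,+\infty)$ be the function such that, for every $\theta\in\boldsymbol{\theta}$, $$\frac{1}{1-2t}\leq\boldsymbol{\sigma}(\theta)<\sigma^*_{t,\theta}\quad\text{and}\quad \rho_t(\theta,\boldsymbol{\sigma}(\theta))=\rho_0 .$$ Then the basis $\mathscr{B}^{\boldsymbol{\sigma}}$ differentiates exactly $L\log L(\mathbb{R}^2)$.
   Context: For $\theta\in(0,\pi/6)$ set $$\sigma^*_{t,\theta}:=\frac{1}{1-2t}\left(\cot2\theta+\sqrt{1+\cot^2 2\theta}\right),$$ and for $\frac1{1-2t}\leq\sigma<\sigma^*_{t,\theta}$ set $$\rho_t(\theta,\sigma):=\frac{1+\frac12\left(\sigma+\frac1\sigma\right)\sin2\theta}{(1-2t)\cos2\theta+\frac12\left[\frac1\sigma-(1-2t)^2\sigma\right]\sin2\theta},$$ whose denominator is positive in this range. For each $\theta\in\boldsymbol{\theta}$, the equation $\rho_t(\theta,\sigma)=\rho_0$ has exactly one solution $\sigma$ in the range $\frac1{1-2t}\leq\sigma<\sigma^*_{t,\theta}$. Rectangles in $\mathbb{R}^2$ are open and nondegenerate, with arbitrary orientation. The shape $\sigma(R)$ of a rectangle $R$ is the quotient of its longest side-length by its shortest side-length. $\mathscr{B}^{\boldsymbol{\sigma}}$ denotes the collection of all rectangles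 $R$ for which there exists $\theta\in\boldsymbol{\theta}$ such that the longest side of $R$ makes an angle $\theta$ with the horizontal line and $\sigma(R)=\boldsymbol{\sigma}(\theta)$ (all positions and all sizes are allowed). A (Buseman-Feller) differentiation basis is a collection $\mathscr{B}$ of open subsets of $\mathbb{R}^2$ such that $\inf\{\operatorname{diam}B: B\in\mathscr{B},\ x\in B\}=0$ for every $x\in\mathbb{R}^2$. For $f\in L^1_{\mathrm{loc}}(\mathbb{R}^2)$, $\mathscr{B}$ differentiates $\int f$ if for a.e. $x\in\mathbb{R}^2$ one has $\frac{1}{|B|}\int_B f\to f(x)$ as $\operatorname{diam}B\to0$ with $x\in B\in\mathscr{B}$. For $X\subseteq L^1_{\mathrm{loc}}(\mathbb{R}^2)$, $\mathscr{B}$ differentiates $X$ if it differentiates $\int f$ for every $f\in X$. A Young function is a convex nondecreasing function $\Phi:[0,\infty)\to[0,\infty)$, not identically zero, with $\Phi(0)=0$; $L^\Phi(\mathbb{R}^2)$ is the Orlicz space of measurable $f$ with $\int_{\mathbb{R}^2}\Phi(|f|/\mu)<\infty$ for some $\mu>0$. $L\log L(\mathbb{R}^2)$ is the Orlicz space associated with $t\mapsto t(1+\log_+t)$, where $\log_+t=\max(\log t,0)$ for $t>0$ (with value $0$ at $t=0$). "$\mathscr{B}$ differentiates exactly $L\log L(\mathbb{R}^2)$" means that $L\log L(\mathbb{R}^2)$ is the largest Orlicz space differentiated by $\mathscr{B}$ (in the sense of local integrability): $\mathscr{B}$ differentiates $L\log L(\mathbb{R}^2)$ and, whenever $\mathscr{B}$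 differentiates $L^\Phi(\mathbb{R}^2)$ for a Young function $\Phi$, one has $s\log s=O(\Phi(s))$ as $s\to+\infty$. *)

theory Defs
  imports "HOL-Analysis.Analysis" "HOL-Library.Landau_Symbols"
begin

definition sigma_star :: "real \<Rightarrow> real \<Rightarrow> real" where
  "sigma_star t \<theta> = 1 / (1 - 2 * t) * (cot (2 * \<theta>) + sqrt (1 + (cot (2 * \<theta>))\<^sup>2))"

definition rho :: "real \<Rightarrow> real \<Rightarrow> real \<Rightarrow> real" where
  "rho t \<theta> \<sigma> =
     (1 + 1 / 2 * (\<sigma> + 1 / \<sigma>) * sin (2 * \<theta>)) /
     ((1 - 2 * t) * cos (2 * \<theta>) + 1 / 2 * (1 / \<sigma> - (1 - 2 * t)\<^sup>2 * \<sigma>) * sin (2 * \<theta>))"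

text \<open>The open rectangle with centre \<open>c\<close>, side of length \<open>L\<close> in the direction
  \<open>(cos \<phi>, sin \<phi>)\<close> and side of length \<open>l\<close> in the orthogonal direction.\<close>

definition open_rectangle :: "real^2 \<Rightarrow> real \<Rightarrow> real \<Rightarrow> real \<Rightarrow> (real^2) set" where
  "open_rectangle c \<phi> L l =
     {x. \<bar>(x - c) \<bullet> vector [cos \<phi>, sin \<phi>]\<bar> < L / 2 \<and>
         \<bar>(x - c) \<bullet> vector [- sin \<phi>, cos \<phi>]\<bar> < l / 2}"

text \<open>The longest side has length \<open>L\<close> and makes the (oriented) angle \<open>\<theta>\<close> with the
  horizontal axis; the shape of the rectangle is \<open>L / l\<close>.\<close>

definition rectangle_basis :: "real set \<Rightarrow> (real \<Rightarrow> real) \<Rightarrow> (real^2) set set" where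
  "rectangle_basis \<Theta> \<sigma> =
     {open_rectangle c \<theta> L l | c \<theta> L l. \<theta> \<in> \<Theta> \<and> 0 < l \<and> l \<le> L \<and> L / l = \<sigma> \<theta>}"

text \<open>The constant \<^const>\<open>diameter\<close> is real-valued and carries no information on unbounded
  sets, which have infinite diameter; hence the boundedness conditions below. The quantified
  form of \<open>inf {diam B | B \<in> \<B>, x \<in> B} = 0\<close> also says that some member contains \<open>x\<close>.\<close>

definition differentiation_basis :: "(real^2) set set \<Rightarrow> bool" where
  "differentiation_basis \<B> \<longleftrightarrow>
     (\<forall>B\<in>\<B>. open B) \<and>
     (\<forall>x. \<forall>\<epsilon>>0. \<exists>B\<in>\<B>. x \<in> B \<and> bounded B \<and> diameter B < \<epsilon>)"

definition shrinking_filter :: "(real^2) set set \<Rightarrow> real^2 \<Rightarrow> (real^2) set filter" where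
  "shrinking_filter \<B> x =
     inf (filtercomap diameter (nhds 0)) (principal {B \<in> \<B>. x \<in> B \<and> bounded B})"

definition L1_loc :: "(real^2 \<Rightarrow> real) set" where
  "L1_loc = {f \<in> borel_measurable lebesgue. \<forall>K. compact K \<longrightarrow> set_integrable lebesgue K f}"

definition differentiates :: "(real^2) set set \<Rightarrow> (real^2 \<Rightarrow> real) \<Rightarrow> bool" where
  "differentiates \<B> f \<longleftrightarrow>
     (AE x in lebesgue.
       ((\<lambda>B. (LINT y:B|lebesgue. f y) / measure lebesgue B) \<longlongrightarrow> f x) (shrinking_filter \<B> x))"

definition differentiates_space :: "(real^2) set set \<Rightarrow> (real^2 \<Rightarrow> real) set \<Rightarrow> bool" where
  "differentiates_space \<B> X \<longleftrightarrow> X \<subseteq> L1_loc \<and> (\<forall>f\<in>X. differentiates \<B> f)"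

text \<open>Only the values on \<open>[0, \<infinity>)\<close> are relevant.\<close>

definition young_function :: "(real \<Rightarrow> real) \<Rightarrow> bool" where
  "young_function \<Phi> \<longleftrightarrow>
     convex_on {0..} \<Phi> \<and> mono_on {0..} \<Phi> \<and> (\<forall>s\<ge>0. \<Phi> s \<ge> 0) \<and>
     \<Phi> 0 = 0 \<and> (\<exists>s\<ge>0. \<Phi> s \<noteq> 0)"

definition orlicz_space :: "(real \<Rightarrow> real) \<Rightarrow> (real^2 \<Rightarrow> real) set" where
  "orlicz_space \<Phi> =
     {f \<in> borel_measurable lebesgue.
        \<exists>\<mu>>0. (\<integral>\<^sup>+x. ennreal (\<Phi> (\<bar>f x\<bar> / \<mu>)) \<partial>lebesgue) < \<infinity>}"

definition log_plus :: "real \<Rightarrow> real" where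
  "log_plus s = (if s > 0 then max (ln s) 0 else 0)"

definition L_log_L :: "(real^2 \<Rightarrow> real) set" where
  "L_log_L = orlicz_space (\<lambda>s. s * (1 + log_plus s))"

definition differentiates_exactly_L_log_L :: "(real^2) set set \<Rightarrow> bool" where
  "differentiates_exactly_L_log_L \<B> \<longleftrightarrow>
     differentiates_space \<B> L_log_L \<and>
     (\<forall>\<Phi>. young_function \<Phi> \<longrightarrow> differentiates_space \<B> (orlicz_space \<Phi>) \<longrightarrow>
          (\<lambda>s. s * ln s) \<in> O[at_top](\<Phi>))"

end

theory Submission
  imports Defs
begin

text \<open>
  From \<open>\<sigma> < sigma_star = cot \<theta> / (1 - 2t)\<close> one gets \<open>\<sigma> sin \<theta> \<le> \<kappa> = 1 / (1 - 2t)\<close>, so a rectangle of the basis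
  with sides \<open>L \<ge> l\<close> contains and is contained in axis-parallel boxes of sizes comparable to
  \<open>L \<times> l\<close>. As \<open>\<rho>\<^sub>0 > 1 / (1 - 2t)\<close>, which is the limit of \<open>rho\<close> for bounded shapes and \<open>\<theta> \<rightarrow> 0\<close>, the
  shapes are unbounded. Only these two facts matter.

  For \<open>f\<close> in \<open>L log L\<close>, the mean of \<open>\<bar>f - f(x, y)\<bar>\<close> over a box \<open>I \<times> J\<close> is at most the mean over \<open>I\<close>
  of \<open>h\<^sub>n(\<cdot>, y)\<close>, the largest mean oscillation of \<open>f\<close> on vertical intervals shorter than \<open>1/n\<close>, plus
  the mean oscillation of \<open>f(\<cdot>, y)\<close> on \<open>I\<close>. The weak type inequality on vertical lines makes \<open>h\<^sub>n\<close>
  locally integrable, so the one-dimensional Lebesgue theorem bounds the limit of the first term by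
  \<open>h\<^sub>n(x, y)\<close>, which tends to \<open>0\<close>.

  Conversely, unbounded shapes yield sets \<open>T\<close>, \<open>Y\<close> with \<open>\<bar>Y\<bar> \<ge> K 2\<^sup>K \<bar>T\<bar> / 2\<close> such that every point of \<open>Y\<close> lies
  in a rectangle of the basis in which \<open>T\<close> has density at least a constant times \<open>2\<^sup>-\<^sup>K\<close>. About \<open>1 / \<bar>Y\<bar>\<close> translates of
  a small such \<open>Y\<close> cover half of the unit square; superposing multiples of the indicators of the
  corresponding translates of \<open>T\<close> gives, unless \<open>s log s = O(\<Phi>(s))\<close>, a function of \<open>L\<^sup>\<Phi>\<close> that vanishes
  on a set of positive measure of points where its means do not tend to \<open>0\<close>.
\<close>

section \<open>Differentiation and maximal functions on the line\<close>

text \<open>Rational endpoints keep the family countable, so suprema over it stay measurable. An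
  arbitrary short interval is handled by enclosing it in a slightly longer one with rational
  endpoints.\<close>

definition rat_intervals :: "nat \<Rightarrow> (real \<times> real) set" where
  "rat_intervals n = {(a, b). a \<in> \<rat> \<and> b \<in> \<rat> \<and> a < b \<and> b - a < 1 / Suc n}"

text \<open>The uncentred Hardy-Littlewood maximal function restricted to intervals shorter than
  1/(n+1). It decreases in n, and its infimum over n is the limsup of the averages over the rational
  intervals shrinking to x.\<close>

definition local_max :: "nat \<Rightarrow> (real \<Rightarrow> ennreal) \<Rightarrow> real \<Rightarrow> ennreal" where
  "local_max n g x =
     (SUP (a, b) \<in> rat_intervals n.
        indicator {a<..<b} x * ((\<integral>\<^sup>+z. g z * indicator {a..b} z \<partial>lborel) / ennreal (b - a)))"

lemma countable_rat_intervals: "countable (rat_intervals n)"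
  by (rule countable_subset[of _ "\<rat> \<times> \<rat>"])
     (auto simp: rat_intervals_def intro: countable_rat)

text \<open>Function and point both depend measurably on a parameter \<open>w\<close>; with
  \<open>w\<close> a point of the plane this covers maximal functions taken along one coordinate
  only.\<close>

lemma local_max_measurable [measurable (raw)]:
  fixes G :: "'w \<Rightarrow> real \<Rightarrow> ennreal"
  assumes [measurable]: "(\<lambda>(w, z). G w z) \<in> borel_measurable (M \<Otimes>\<^sub>M borel)"
    "h \<in> borel_measurable M"
  shows "(\<lambda>w. local_max n (G w) (h w)) \<in> borel_measurable M"
proof -
  have [measurable]: "(\<lambda>w. (\<integral>\<^sup>+z. G w z * indicator {a..b} z \<partial>lborel)) \<in> borel_measurable M"
    for a b :: real
    by measurable
  show ?thesis
    unfolding local_max_def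
    by (rule borel_measurable_SUP[OF countable_rat_intervals]) (simp add: split_beta)
qed

lemma local_max_ge:
  assumes "(a, b) \<in> rat_intervals n" "a < x" "x < b"
  shows "(\<integral>\<^sup>+z. g z * indicator {a..b} z \<partial>lborel) / ennreal (b - a) \<le> local_max n g x"
  unfolding local_max_def
  by (rule SUP_upper2[of "(a, b)"]) (use assms in auto)

lemma local_max_leI:
  assumes "\<And>a b. (a, b) \<in> rat_intervals n \<Longrightarrow> a < x \<Longrightarrow> x < b \<Longrightarrow>
    (\<integral>\<^sup>+z. g z * indicator {a..b} z \<partial>lborel) \<le> c * ennreal (b - a)"
  shows "local_max n g x \<le> c"
  unfolding local_max_def
proof (rule SUP_least, clarify)
  fix a b assume ab: "(a, b) \<in> rat_intervals n"
  then have "ennreal (b - a) \<noteq> 0" "ennreal (b - a) \<noteq> top" by (auto simp: rat_intervals_def)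
  then have "(\<integral>\<^sup>+z. g z * indicator {a..b} z \<partial>lborel) / ennreal (b - a) \<le> c" if "a < x" "x < b"
    using assms[OF ab that] 
    by (metis divide_le_posI_ennreal mult.commute not_gr_zero)
  then show "indicator {a<..<b} x * ((\<integral>\<^sup>+z. g z * indicator {a..b} z \<partial>lborel) / ennreal (b - a)) \<le> c"
    by (auto simp: indicator_def)
qed

lemma nn_integral_le_local_max:
  assumes "(a, b) \<in> rat_intervals n" "a < x" "x < b"
  shows "(\<integral>\<^sup>+z. g z * indicator {a..b} z \<partial>lborel) \<le> local_max n g x * ennreal (b - a)"
proof -
  have "ennreal (b - a) \<noteq> 0" "ennreal (b - a) \<noteq> top" using assms by (auto simp: rat_intervals_def)
  then have "(\<integral>\<^sup>+z. g z * indicator {a..b} z \<partial>lborel) =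
    (\<integral>\<^sup>+z. g z * indicator {a..b} z \<partial>lborel) / ennreal (b - a) * ennreal (b - a)"
    by (simp add: ennreal_divide_times less_top)
  then show ?thesis using mult_right_mono[OF local_max_ge[OF assms, of g], of "ennreal (b - a)"] by simp
qed

lemma local_max_antimono: "m \<le> n \<Longrightarrow> local_max n g x \<le> local_max m g x"
  unfolding local_max_def
proof (rule SUP_subset_mono)
  assume "m \<le> n"
  then have "1 / real (Suc n) \<le> 1 / real (Suc m)" by (simp add: frac_le)
  then show "rat_intervals n \<subseteq> rat_intervals m"
    by (auto simp: rat_intervals_def)
qed auto

text \<open>Vitali covering: among the intervals with average above \<open>l\<close>, a disjoint
  subfamily has five-fold dilations that cover the level set. Summing \<open>l\<close> times the
  lengths over the disjoint intervals gives at most the integral of \<open>g\<close>, whence the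
  constant 5.\<close>

lemma weak_type_local_max:
  assumes [measurable]: "g \<in> borel_measurable borel" and "l > 0"
  shows "ennreal l * emeasure lborel {x. local_max n g x > ennreal l} \<le> 5 * (\<integral>\<^sup>+z. g z \<partial>lborel)"
proof -
  define K where "K = {(a, b) \<in> rat_intervals n. (\<integral>\<^sup>+z. g z * indicator {a..b} z \<partial>lborel) > ennreal (l * (b - a))}"
  define m where "m = (\<lambda>p::real \<times> real. (fst p + snd p) / 2)"
  define r where "r = (\<lambda>p::real \<times> real. (snd p - fst p) / 2)"
  have cb: "cball (m p) (r p) = {fst p..snd p}" for p
    by (auto simp: m_def r_def cball_eq_atLeastAtMost field_simps)
  have lt: "fst p < snd p" if "p \<in> K" for p using that by (auto simp: K_def rat_intervals_def)
  have sub: "{x. local_max n g x > ennreal l} \<subseteq> (\<Union>i\<in>K. cball (m i) (r i))"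
  proof
    fix x assume "x \<in> {x. local_max n g x > ennreal l}"
    then have "\<not> local_max n g x \<le> ennreal l" by auto
    then obtain a b where ab: "(a, b) \<in> rat_intervals n" "a < x" "x < b"
      "\<not> (\<integral>\<^sup>+z. g z * indicator {a..b} z \<partial>lborel) \<le> ennreal l * ennreal (b - a)"
      using local_max_leI[of n x g "ennreal l"] by blast
    then have "(a, b) \<in> K" using \<open>l > 0\<close> by (auto simp: K_def ennreal_mult'[symmetric] not_le)
    then show "x \<in> (\<Union>i\<in>K. cball (m i) (r i))"
      using ab cb[of "(a,b)"] by (intro UN_I[of "(a,b)"]) auto
  qed
  have rb: "0 < r p \<and> r p \<le> 1" if "p \<in> K" for p
  proof -
    have "snd p - fst p < 1 / Suc n" "1 / real (Suc n) \<le> 1" using that by (auto simp: K_def rat_intervals_def)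
    then have "snd p - fst p < 1" by (rule less_le_trans)
    then show ?thesis using lt[OF that] by (simp add: r_def)
  qed
  obtain C where C: "countable C" "C \<subseteq> K"
     "pairwise (\<lambda>i j. disjnt (cball (m i) (r i)) (cball (m j) (r j))) C"
     "{x. local_max n g x > ennreal l} \<subseteq> (\<Union>i\<in>C. cball (m i) (5 * r i))"
    by (rule Vitali_covering_lemma_cballs[OF sub rb]) blast+
  \<comment> \<open>Disjointness in integral form: a point lies in at most one selected
    interval.\<close>
  have one: "(\<integral>\<^sup>+i. indicator {fst i..snd i} z \<partial>count_space C) \<le> (1::ennreal)" for z
  proof (cases "\<exists>i\<in>C. z \<in> {fst i..snd i}")
    case True
    then obtain i where i: "i \<in> C" "z \<in> {fst i..snd i}" by auto
    have "j = i" if "j \<in> C" "z \<in> {fst j..snd j}" for j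
      using pairwiseD[OF C(3) that(1) i(1)] i that(2) unfolding disjnt_def cb by blast
    then have "z \<in> {fst j..snd j} \<longleftrightarrow> j \<in> {i}" if "j \<in> C" for j
      using i that by blast
    then have "indicator {fst j..snd j} z = (indicator {i} j :: ennreal)" if "j \<in> C" for j
      using that by (simp only: indicator_def)
    then have "(\<integral>\<^sup>+i. indicator {fst i..snd i} z \<partial>count_space C) = (\<integral>\<^sup>+j. indicator {i} j \<partial>count_space C)"
      by (intro nn_integral_cong) auto
    also have "\<dots> \<le> 1" using i by simp
    finally show ?thesis .
  next
    case False
    then have "(\<integral>\<^sup>+i. indicator {fst i..snd i} z \<partial>count_space C) = (\<integral>\<^sup>+i. (0::ennreal) \<partial>count_space C)"
      by (intro nn_integral_cong) (auto simp: indicator_def)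
    then show ?thesis by simp
  qed
  have "emeasure lborel {x. local_max n g x > ennreal l} \<le> emeasure lborel (\<Union>i\<in>C. cball (m i) (5 * r i))"
    using C by (intro emeasure_mono) (auto intro!: sets.countable_UN'')
  also have "\<dots> = (\<integral>\<^sup>+z. indicator (\<Union>i\<in>C. cball (m i) (5 * r i)) z \<partial>lborel)"
    using C by (subst nn_integral_indicator) (auto intro!: sets.countable_UN'')
  \<comment> \<open>Sums over \<open>C\<close> are written as integrals against counting measure, so
    that a single Tonelli theorem serves finite and infinite \<open>C\<close> alike.\<close>
  also have "\<dots> \<le> (\<integral>\<^sup>+z. (\<integral>\<^sup>+i. indicator (cball (m i) (5 * r i)) z \<partial>count_space C) \<partial>lborel)"
  proof (rule nn_integral_mono)
    fix z :: real
    show "indicator (\<Union>i\<in>C. cball (m i) (5 * r i)) z \<le> (\<integral>\<^sup>+i. indicator (cball (m i) (5 * r i)) z \<partial>count_space C)"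
    proof (cases "z \<in> (\<Union>i\<in>C. cball (m i) (5 * r i))")
      case True
      then obtain i where i: "i \<in> C" "z \<in> cball (m i) (5 * r i)" by auto
      have "1 = (\<integral>\<^sup>+j. indicator {i} j \<partial>count_space C)" using i by simp
      also have "\<dots> \<le> (\<integral>\<^sup>+j. indicator (cball (m j) (5 * r j)) z \<partial>count_space C)"
        using i by (intro nn_integral_mono) (auto simp: indicator_def)
      finally show ?thesis by (simp add: indicator_def)
    qed auto
  qed
  also have "\<dots> = (\<integral>\<^sup>+i. (\<integral>\<^sup>+z. indicator (cball (m i) (5 * r i)) z \<partial>lborel) \<partial>count_space C)"
    by (rule nn_integral_count_space_nn_integral[OF C(1)]) (simp add: borel_measurable_indicator)
  also have "\<dots> = (\<integral>\<^sup>+i. ennreal (5 * (snd i - fst i)) \<partial>count_space C)"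
  proof (intro nn_integral_cong)
    fix i assume "i \<in> space (count_space C)"
    then have "i \<in> K" using C by auto
    from lt[OF this] show "(\<integral>\<^sup>+z. indicator (cball (m i) (5 * r i)) z \<partial>lborel) = ennreal (5 * (snd i - fst i))"
      by (simp add: cball_eq_atLeastAtMost r_def emeasure_lborel_Icc_eq field_simps)
  qed
  finally have "ennreal l * emeasure lborel {x. local_max n g x > ennreal l} \<le>
      ennreal l * (\<integral>\<^sup>+i. ennreal (5 * (snd i - fst i)) \<partial>count_space C)"
    by (rule mult_left_mono) simp
  also have "\<dots> = (\<integral>\<^sup>+i. 5 * ennreal (l * (snd i - fst i)) \<partial>count_space C)"
  proof (subst nn_integral_cmult[symmetric])
    have "ennreal l * ennreal (5 * (snd i - fst i)) = 5 * ennreal (l * (snd i - fst i))" if "i \<in> C" for i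
      using lt[of i] that C(2) \<open>l > 0\<close>
      by (simp add: ennreal_mult'[symmetric] ennreal_numeral[symmetric] mult_ac del: ennreal_numeral)
    then show "(\<integral>\<^sup>+i. ennreal l * ennreal (5 * (snd i - fst i)) \<partial>count_space C) =
      (\<integral>\<^sup>+i. 5 * ennreal (l * (snd i - fst i)) \<partial>count_space C)"
      by (intro nn_integral_cong) auto
  qed auto
  also have "\<dots> \<le> (\<integral>\<^sup>+i. 5 * (\<integral>\<^sup>+z. g z * indicator {fst i..snd i} z \<partial>lborel) \<partial>count_space C)"
    using C(2) by (intro nn_integral_mono mult_left_mono) (auto simp: K_def less_imp_le)
  also have "\<dots> = 5 * (\<integral>\<^sup>+i. (\<integral>\<^sup>+z. g z * indicator {fst i..snd i} z \<partial>lborel) \<partial>count_space C)"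
    by (rule nn_integral_cmult) auto
  also have "(\<integral>\<^sup>+i. (\<integral>\<^sup>+z. g z * indicator {fst i..snd i} z \<partial>lborel) \<partial>count_space C) =
      (\<integral>\<^sup>+z. (\<integral>\<^sup>+i. g z * indicator {fst i..snd i} z \<partial>count_space C) \<partial>lborel)"
    by (rule nn_integral_count_space_nn_integral[OF C(1), symmetric]) simp
  also have "\<dots> = (\<integral>\<^sup>+z. g z * (\<integral>\<^sup>+i. indicator {fst i..snd i} z \<partial>count_space C) \<partial>lborel)"
    by (intro nn_integral_cong nn_integral_cmult) auto
  also have "\<dots> \<le> (\<integral>\<^sup>+z. g z * 1 \<partial>lborel)"
    by (intro nn_integral_mono mult_left_mono one) auto
  finally show ?thesis by (simp add: mult_left_mono)
qed

section \<open>From the weak type inequality to an \<open>L log L\<close> bound for the maximal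
  function\<close>

lemma local_max_add_const:
  assumes [measurable]: "g \<in> borel_measurable borel" and "\<And>z. f z \<le> g z + c"
  shows "local_max n f x \<le> local_max n g x + c"
proof (rule local_max_leI)
  fix a b assume ab: "(a, b) \<in> rat_intervals n" "a < x" "x < b"
  have "(\<integral>\<^sup>+z. f z * indicator {a..b} z \<partial>lborel) \<le> (\<integral>\<^sup>+z. g z * indicator {a..b} z + c * indicator {a..b} z \<partial>lborel)"
    using assms(2) by (intro nn_integral_mono) (auto simp: indicator_def)
  also have "\<dots> = (\<integral>\<^sup>+z. g z * indicator {a..b} z \<partial>lborel) + c * ennreal (b - a)"
    using ab by (subst nn_integral_add) (auto simp: nn_integral_cmult)
  also have "\<dots> \<le> local_max n g x * ennreal (b - a) + c * ennreal (b - a)"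
    by (intro add_right_mono nn_integral_le_local_max ab)
  finally show "(\<integral>\<^sup>+z. f z * indicator {a..b} z \<partial>lborel) \<le> (local_max n g x + c) * ennreal (b - a)"
    by (simp add: distrib_right)
qed

text \<open>Cut \<open>g\<close> at height l/2. The part below raises the maximal function by at
  most l/2, so where the latter exceeds \<open>l\<close>, the maximal function of the upper part
  exceeds l/2. This gives 10 = 2 times 5; keeping only the large values of \<open>g\<close> is what
  later produces the logarithm.\<close>

lemma weak_type_local_max_truncated:
  assumes [measurable]: "g \<in> borel_measurable borel" and "l > 0"
  shows "ennreal l * emeasure lborel {x. local_max n g x > ennreal l}
    \<le> 10 * (\<integral>\<^sup>+z. g z * indicator {z. g z > ennreal (l / 2)} z \<partial>lborel)"
proof -
  define g' where "g' z = g z * indicator {z. g z > ennreal (l / 2)} z" for z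
  have [measurable]: "g' \<in> borel_measurable borel" unfolding g'_def by measurable
  have "local_max n g x \<le> local_max n g' x + ennreal (l / 2)" for x
    by (rule local_max_add_const) (auto simp: g'_def indicator_def)
  moreover have "ennreal l = ennreal (l / 2) + ennreal (l / 2)"
    using \<open>l > 0\<close> by (subst ennreal_plus[symmetric]) auto
  ultimately have "local_max n g' x > ennreal (l / 2)" if "local_max n g x > ennreal l" for x
    using that by (metis add_right_mono leD leI order.trans)
  then have "emeasure lborel {x. local_max n g x > ennreal l} \<le> emeasure lborel {x. local_max n g' x > ennreal (l/2)}"
    by (intro emeasure_mono) auto
  then have "ennreal l * emeasure lborel {x. local_max n g x > ennreal l} \<le>
     2 * (ennreal (l/2) * emeasure lborel {x. local_max n g' x > ennreal (l/2)})"
    using \<open>l > 0\<close>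
    by (auto simp: mult.assoc[symmetric] ennreal_mult'[symmetric] ennreal_numeral[symmetric] mult_left_mono simp del: ennreal_numeral)
  also have "\<dots> \<le> 2 * (5 * (\<integral>\<^sup>+z. g' z \<partial>lborel))"
    using weak_type_local_max[of g' "l/2" n] \<open>l > 0\<close> by (intro mult_left_mono) auto
  finally show ?thesis by (simp add: g'_def mult.assoc[symmetric])
qed

text \<open>For finite M > 1 the powers of 2 below M are 1, 2, ..., 2^(N-1) with 2^N \<ge> M, and
  they sum to 2^N - 1 \<ge> M - 1.\<close>

lemma ennreal_le_dyadic_sum:
  fixes M :: ennreal
  shows "M \<le> 1 + (\<Sum>k. 2 ^ k * indicator {M. 2 ^ k < M} M)"
proof (rule ccontr)
  let ?f = "\<lambda>k. 2 ^ k * indicator {M. 2 ^ k < M} M :: ennreal"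
  \<comment> \<open>Truncating at 2^N permits induction on N and covers infinite M: raising the cut
    from 2^N to 2^(N+1) adds at most 2^N, and only if 2^N < M.\<close>
  have *: "min M (2 ^ N) \<le> 1 + (\<Sum>k<N. ?f k)" for N
  proof (induction N)
    case (Suc N)
    show ?case
    proof (cases "2 ^ N < M")
      case True
      then have "min M (2 ^ Suc N) \<le> min M (2 ^ N) + 2 ^ N"
        by (auto simp: min_def mult_2)
      also have "\<dots> \<le> 1 + (\<Sum>k<N. ?f k) + 2 ^ N" using Suc by (rule add_right_mono)
      finally show ?thesis using True by (simp add: add.assoc)
    next
      case False
      then have "M \<le> 2 ^ N" by simp
      moreover have "(2::ennreal) ^ N \<le> 2 ^ Suc N" by (simp add: mult_2)
      ultimately have "M \<le> 2 ^ Suc N" by (rule order.trans)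
      then have "min M (2 ^ Suc N) \<le> min M (2 ^ N)" using \<open>M \<le> 2 ^ N\<close> by (simp add: min_absorb1)
      also note Suc
      finally show ?thesis using False by simp
    qed
  qed auto
  have N: "min M (2 ^ N) \<le> 1 + suminf ?f" for N
    by (rule order.trans[OF *]) (intro add_left_mono sum_le_suminf, auto)
  assume "\<not> M \<le> 1 + suminf ?f"
  then have lt: "1 + suminf ?f < M" by simp
  then have "1 + suminf ?f < top" by (rule less_le_trans) simp
  then obtain x where x: "1 + suminf ?f = ennreal x" "x \<ge> 0"
    by (cases "1 + suminf ?f") auto
  obtain N where "x < 2 ^ N" using real_arch_pow[of 2 x] by auto
  then have "1 + suminf ?f < ennreal (2 ^ N)" unfolding x(1) using x(2) by (simp add: ennreal_less_iff)
  then have "1 + suminf ?f < 2 ^ N" by (simp add: ennreal_power[symmetric])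
  with lt have "1 + suminf ?f < min M (2 ^ N)" by simp
  then show False using N[of N] leD by blast
qed

text \<open>The series counts the k with 2^k < 2u: at most
  \<open>\<lceil>log 2 (2 * u)\<rceil>\<close> of them, and none when u \<le> 1/2.\<close>

lemma suminf_indicator_dyadic_le:
  fixes u :: real
  assumes "u \<ge> 0"
  shows "(\<Sum>k. indicator {k. ennreal (2 ^ k / 2) < ennreal u} k) \<le> ennreal (2 * (1 + log_plus u))"
proof (cases "u > 1/2")
  case False
  have "(ennreal (2 ^ k / 2) < ennreal u) = False" for k
  proof -
    have "(1::real) \<le> 2 ^ k" by simp
    then show ?thesis using False assms by (auto simp: ennreal_less_iff not_less simp del: one_le_power)
  qed
  then have "(\<Sum>k. indicator {k. ennreal (2 ^ k / 2) < ennreal u} k) = (\<Sum>k::nat. (0::ennreal))"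
    by (intro suminf_cong) (auto simp: indicator_def)
  then show ?thesis by simp
next
  case True
  define N where "N = nat \<lceil>log 2 (2 * u)\<rceil>"
  have N: "k < N" if "ennreal (2 ^ k / 2) < ennreal u" for k
  proof -
    have "2 ^ k < 2 * u" using that by (simp add: ennreal_less_iff)
    then have "k < log 2 (2 * u)" using True by (subst less_log_iff) (auto simp: powr_realpow)
    then show ?thesis by (auto simp: N_def) linarith
  qed
  then have "(\<Sum>k. indicator {k. ennreal (2 ^ k / 2) < ennreal u} k :: ennreal) = (\<Sum>k<N. indicator {k. ennreal (2 ^ k / 2) < ennreal u} k)"
    by (intro suminf_finite) (auto simp: indicator_def)
  also have "\<dots> \<le> (\<Sum>k<N. 1)" by (intro sum_mono) (auto simp: indicator_def)
  also have "\<dots> = ennreal (real N)" by (simp add: ennreal_of_nat_eq_real_of_nat)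
  also have "\<dots> \<le> ennreal (2 * (1 + log_plus u))"
  proof (rule ennreal_leI)
    have "log 2 (2 * u) \<ge> 0" using True by (simp add: zero_le_log_cancel_iff)
    then have "real N \<le> log 2 (2 * u) + 1" unfolding N_def by linarith
    also have "\<dots> = 2 + log 2 u" using True by (simp add: log_mult)
    \<comment> \<open>For u \<ge> 1 this amounts to ln 2 \<ge> 1/2, which follows from e \<le> 3 <
      4.\<close>
    also have "log 2 u \<le> 2 * log_plus u"
    proof -
      have "1 \<le> ln (2 ^ 2 :: real)" using exp_le by (subst ln_ge_iff) auto
      then have "ln 2 \<ge> (1/2::real)" by (subst (asm) ln_realpow) auto
      then have "\<bar>ln u\<bar> * 1 \<le> \<bar>ln u\<bar> * (2 * ln 2)" by (intro mult_left_mono) auto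
      then show ?thesis using True by (auto simp: log_plus_def log_def max_def field_simps divide_le_0_iff)
    qed
    finally show "real N \<le> 2 * (1 + log_plus u)" by simp
  qed
  finally show ?thesis .
qed

text \<open>Sum the truncated weak type bounds over the levels 2^k. After exchanging sum and
  integral, the value u(z) is counted once for each k with 2^k < 2 u(z), that is, about log u(z)
  times; this is where the logarithm enters. The constant is 20 = 10 times 2.\<close>

lemma nn_integral_local_max_le:
  fixes u :: "real \<Rightarrow> real"
  assumes [measurable]: "u \<in> borel_measurable borel" "S \<in> sets borel" and u: "\<And>z. u z \<ge> 0"
  shows "(\<integral>\<^sup>+x. local_max n (\<lambda>z. ennreal (u z)) x * indicator S x \<partial>lborel)
    \<le> emeasure lborel S + 20 * (\<integral>\<^sup>+z. ennreal (u z * (1 + log_plus (u z))) \<partial>lborel)"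
proof -
  let ?M = "local_max n (\<lambda>z. ennreal (u z))"
  have [measurable]: "?M \<in> borel_measurable borel" by measurable
  have [measurable]: "log_plus \<in> borel_measurable borel" unfolding log_plus_def by measurable
  have "(\<integral>\<^sup>+x. ?M x * indicator S x \<partial>lborel) \<le>
     (\<integral>\<^sup>+x. indicator S x + (\<Sum>k. 2 ^ k * indicator {x. 2 ^ k < ?M x} x) \<partial>lborel)"
  proof (rule nn_integral_mono)
    fix x
    show "?M x * indicator S x \<le> indicator S x + (\<Sum>k. 2 ^ k * indicator {x. 2 ^ k < ?M x} x)"
      using ennreal_le_dyadic_sum[of "?M x"] by (auto simp: indicator_def)
  qed
  also have "\<dots> = emeasure lborel S + (\<Sum>k. (\<integral>\<^sup>+x. 2 ^ k * indicator {x. 2 ^ k < ?M x} x \<partial>lborel))"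
    by (subst nn_integral_add) (auto simp: nn_integral_suminf)
  also have "(\<Sum>k. (\<integral>\<^sup>+x. 2 ^ k * indicator {x. 2 ^ k < ?M x} x \<partial>lborel)) \<le>
     (\<Sum>k. 10 * (\<integral>\<^sup>+z. ennreal (u z) * indicator {z. ennreal (u z) > ennreal (2 ^ k / 2)} z \<partial>lborel))"
  proof (rule suminf_le)
    fix k
    have "(\<integral>\<^sup>+x. 2 ^ k * indicator {x. 2 ^ k < ?M x} x \<partial>lborel) = ennreal (2 ^ k) * emeasure lborel {x. ?M x > ennreal (2 ^ k)}"
      by (subst nn_integral_cmult) (auto simp: ennreal_power[symmetric])
    also have "\<dots> \<le> 10 * (\<integral>\<^sup>+z. ennreal (u z) * indicator {z. ennreal (u z) > ennreal (2 ^ k / 2)} z \<partial>lborel)"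
      by (rule weak_type_local_max_truncated) auto
    finally show "(\<integral>\<^sup>+x. 2 ^ k * indicator {x. 2 ^ k < ?M x} x \<partial>lborel) \<le> \<dots>" .
  qed auto
  also have "\<dots> = (\<integral>\<^sup>+z. (\<Sum>k. 10 * (ennreal (u z) * indicator {z. ennreal (u z) > ennreal (2 ^ k / 2)} z)) \<partial>lborel)"
    by (subst nn_integral_suminf) (auto simp: nn_integral_cmult)
  also have "\<dots> \<le> (\<integral>\<^sup>+z. 20 * ennreal (u z * (1 + log_plus (u z))) \<partial>lborel)"
  proof (rule nn_integral_mono)
    fix z
    have lp: "log_plus (u z) \<ge> 0" by (auto simp: log_plus_def)
    have "(\<Sum>k. 10 * (ennreal (u z) * indicator {z. ennreal (u z) > ennreal (2 ^ k / 2)} z)) =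
        10 * (ennreal (u z) * (\<Sum>k. indicator {k. ennreal (2 ^ k / 2) < ennreal (u z)} k))"
      by (simp add: ennreal_suminf_cmult indicator_def)
    also have "\<dots> \<le> 10 * (ennreal (u z) * ennreal (2 * (1 + log_plus (u z))))"
      by (intro mult_left_mono suminf_indicator_dyadic_le u) auto
    also have "\<dots> = 20 * ennreal (u z * (1 + log_plus (u z)))"
    proof -
      have "10 * (ennreal (u z) * ennreal (2 * (1 + log_plus (u z)))) = ennreal (10 * (u z * (2 * (1 + log_plus (u z)))))"
        using u[of z] lp by (simp only: ennreal_mult ennreal_numeral mult_nonneg_nonneg add_nonneg_nonneg zero_le_numeral zero_le_one)
      also have "10 * (u z * (2 * (1 + log_plus (u z)))) = 20 * (u z * (1 + log_plus (u z)))" by simp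
      also have "ennreal \<dots> = 20 * ennreal (u z * (1 + log_plus (u z)))"
        using u[of z] lp by (simp only: ennreal_mult ennreal_numeral mult_nonneg_nonneg add_nonneg_nonneg zero_le_numeral zero_le_one)
      finally show ?thesis .
    qed
    finally show "(\<Sum>k. 10 * (ennreal (u z) * indicator {z. ennreal (u z) > ennreal (2 ^ k / 2)} z)) \<le> \<dots>" .
  qed
  also have "\<dots> = 20 * (\<integral>\<^sup>+z. ennreal (u z * (1 + log_plus (u z))) \<partial>lborel)"
    by (rule nn_integral_cmult) auto
  finally show ?thesis by (simp add: add_left_mono)
qed

section \<open>Lebesgue differentiation on the line\<close>

lemma integrable_right_averages:
  fixes f :: "real \<Rightarrow> real"
  assumes "\<And>a b. f integrable_on {a..b}"
  shows "AE x in lborel. \<forall>e>0. \<exists>d>0. \<forall>h. 0 < h \<and> h < d \<longrightarrow> integral {x..x + h} f \<le> (f x + e) * h"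
proof -
  \<comment> \<open>The differentiation theorem applied here uses cubes with lower corner x, which
    on the line are the intervals to the right of x.\<close>
  obtain N where N: "negligible N"
    "\<And>x e. \<lbrakk>x \<notin> N; 0 < e\<rbrakk> \<Longrightarrow> \<exists>d>0. \<forall>h. 0 < h \<and> h < d \<longrightarrow>
       norm (integral (cbox x (x + h *\<^sub>R One)) f /\<^sub>R h ^ DIM(real) - f x) < e"
    by (rule integrable_ccontinuous_explicit[of f]) (use assms in auto)
  have "AE x in lebesgue. x \<notin> N"
    using N(1) by (auto simp: negligible_iff_null_sets intro: AE_not_in)
  then have "AE x in lborel. x \<notin> N" by (simp add: AE_completion_iff)
  then show ?thesis
  proof eventually_elim
    case (elim x)
    show ?case
    proof (intro allI impI)
      fix e :: real assume "e > 0"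
      from N(2)[OF elim this] obtain d where d: "d > 0"
        "\<And>h. 0 < h \<Longrightarrow> h < d \<Longrightarrow> \<bar>integral {x..x + h} f / h - f x\<bar> < e"
        by (auto simp: divide_inverse mult.commute)
      have "integral {x..x + h} f \<le> (f x + e) * h" if "0 < h" "h < d" for h
      proof -
        have "integral {x..x + h} f / h \<le> f x + e" using d(2)[OF that] by linarith
        then show ?thesis using that by (simp add: pos_divide_le_eq)
      qed
      with d show "\<exists>d>0. \<forall>h. 0 < h \<and> h < d \<longrightarrow> integral {x..x + h} f \<le> (f x + e) * h" by blast
    qed
  qed
qed

text \<open>Reflection at the origin preserves Lebesgue measure and turns averages to the left of a
  point into averages to the right of its mirror image.\<close>

lemma integrable_left_averages:
  fixes f :: "real \<Rightarrow> real"
  assumes "\<And>a b. f integrable_on {a..b}"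
  shows "AE x in lborel. \<forall>e>0. \<exists>d>0. \<forall>h. 0 < h \<and> h < d \<longrightarrow> integral {x - h..x} f \<le> (f x + e) * h"
proof -
  let ?P = "\<lambda>x. \<forall>e>0. \<exists>d>0. \<forall>h. 0 < h \<and> h < d \<longrightarrow> integral {x - h..x} f \<le> (f x + e) * h"
  have "(\<lambda>x. f (- x)) integrable_on {a..b}" for a b
    using assms[of "- b" "- a"] Henstock_Kurzweil_Integration.integrable_reflect_real[of f "- a" "- b"] by simp
  from integrable_right_averages[OF this]
  have *: "AE x in lborel. ?P (- x)"
  proof eventually_elim
    case (elim x)
    have "integral {- x - h..- x} f = integral {x..x + h} (\<lambda>x. f (- x))" for h
      using Henstock_Kurzweil_Integration.integral_reflect_real[of "x + h" x "\<lambda>x. f (- x)"] by simp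
    then show ?case using elim by simp
  qed
  have "AE x in distr lborel borel uminus. ?P x"
  proof -
    obtain N where N: "N \<in> null_sets lborel" "{x. \<not> ?P (- x)} \<subseteq> N" 
      using * by (auto simp: eventually_ae_filter)
    have "uminus -` N \<in> null_sets (distr lborel borel uminus)"
    proof -
      have m: "uminus -` N \<in> sets borel"
        using measurable_sets[of uminus borel borel N] N(1) by (auto simp: null_sets_def)
      have "uminus -` uminus -` N = N" by auto
      then show ?thesis using m N(1) by (simp add: null_sets_def emeasure_distr)
    qed
    moreover have "{x. \<not> ?P x} \<subseteq> uminus -` N" using N(2) by force
    ultimately show ?thesis by (auto simp: eventually_ae_filter)
  qed
  then show ?thesis unfolding lborel_distr_uminus .
qed

text \<open>An interval around x splits at x into a left and a right piece, and the one-sided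
  theorems bound the integral over each piece by f(x) + e times its length. The upper bound suffices
  for the passage to Lebesgue points.\<close>

theorem local_max_differentiation:
  assumes [measurable]: "g \<in> borel_measurable borel"
    and fin: "\<And>k::nat. (\<integral>\<^sup>+x. g x * indicator {- real k..real k} x \<partial>lborel) < \<infinity>"
  shows "AE x in lborel. (INF m. local_max m g x) \<le> g x"
proof -
  \<comment> \<open>Local integrability makes \<open>g\<close> finite almost everywhere;
    \<open>enn2real\<close> puts 0 at the exceptional points and yields a real function to which the
    Henstock-Kurzweil theorems apply.\<close>
  define f where "f x = enn2real (g x)" for x
  have [measurable]: "f \<in> borel_measurable borel" unfolding f_def by measurable
  have "AE x in lborel. \<forall>k::nat. g x * indicator {- real k..real k} x \<noteq> \<infinity>"
    unfolding AE_all_countable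
    by (intro allI nn_integral_PInf_AE) (use fin in \<open>auto simp: less_top\<close>)
  then have g: "AE x in lborel. g x = ennreal (f x)"
  proof eventually_elim
    case (elim x)
    obtain k where "\<bar>x\<bar> \<le> real k" using real_arch_simple by blast
    then have "x \<in> {- real k..real k}" by auto
    then have "g x \<noteq> top" using elim[rule_format, of k] by auto
    then show ?case by (simp add: f_def less_top)
  qed
  have si: "set_integrable lborel {a..b} f" for a b
  proof -
    obtain k where "max \<bar>a\<bar> \<bar>b\<bar> \<le> real k" using real_arch_simple by blast
    then have sub: "{a..b} \<subseteq> {- real k..real k}" by auto
    have "(\<integral>\<^sup>+x. ennreal (norm (indicator {- real k..real k} x *\<^sub>R f x)) \<partial>lborel) =
       (\<integral>\<^sup>+x. g x * indicator {- real k..real k} x \<partial>lborel)"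
      by (rule nn_integral_cong_AE, use g in eventually_elim) (auto simp: indicator_def f_def)
    then have "set_integrable lborel {- real k..real k} f"
      unfolding set_integrable_def using fin[of k] by (intro integrableI_bounded) auto
    then show ?thesis by (rule set_integrable_subset) (use sub in auto)
  qed
  have eq: "(\<integral>\<^sup>+z. g z * indicator {a..b} z \<partial>lborel) = ennreal (integral {a..b} f)" for a b
  proof -
    have "(\<integral>\<^sup>+z. g z * indicator {a..b} z \<partial>lborel) = (\<integral>\<^sup>+z. ennreal (indicator {a..b} z *\<^sub>R f z) \<partial>lborel)"
      by (rule nn_integral_cong_AE, use g in eventually_elim) (auto simp: indicator_def)
    also have "\<dots> = ennreal (LINT z:{a..b}|lborel. f z)"
      unfolding set_lebesgue_integral_def
      by (rule nn_integral_eq_integral) (use si in \<open>auto simp: set_integrable_def f_def\<close>)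
    also have "(LINT z:{a..b}|lborel. f z) = integral {a..b} f"
      by (rule set_borel_integral_eq_integral(2)[OF si])
    finally show ?thesis .
  qed
  have int: "f integrable_on {a..b}" for a b
    by (rule set_borel_integral_eq_integral(1)[OF si])
  show ?thesis
    using g integrable_right_averages[OF int] integrable_left_averages[OF int]
  proof eventually_elim
    case (elim x)
    have fx: "f x \<ge> 0" by (simp add: f_def)
    have "(INF m. local_max m g x) \<le> g x + ennreal e" if e: "e > 0" for e
    proof -
      obtain d1 where d1: "d1 > 0" "\<And>h. 0 < h \<Longrightarrow> h < d1 \<Longrightarrow> integral {x..x + h} f \<le> (f x + e) * h"
        using elim(2) e by blast
      obtain d2 where d2: "d2 > 0" "\<And>h. 0 < h \<Longrightarrow> h < d2 \<Longrightarrow> integral {x - h..x} f \<le> (f x + e) * h"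
        using elim(3) e by blast
      obtain m where m: "1 / Suc m < min d1 d2"
        using nat_approx_posE[of "min d1 d2"] d1 d2 by auto
      have "local_max m g x \<le> ennreal (f x + e)"
      proof (rule local_max_leI)
        fix a b assume ab: "(a, b) \<in> rat_intervals m" "a < x" "x < b"
        then have "b - a < min d1 d2" using m by (auto simp: rat_intervals_def)
        then have *: "x - a < d2" "b - x < d1" using ab by auto
        have "integral {a..b} f = integral {a..x} f + integral {x..b} f"
          using ab int by (intro Henstock_Kurzweil_Integration.integral_combine[symmetric]) auto
        also have "\<dots> \<le> (f x + e) * (x - a) + (f x + e) * (b - x)"
          using d1(2)[of "b - x"] d2(2)[of "x - a"] ab * by (intro add_mono) auto
        also have "\<dots> = (f x + e) * (b - a)" by (simp add: algebra_simps)
        finally show "(\<integral>\<^sup>+z. g z * indicator {a..b} z \<partial>lborel) \<le> ennreal (f x + e) * ennreal (b - a)"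
          unfolding eq using ab fx e by (subst ennreal_mult[symmetric]) (auto intro: ennreal_leI)
      qed
      also have "\<dots> = g x + ennreal e" using fx e elim(1) by simp
      finally show ?thesis by (rule INF_lower2[OF UNIV_I])
    qed
    then show ?case by (rule ennreal_le_epsilon)
  qed
qed

text \<open>Apply the differentiation theorem to \<open>\<bar>u - q\<bar>\<close> for all rational q
  at once, discarding countably many null sets. At a remaining x choose q within e/2 of u(x):
  replacing u(x) by q costs e/2, and the limiting bound \<open>\<bar>u x - q\<bar>\<close> is
  another e/2.\<close>

theorem lebesgue_points:
  fixes u :: "real \<Rightarrow> real"
  assumes [measurable]: "u \<in> borel_measurable borel"
    and fin: "\<And>k::nat. (\<integral>\<^sup>+x. ennreal \<bar>u x\<bar> * indicator {- real k..real k} x \<partial>lborel) < \<infinity>"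
  shows "AE x in lborel. (INF m. local_max m (\<lambda>z. ennreal \<bar>u z - u x\<bar>) x) = 0"
proof -
  have "AE x in lborel. \<forall>q\<in>\<rat>. (INF m. local_max m (\<lambda>z. ennreal \<bar>u z - q\<bar>) x) \<le> ennreal \<bar>u x - q\<bar>"
  proof (subst AE_ball_countable[OF countable_rat], intro ballI local_max_differentiation)
    fix q :: real and k :: nat
    have "(\<integral>\<^sup>+x. ennreal \<bar>u x - q\<bar> * indicator {- real k..real k} x \<partial>lborel) \<le>
      (\<integral>\<^sup>+x. ennreal \<bar>u x\<bar> * indicator {- real k..real k} x + ennreal \<bar>q\<bar> * indicator {- real k..real k} x \<partial>lborel)"
      by (intro nn_integral_mono) (auto simp: indicator_def ennreal_plus[symmetric] intro!: ennreal_leI simp del: ennreal_plus)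
    also have "\<dots> = (\<integral>\<^sup>+x. ennreal \<bar>u x\<bar> * indicator {- real k..real k} x \<partial>lborel) + ennreal \<bar>q\<bar> * ennreal (2 * real k)"
      by (subst nn_integral_add) (auto simp: nn_integral_cmult)
    also have "\<dots> < \<infinity>" using fin[of k] by (auto simp: ennreal_mult_less_top)
    finally show "(\<integral>\<^sup>+x. ennreal \<bar>u x - q\<bar> * indicator {- real k..real k} x \<partial>lborel) < \<infinity>" .
  qed measurable
  then show ?thesis
  proof eventually_elim
    case (elim x)
    have "(INF m. local_max m (\<lambda>z. ennreal \<bar>u z - u x\<bar>) x) \<le> 0 + ennreal e" if "e > 0" for e
    proof -
      obtain q where q: "q \<in> \<rat>" "u x < q" "q < u x + e / 2"
        using Rats_dense_in_real[of "u x" "u x + e/2"] \<open>e > 0\<close> by auto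
      then have qe: "\<bar>u x - q\<bar> \<le> e / 2" by auto
      have "local_max m (\<lambda>z. ennreal \<bar>u z - u x\<bar>) x \<le> local_max m (\<lambda>z. ennreal \<bar>u z - q\<bar>) x + ennreal (e/2)" for m
      proof (rule local_max_add_const)
        fix z
        have "\<bar>u z - u x\<bar> \<le> \<bar>u z - q\<bar> + e / 2" using qe by linarith
        then show "ennreal \<bar>u z - u x\<bar> \<le> ennreal \<bar>u z - q\<bar> + ennreal (e / 2)"
          using \<open>e > 0\<close> by (simp add: ennreal_plus[symmetric] ennreal_leI del: ennreal_plus)
      qed measurable
      then have "(INF m. local_max m (\<lambda>z. ennreal \<bar>u z - u x\<bar>) x) \<le>
        (INF m. local_max m (\<lambda>z. ennreal \<bar>u z - q\<bar>) x + ennreal (e/2))"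
        by (intro INF_mono) auto
      also have "\<dots> = (INF m. local_max m (\<lambda>z. ennreal \<bar>u z - q\<bar>) x) + ennreal (e/2)"
        by (rule INF_ennreal_add_const)
      also have "\<dots> \<le> ennreal \<bar>u x - q\<bar> + ennreal (e / 2)"
        using elim q by (intro add_right_mono) auto
      also have "\<dots> \<le> ennreal (e/2) + ennreal (e/2)"
        using qe by (intro add_right_mono ennreal_leI)
      also have "\<dots> = 0 + ennreal e" using \<open>e > 0\<close> by (simp add: ennreal_plus[symmetric] del: ennreal_plus)
      finally show ?thesis .
    qed
    then have "(INF m. local_max m (\<lambda>z. ennreal \<bar>u z - u x\<bar>) x) \<le> 0" by (rule ennreal_le_epsilon)
    then show ?case by simp
  qed
qed

section \<open>Strong differentiation in the plane\<close>

lemma log_plus_nonneg: "log_plus s \<ge> 0"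
  by (simp add: log_plus_def)

lemma log_plus_measurable [measurable]: "log_plus \<in> borel_measurable borel"
  unfolding log_plus_def by measurable

text \<open>Mean deviation from the value at y itself; points where its infimum over n vanishes are
  Lebesgue points of \<open>v\<close>.\<close>

definition oscillation :: "nat \<Rightarrow> (real \<Rightarrow> real) \<Rightarrow> real \<Rightarrow> ennreal" where
  "oscillation n v y = local_max n (\<lambda>z. ennreal \<bar>v z - v y\<bar>) y"

lemma oscillation_measurable [measurable (raw)]:
  fixes U :: "'w \<Rightarrow> real \<Rightarrow> real"
  assumes [measurable]: "(\<lambda>(w, z). U w z) \<in> borel_measurable (M \<Otimes>\<^sub>M borel)"
    "h \<in> borel_measurable M"
  shows "(\<lambda>w. oscillation n (U w) (h w)) \<in> borel_measurable M"
  unfolding oscillation_def by measurable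

lemma oscillation_le:
  assumes [measurable]: "v \<in> borel_measurable borel"
  shows "oscillation n v y \<le> local_max n (\<lambda>z. ennreal \<bar>v z\<bar>) y + ennreal \<bar>v y\<bar>"
  unfolding oscillation_def
  by (rule local_max_add_const) (auto simp: ennreal_plus[symmetric] intro!: ennreal_leI simp del: ennreal_plus)

text \<open>Rational boxes and an iterated integral are the form in which one-dimensional maximal
  functions control the mean. Three almost everywhere facts combine: A for averages of
  \<open>h n\<close> along horizontal lines, B for Lebesgue points on horizontal lines, C for
  Lebesgue points on vertical lines.\<close>

theorem strong_differentiation:
  fixes U :: "real \<Rightarrow> real \<Rightarrow> real"
  assumes U [measurable]: "(\<lambda>(x, y). U x y) \<in> borel_measurable (borel \<Otimes>\<^sub>M borel)"
    and fin: "(\<integral>\<^sup>+x. \<integral>\<^sup>+y. ennreal (\<bar>U x y\<bar> * (1 + log_plus \<bar>U x y\<bar>)) \<partial>lborel \<partial>lborel) < \<infinity>"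
  shows "AE p in lborel \<Otimes>\<^sub>M lborel. \<forall>\<epsilon>>0. \<exists>n. \<forall>(a, b)\<in>rat_intervals n. \<forall>(c, d)\<in>rat_intervals n.
    a < fst p \<and> fst p < b \<and> c < snd p \<and> snd p < d \<longrightarrow>
      (\<integral>\<^sup>+z. (\<integral>\<^sup>+w. ennreal \<bar>U z w - U (fst p) (snd p)\<bar> * indicator {c..d} w \<partial>lborel) * indicator {a..b} z \<partial>lborel)
       \<le> ennreal \<epsilon> * ennreal ((b - a) * (d - c))"
proof -
  have U1 [measurable]: "U x \<in> borel_measurable borel" for x by measurable
  have U2 [measurable]: "(\<lambda>x. U x y) \<in> borel_measurable borel" for y by measurable
  \<comment> \<open>The vertical oscillation: x is held fixed and the averages run over the second
    coordinate.\<close>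
  define h where "h n x y = oscillation n (U x) y" for n x y
  have h [measurable]: "(\<lambda>(x, y). h n x y) \<in> borel_measurable (borel \<Otimes>\<^sub>M borel)" for n
    unfolding h_def by measurable
  have h2 [measurable]: "(\<lambda>x. h n x y) \<in> borel_measurable borel" for n y by measurable
  have mC [measurable]: "(\<lambda>p. INF n. h n (fst p) (snd p)) \<in> borel_measurable (lborel \<Otimes>\<^sub>M lborel)"
    by measurable
  have mB [measurable]: "(\<lambda>p. INF m. oscillation m (\<lambda>x. U x (snd p)) (fst p)) \<in> borel_measurable (lborel \<Otimes>\<^sub>M lborel)"
    by measurable
  have mA [measurable]: "(\<lambda>p. INF m. local_max m (\<lambda>z. h n z (snd p)) (fst p)) \<in> borel_measurable (lborel \<Otimes>\<^sub>M lborel)"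
    "(\<lambda>p. h n (fst p) (snd p)) \<in> borel_measurable (lborel \<Otimes>\<^sub>M lborel)" for n
    by measurable
  let ?M2 = "lborel \<Otimes>\<^sub>M lborel :: (real \<times> real) measure"
  \<comment> \<open>Measurability of these sets is required for passing between iterated and product
    almost everywhere statements.\<close>
  have sets0: "{p \<in> space ?M2. F p = (0::ennreal)} \<in> sets ?M2" if "F \<in> borel_measurable ?M2" for F
  proof -
    have "F -` {0} \<inter> space ?M2 \<in> sets ?M2" using that by (rule measurable_sets) auto
    then show ?thesis by (simp only: vimage_def Int_def Collect_conj_eq[symmetric] mem_Collect_eq singleton_iff conj_commute)
  qed
  note sC = sets0[OF mC] and sB = sets0[OF mB]
  have sA: "{p \<in> space ?M2. \<forall>n. (INF m. local_max m (\<lambda>z. h n z (snd p)) (fst p)) \<le> h n (fst p) (snd p)} \<in> sets ?M2"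
    using mA by measurable
  have le: "\<bar>t\<bar> \<le> \<bar>t\<bar> * (1 + log_plus \<bar>t\<bar>)" for t
    using mult_left_mono[of 1 "1 + log_plus \<bar>t\<bar>" "\<bar>t\<bar>"] log_plus_nonneg[of "\<bar>t\<bar>"] by simp
  have fin1: "(\<integral>\<^sup>+x. \<integral>\<^sup>+y. ennreal \<bar>U x y\<bar> \<partial>lborel \<partial>lborel) < \<infinity>"
    by (rule le_less_trans[OF _ fin]) (intro nn_integral_mono ennreal_leI le)
  have "AE x in lborel. (\<integral>\<^sup>+y. ennreal \<bar>U x y\<bar> \<partial>lborel) \<noteq> \<infinity>"
    by (rule nn_integral_PInf_AE) (use fin1 in auto)
  then have "AE x in lborel. AE y in lborel. (INF n. h n x y) = 0"
  proof eventually_elim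
    case (elim x)
    show ?case unfolding h_def oscillation_def
    proof (rule lebesgue_points)
      fix k :: nat
      have "(\<integral>\<^sup>+y. ennreal \<bar>U x y\<bar> * indicator {- real k..real k} y \<partial>lborel) \<le> (\<integral>\<^sup>+y. ennreal \<bar>U x y\<bar> \<partial>lborel)"
        by (intro nn_integral_mono) (auto simp: indicator_def)
      also have "\<dots> < \<infinity>" using elim by (simp add: less_top)
      finally show "(\<integral>\<^sup>+y. ennreal \<bar>U x y\<bar> * indicator {- real k..real k} y \<partial>lborel) < \<infinity>" .
    qed measurable
  qed
  then have C: "AE p in lborel \<Otimes>\<^sub>M lborel. (INF n. h n (fst p) (snd p)) = 0"
    by (rule iffD1[OF lborel_pair.AE_pair_iff[where P = "\<lambda>x y. (INF n. h n x y) = 0", OF sC]])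
  have "(\<integral>\<^sup>+y. \<integral>\<^sup>+x. ennreal \<bar>U x y\<bar> \<partial>lborel \<partial>lborel) = (\<integral>\<^sup>+x. \<integral>\<^sup>+y. ennreal \<bar>U x y\<bar> \<partial>lborel \<partial>lborel)"
    by (rule lborel_pair.Fubini') auto
  then have "AE y in lborel. (\<integral>\<^sup>+x. ennreal \<bar>U x y\<bar> \<partial>lborel) \<noteq> \<infinity>"
    by (intro nn_integral_PInf_AE) (use fin1 in auto)
  then have "AE y in lborel. AE x in lborel. (INF m. oscillation m (\<lambda>x. U x y) x) = 0"
  proof eventually_elim
    case (elim y)
    show ?case unfolding oscillation_def
    proof (rule lebesgue_points)
      fix k :: nat
      have "(\<integral>\<^sup>+x. ennreal \<bar>U x y\<bar> * indicator {- real k..real k} x \<partial>lborel) \<le> (\<integral>\<^sup>+x. ennreal \<bar>U x y\<bar> \<partial>lborel)"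
        by (intro nn_integral_mono) (auto simp: indicator_def)
      also have "\<dots> < \<infinity>" using elim by (simp add: less_top)
      finally show "(\<integral>\<^sup>+x. ennreal \<bar>U x y\<bar> * indicator {- real k..real k} x \<partial>lborel) < \<infinity>" .
    qed measurable
  qed
  then have "AE x in lborel. AE y in lborel. (INF m. oscillation m (\<lambda>x. U x y) x) = 0"
    by (rule iffD2[OF lborel_pair.AE_commute[where P = "\<lambda>x y. (INF m. oscillation m (\<lambda>x. U x y) x) = 0", OF sB]])
  then have B: "AE p in lborel \<Otimes>\<^sub>M lborel. (INF m. oscillation m (\<lambda>x. U x (snd p)) (fst p)) = 0"
    by (rule iffD1[OF lborel_pair.AE_pair_iff[where P = "\<lambda>x y. (INF m. oscillation m (\<lambda>x. U x y) x) = 0", OF sB]])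
  \<comment> \<open>Integrability of \<open>h n\<close> on squares. On a vertical line
    \<open>h n\<close> is at most the local maximal function plus the absolute value of U, and the
    \<open>L log L\<close> integral bounds both: 21 below is 20 for the former and 1 for the
    latter.\<close>
  have hfin: "(\<integral>\<^sup>+y. (\<integral>\<^sup>+x. h n x y * indicator {- real k..real k} x \<partial>lborel) * indicator {- real k..real k} y \<partial>lborel) < \<infinity>"
    for n k :: nat
  proof -
    let ?I = "{- real k..real k}"
    have "(\<integral>\<^sup>+y. (\<integral>\<^sup>+x. h n x y * indicator ?I x \<partial>lborel) * indicator ?I y \<partial>lborel) =
      (\<integral>\<^sup>+y. (\<integral>\<^sup>+x. h n x y * indicator ?I x * indicator ?I y \<partial>lborel) \<partial>lborel)"
      by (intro nn_integral_cong nn_integral_multc[symmetric]) auto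
    also have "\<dots> = (\<integral>\<^sup>+x. (\<integral>\<^sup>+y. h n x y * indicator ?I x * indicator ?I y \<partial>lborel) \<partial>lborel)"
      by (rule lborel_pair.Fubini') auto
    also have "\<dots> \<le> (\<integral>\<^sup>+x. ennreal (2 * real k) * indicator ?I x +
        21 * (\<integral>\<^sup>+y. ennreal (\<bar>U x y\<bar> * (1 + log_plus \<bar>U x y\<bar>)) \<partial>lborel) \<partial>lborel)"
    proof (rule nn_integral_mono)
      fix x
      have "(\<integral>\<^sup>+y. h n x y * indicator ?I x * indicator ?I y \<partial>lborel) \<le>
         (\<integral>\<^sup>+y. (local_max n (\<lambda>z. ennreal \<bar>U x z\<bar>) y * indicator ?I y + ennreal \<bar>U x y\<bar>) * indicator ?I x \<partial>lborel)"
        using oscillation_le[of "U x" n] by (intro nn_integral_mono) (auto simp: h_def indicator_def)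
      also have "\<dots> = ((\<integral>\<^sup>+y. local_max n (\<lambda>z. ennreal \<bar>U x z\<bar>) y * indicator ?I y \<partial>lborel) +
          (\<integral>\<^sup>+y. ennreal \<bar>U x y\<bar> \<partial>lborel)) * indicator ?I x"
        by (subst nn_integral_multc) (auto simp: nn_integral_add)
      also have "\<dots> \<le> ((emeasure lborel ?I + 20 * (\<integral>\<^sup>+y. ennreal (\<bar>U x y\<bar> * (1 + log_plus \<bar>U x y\<bar>)) \<partial>lborel)) +
          (\<integral>\<^sup>+y. ennreal (\<bar>U x y\<bar> * (1 + log_plus \<bar>U x y\<bar>)) \<partial>lborel)) * indicator ?I x"
        by (intro mult_right_mono add_mono nn_integral_local_max_le nn_integral_mono ennreal_leI le) auto
      also have "\<dots> = (ennreal (2 * real k) + 21 * (\<integral>\<^sup>+y. ennreal (\<bar>U x y\<bar> * (1 + log_plus \<bar>U x y\<bar>)) \<partial>lborel)) * indicator ?I x"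
        by (simp add: add.assoc distrib_right[of 20 1, simplified])
      also have "\<dots> \<le> ennreal (2 * real k) * indicator ?I x +
        21 * (\<integral>\<^sup>+y. ennreal (\<bar>U x y\<bar> * (1 + log_plus \<bar>U x y\<bar>)) \<partial>lborel)"
        by (auto simp: indicator_def)
      finally show "(\<integral>\<^sup>+y. h n x y * indicator ?I x * indicator ?I y \<partial>lborel) \<le> \<dots>" .
    qed
    also have "\<dots> = ennreal (2 * real k) * emeasure lborel ?I +
        21 * (\<integral>\<^sup>+x. \<integral>\<^sup>+y. ennreal (\<bar>U x y\<bar> * (1 + log_plus \<bar>U x y\<bar>)) \<partial>lborel \<partial>lborel)"
      by (subst nn_integral_add) (auto simp: nn_integral_cmult)
    also have "\<dots> < \<infinity>" using fin by (auto simp: ennreal_mult_less_top)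
    finally show ?thesis .
  qed
  have "AE y in lborel. \<forall>n k. (\<integral>\<^sup>+x. h n x y * indicator {- real k..real k} x \<partial>lborel) * indicator {- real k..real k} y \<noteq> \<infinity>"
    unfolding AE_all_countable
    by (intro allI nn_integral_PInf_AE) (use hfin in \<open>auto simp: less_top\<close>)
  then have "AE y in lborel. AE x in lborel. \<forall>n. (INF m. local_max m (\<lambda>z. h n z y) x) \<le> h n x y"
  proof eventually_elim
    case (elim y)
    show ?case unfolding AE_all_countable
    proof (intro allI local_max_differentiation)
      fix n k :: nat
      \<comment> \<open>The window is enlarged to contain y, so that the outer indicator is 1 at
        y.\<close>
      obtain l where l: "max \<bar>y\<bar> (real k) \<le> real l" using real_arch_simple by blast
      have "(\<integral>\<^sup>+x. h n x y * indicator {- real k..real k} x \<partial>lborel) \<le>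
        (\<integral>\<^sup>+x. h n x y * indicator {- real l..real l} x \<partial>lborel)"
        using l by (intro nn_integral_mono) (auto simp: indicator_def)
      also have "\<dots> = (\<integral>\<^sup>+x. h n x y * indicator {- real l..real l} x \<partial>lborel) * indicator {- real l..real l} y"
        using l by (auto simp: indicator_def)
      also have "\<dots> < \<infinity>" using elim by (simp add: less_top)
      finally show "(\<integral>\<^sup>+x. h n x y * indicator {- real k..real k} x \<partial>lborel) < \<infinity>" .
    qed measurable
  qed
  then have "AE x in lborel. AE y in lborel. \<forall>n. (INF m. local_max m (\<lambda>z. h n z y) x) \<le> h n x y"
    by (rule iffD2[OF lborel_pair.AE_commute[where P = "\<lambda>x y. \<forall>n. (INF m. local_max m (\<lambda>z. h n z y) x) \<le> h n x y", OF sA]])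
  then have A: "AE p in lborel \<Otimes>\<^sub>M lborel. \<forall>n. (INF m. local_max m (\<lambda>z. h n z (snd p)) (fst p)) \<le> h n (fst p) (snd p)"
    by (rule iffD1[OF lborel_pair.AE_pair_iff[where P = "\<lambda>x y. \<forall>n. (INF m. local_max m (\<lambda>z. h n z y) x) \<le> h n x y", OF sA]])
  show ?thesis using A B C
  proof eventually_elim
    case (elim p)
    obtain x y where p: "p = (x, y)" by (cases p)
    show ?case unfolding p fst_conv snd_conv
    proof (intro allI impI)
      fix \<epsilon> :: real assume "\<epsilon> > 0"
      let ?e = "ennreal (\<epsilon> / 2)"
      have e: "0 < ?e" using \<open>\<epsilon> > 0\<close> by simp
      \<comment> \<open>The order of choice matters: first n from C, then m from A applied to
        \<open>h n\<close>, so that m may depend on n; k comes from B. Their maximum works because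
        all three quantities decrease in the index.\<close>
      have "(INF n. h n x y) < ?e" using elim(3) e by (simp add: p)
      then obtain n where n: "h n x y < ?e" by (auto simp: INF_less_iff)
      then have "(INF m. local_max m (\<lambda>z. h n z y) x) < ?e" using elim(1) by (auto simp: p intro: le_less_trans)
      then obtain m where m: "local_max m (\<lambda>z. h n z y) x < ?e" by (auto simp: INF_less_iff)
      have "(INF m. oscillation m (\<lambda>x. U x y) x) < ?e" using elim(2) e by (simp add: p)
      then obtain k where k: "oscillation k (\<lambda>x. U x y) x < ?e" by (auto simp: INF_less_iff)
      define N where "N = max n (max m k)"
      have N: "n \<le> N" "m \<le> N" "k \<le> N" by (auto simp: N_def)
      have "(\<integral>\<^sup>+z. (\<integral>\<^sup>+w. ennreal \<bar>U z w - U x y\<bar> * indicator {c..d} w \<partial>lborel) * indicator {a..b} z \<partial>lborel)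
       \<le> ennreal \<epsilon> * ennreal ((b - a) * (d - c))"
        if ab: "(a, b) \<in> rat_intervals N" and cd: "(c, d) \<in> rat_intervals N"
          and xy: "a < x" "x < b" "c < y" "y < d" for a b c d
      proof -
        have pos: "b - a > 0" "d - c > 0" using xy by auto
        \<comment> \<open>Go from (x, y) to (z, w) through (z, y): the vertical move costs the
          oscillation on the line through z, the horizontal move costs
          \<open>\<bar>U z y - U x y\<bar>\<close>.\<close>
        have inner: "(\<integral>\<^sup>+w. ennreal \<bar>U z w - U x y\<bar> * indicator {c..d} w \<partial>lborel) \<le>
           (h n z y + ennreal \<bar>U z y - U x y\<bar>) * ennreal (d - c)" for z
        proof -
          have "(\<integral>\<^sup>+w. ennreal \<bar>U z w - U x y\<bar> * indicator {c..d} w \<partial>lborel) \<le>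
            (\<integral>\<^sup>+w. ennreal \<bar>U z w - U z y\<bar> * indicator {c..d} w + ennreal \<bar>U z y - U x y\<bar> * indicator {c..d} w \<partial>lborel)"
            by (intro nn_integral_mono) (auto simp: indicator_def ennreal_plus[symmetric] intro!: ennreal_leI simp del: ennreal_plus)
          also have "\<dots> = (\<integral>\<^sup>+w. ennreal \<bar>U z w - U z y\<bar> * indicator {c..d} w \<partial>lborel) + ennreal \<bar>U z y - U x y\<bar> * ennreal (d - c)"
            using pos by (subst nn_integral_add) (auto simp: nn_integral_cmult)
          also have "(\<integral>\<^sup>+w. ennreal \<bar>U z w - U z y\<bar> * indicator {c..d} w \<partial>lborel) \<le> oscillation N (U z) y * ennreal (d - c)"
            unfolding oscillation_def by (rule nn_integral_le_local_max) (use cd xy in auto)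
          also have "\<dots> \<le> h n z y * ennreal (d - c)"
            unfolding h_def oscillation_def by (intro mult_right_mono local_max_antimono N) auto
          finally show ?thesis by (simp add: distrib_right add_right_mono)
        qed
        have "(\<integral>\<^sup>+z. (\<integral>\<^sup>+w. ennreal \<bar>U z w - U x y\<bar> * indicator {c..d} w \<partial>lborel) * indicator {a..b} z \<partial>lborel)
          \<le> (\<integral>\<^sup>+z. (h n z y * indicator {a..b} z + ennreal \<bar>U z y - U x y\<bar> * indicator {a..b} z) * ennreal (d - c) \<partial>lborel)"
          using inner by (intro nn_integral_mono) (auto simp: indicator_def)
        also have "\<dots> = ((\<integral>\<^sup>+z. h n z y * indicator {a..b} z \<partial>lborel) +
            (\<integral>\<^sup>+z. ennreal \<bar>U z y - U x y\<bar> * indicator {a..b} z \<partial>lborel)) * ennreal (d - c)"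
          by (subst nn_integral_multc) (auto simp: nn_integral_add)
        also have "\<dots> \<le> (local_max N (\<lambda>z. h n z y) x * ennreal (b - a) +
           oscillation N (\<lambda>x. U x y) x * ennreal (b - a)) * ennreal (d - c)"
          unfolding oscillation_def
          by (intro mult_right_mono add_mono nn_integral_le_local_max) (use ab xy in auto)
        also have "\<dots> \<le> (?e * ennreal (b - a) + ?e * ennreal (b - a)) * ennreal (d - c)"
        proof (intro mult_right_mono add_mono)
          show "local_max N (\<lambda>z. h n z y) x \<le> ?e"
            using local_max_antimono[OF N(2), of "\<lambda>z. h n z y" x] m by (auto intro: order.trans less_imp_le)
          show "oscillation N (\<lambda>x. U x y) x \<le> ?e"
            using local_max_antimono[OF N(3), of _ x] k unfolding oscillation_def by (meson le_less_trans less_imp_le)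
        qed auto
        also have "\<dots> = ennreal \<epsilon> * ennreal ((b - a) * (d - c))"
        proof -
          have "?e * ennreal (b - a) + ?e * ennreal (b - a) = (?e + ?e) * ennreal (b - a)" by (simp only: distrib_right)
          also have "?e + ?e = ennreal \<epsilon>" using \<open>\<epsilon> > 0\<close> by (subst ennreal_plus[symmetric]) auto
          finally show ?thesis using pos by (simp add: ennreal_mult mult.assoc)
        qed
        finally show ?thesis .
      qed
      then show "\<exists>n. \<forall>(a, b)\<in>rat_intervals n. \<forall>(c, d)\<in>rat_intervals n.
         a < x \<and> x < b \<and> c < y \<and> y < d \<longrightarrow>
         (\<integral>\<^sup>+z. (\<integral>\<^sup>+w. ennreal \<bar>U z w - U x y\<bar> * indicator {c..d} w \<partial>lborel) * indicator {a..b} z \<partial>lborel)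
           \<le> ennreal \<epsilon> * ennreal ((b - a) * (d - c))"
        by (intro exI[of _ N]) auto
    qed
  qed
qed

section \<open>Plane rectangles\<close>

text \<open>A combination of axis vectors, so that continuity, and with it Borel measurability,
  comes from the standard rules.\<close>

definition vec2 :: "real \<Rightarrow> real \<Rightarrow> real^2" where
  "vec2 x y = x *\<^sub>R axis 1 1 + y *\<^sub>R axis 2 1"

lemma vec2_nth [simp]: "vec2 x y $ 1 = x" "vec2 x y $ 2 = y"
  by (simp_all add: vec2_def axis_def)

lemma vec2_collapse [simp]: "vec2 (z $ 1) (z $ 2) = z"
  by (simp add: vec_eq_iff forall_2)

lemma vec2_measurable [measurable]: "(\<lambda>(x, y). vec2 x y) \<in> borel_measurable (borel \<Otimes>\<^sub>M borel)"
  unfolding vec2_def borel_prod split_beta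
  by (intro borel_measurable_continuous_onI continuous_intros)

lemma vec_nth_borel_measurable [measurable]: "(\<lambda>z::real^2. z $ i) \<in> borel_measurable borel"
  by (intro borel_measurable_continuous_onI continuous_intros)

lemma Basis_real2: "(Basis :: (real^2) set) = {axis 1 1, axis 2 1}"
  by (auto simp: Basis_vec_def UNIV_2)

text \<open>Lebesgue measure is determined by its values on boxes, and the preimage of a box under
  \<open>vec2\<close> is a product of two intervals.\<close>

lemma lborel_real2: "lborel = distr (lborel \<Otimes>\<^sub>M lborel) borel (\<lambda>(x, y). vec2 x y)"
proof (rule lborel_eqI)
  fix l u :: "real^2" assume le: "\<And>b. b \<in> Basis \<Longrightarrow> l \<bullet> b \<le> u \<bullet> b"
  have le: "l $ 1 \<le> u $ 1" "l $ 2 \<le> u $ 2" using le[of "axis 1 1"] le[of "axis 2 1"] by (simp_all add: Basis_real2 inner_axis)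
  have ne: "axis 1 1 \<noteq> (axis 2 1 :: real^2)" by (simp add: axis_eq_axis)
  have "(\<lambda>(x, y). vec2 x y) -` box l u \<inter> space (lborel \<Otimes>\<^sub>M lborel) = {l $ 1<..<u $ 1} \<times> {l $ 2<..<u $ 2}"
    by (auto simp: box_def Basis_real2 inner_axis space_pair_measure)
  then have "emeasure (distr (lborel \<Otimes>\<^sub>M lborel) borel (\<lambda>(x, y). vec2 x y)) (box l u) =
      emeasure (lborel \<Otimes>\<^sub>M lborel) ({l $ 1<..<u $ 1} \<times> {l $ 2<..<u $ 2})"
    by (subst emeasure_distr) auto
  also have "\<dots> = ennreal (u $ 1 - l $ 1) * ennreal (u $ 2 - l $ 2)"
    using le by (subst lborel.emeasure_pair_measure_Times) auto
  also have "\<dots> = (\<Prod>b\<in>Basis. (u - l) \<bullet> b)"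
    using le ne by (simp add: Basis_real2 inner_axis ennreal_mult)
  finally show "emeasure (distr (lborel \<Otimes>\<^sub>M lborel) borel (\<lambda>(x, y). vec2 x y)) (box l u) = (\<Prod>b\<in>Basis. (u - l) \<bullet> b)" .
qed simp

lemma nn_integral_real2:
  assumes [measurable]: "F \<in> borel_measurable borel"
  shows "(\<integral>\<^sup>+z. F z \<partial>lborel) = (\<integral>\<^sup>+x. \<integral>\<^sup>+y. F (vec2 x y) \<partial>lborel \<partial>lborel)"
proof -
  have "(\<integral>\<^sup>+z. F z \<partial>lborel) = (\<integral>\<^sup>+p. F (case p of (x, y) \<Rightarrow> vec2 x y) \<partial>(lborel \<Otimes>\<^sub>M lborel))"
    by (subst lborel_real2, subst nn_integral_distr) auto
  also have "\<dots> = (\<integral>\<^sup>+x. \<integral>\<^sup>+y. F (vec2 x y) \<partial>lborel \<partial>lborel)"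
    by (subst lborel.nn_integral_fst[symmetric]) (auto simp: split_beta)
  finally show ?thesis .
qed

lemma emeasure_real2_Times:
  assumes [measurable]: "A \<in> sets borel" "B \<in> sets borel"
  shows "emeasure lborel {z::real^2. z $ 1 \<in> A \<and> z $ 2 \<in> B} = emeasure lborel A * emeasure lborel B"
proof -
  have "emeasure lborel {z::real^2. z $ 1 \<in> A \<and> z $ 2 \<in> B} =
      emeasure (lborel \<Otimes>\<^sub>M lborel) (A \<times> B)"
    by (subst lborel_real2, subst emeasure_distr)
       (auto simp: space_pair_measure intro!: arg_cong2[where f=emeasure])
  then show ?thesis by (simp add: lborel.emeasure_pair_measure_Times)
qed

text \<open>The inverse map, the pair of coordinates, carries a null set of the product to a null
  set of the plane.\<close>

lemma AE_real2I:
  assumes "AE p in lborel \<Otimes>\<^sub>M lborel. P (vec2 (fst p) (snd p))"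
  shows "AE z in lborel. P (z :: real^2)"
proof -
  obtain N where N: "N \<in> null_sets (lborel \<Otimes>\<^sub>M lborel)" "{p. \<not> P (vec2 (fst p) (snd p))} \<subseteq> N"
    using assms by (auto simp: eventually_ae_filter space_pair_measure)
  let ?W = "\<lambda>z::real^2. (z $ 1, z $ 2)"
  have [measurable]: "N \<in> sets (borel \<Otimes>\<^sub>M borel)" using N by (auto simp: null_sets_def cong: sets_pair_measure_cong)
  have "?W \<in> borel \<rightarrow>\<^sub>M borel \<Otimes>\<^sub>M borel" by measurable
  from measurable_sets[OF this, of N] have m: "?W -` N \<in> sets borel" by simp
  have "(\<lambda>(x, y). vec2 x y) -` ?W -` N \<inter> space (lborel \<Otimes>\<^sub>M lborel) = N"
    by (auto simp: space_pair_measure)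
  then have "emeasure lborel (?W -` N) = emeasure (lborel \<Otimes>\<^sub>M lborel) N"
    using m by (subst lborel_real2, subst emeasure_distr) auto
  then have "?W -` N \<in> null_sets lborel" using m N(1) by (auto simp: null_sets_def)
  moreover have "{z. \<not> P z} \<subseteq> ?W -` N" using N(2) by force
  ultimately show ?thesis by (auto simp: eventually_ae_filter)
qed

lemma emeasure_real2_box:
  assumes "a \<ge> 0" "b \<ge> 0"
  shows "emeasure lborel {z::real^2. \<bar>z $ 1 - p\<bar> \<le> a \<and> \<bar>z $ 2 - q\<bar> \<le> b} = ennreal (4 * (a * b))"
proof -
  have "{z::real^2. \<bar>z $ 1 - p\<bar> \<le> a \<and> \<bar>z $ 2 - q\<bar> \<le> b} =
      {z. z $ 1 \<in> {p - a..p + a} \<and> z $ 2 \<in> {q - b..q + b}}" by auto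
  then show ?thesis using assms
    by (simp only:) (subst emeasure_real2_Times, auto simp: ennreal_mult[symmetric])
qed

section \<open>Flat rectangles compared with axis-parallel boxes\<close>

lemma open_rectangle_coords:
  "z \<in> open_rectangle c \<phi> L l \<longleftrightarrow>
    \<bar>(z $ 1 - c $ 1) * cos \<phi> + (z $ 2 - c $ 2) * sin \<phi>\<bar> < L / 2 \<and>
    \<bar>- (z $ 1 - c $ 1) * sin \<phi> + (z $ 2 - c $ 2) * cos \<phi>\<bar> < l / 2"
  by (simp add: open_rectangle_def inner_vec_def sum_2 left_diff_distrib)

lemma open_open_rectangle: "open (open_rectangle c \<phi> L l)"
  unfolding open_rectangle_def
  by (intro open_Collect_conj open_Collect_less continuous_intros)

lemma abs_mult_le: "\<bar>a\<bar> \<le> A \<Longrightarrow> \<bar>b\<bar> \<le> B \<Longrightarrow> \<bar>a * b\<bar> \<le> A * (B::real)"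
  by (simp add: abs_mult mult_mono')

text \<open>The condition \<open>flat\<close> says that the long side rises by at most
  \<open>\<kappa>\<close> times the thickness; up to factors depending on \<open>\<kappa>\<close>
  the tilt can then be ignored.\<close>

locale flat_rectangle =
  fixes \<kappa> \<theta> L l :: real
  assumes kappa: "1 \<le> \<kappa>" and angle: "0 \<le> sin \<theta>" "0 \<le> cos \<theta>"
    and l_pos: "0 < l" and l_le: "l \<le> L" and flat: "L * sin \<theta> \<le> \<kappa> * l"
begin

lemma L_pos: "0 < L"
  using l_pos l_le by simp

lemma open_rectangle_subset_box:
  "open_rectangle c \<theta> L l \<subseteq> {z. \<bar>z $ 1 - c $ 1\<bar> \<le> L \<and> \<bar>z $ 2 - c $ 2\<bar> \<le> \<kappa> * l}"
proof
  fix z assume z: "z \<in> open_rectangle c \<theta> L l"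
  \<comment> \<open>Coordinates of z - c in the rotated frame. Inverting the rotation bounds the
    vertical distance to c by L sin \<theta> / 2 + l / 2, which is at most \<kappa> l.\<close>
  define A where "A = (z $ 1 - c $ 1) * cos \<theta> + (z $ 2 - c $ 2) * sin \<theta>"
  define B where "B = - (z $ 1 - c $ 1) * sin \<theta> + (z $ 2 - c $ 2) * cos \<theta>"
  have AB: "\<bar>A\<bar> \<le> L / 2" "\<bar>B\<bar> \<le> l / 2" using z by (auto simp: open_rectangle_coords A_def B_def)
  have sc: "sin \<theta> * sin \<theta> + cos \<theta> * cos \<theta> = 1" using sin_cos_squared_add3[of \<theta>] by (simp add: add.commute)
  have "z $ 1 - c $ 1 = (z $ 1 - c $ 1) * (sin \<theta> * sin \<theta> + cos \<theta> * cos \<theta>)" by (simp add: sc)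
  also have "\<dots> = A * cos \<theta> - B * sin \<theta>" unfolding A_def B_def by algebra
  finally have 1: "z $ 1 - c $ 1 = A * cos \<theta> - B * sin \<theta>" .
  have "z $ 2 - c $ 2 = (z $ 2 - c $ 2) * (sin \<theta> * sin \<theta> + cos \<theta> * cos \<theta>)" by (simp add: sc)
  also have "\<dots> = A * sin \<theta> + B * cos \<theta>" unfolding A_def B_def by algebra
  finally have 2: "z $ 2 - c $ 2 = A * sin \<theta> + B * cos \<theta>" .
  have "\<bar>A * cos \<theta>\<bar> \<le> L / 2 * 1" "\<bar>B * sin \<theta>\<bar> \<le> l / 2 * 1" "\<bar>B * cos \<theta>\<bar> \<le> l / 2 * 1"
    by (rule abs_mult_le; use AB in simp)+
  moreover have "\<bar>A * sin \<theta>\<bar> \<le> L / 2 * sin \<theta>"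
    using AB angle by (intro abs_mult_le) auto
  moreover have "1 * l \<le> \<kappa> * l" using kappa l_pos by (intro mult_right_mono) auto
  ultimately show "z \<in> {z. \<bar>z $ 1 - c $ 1\<bar> \<le> L \<and> \<bar>z $ 2 - c $ 2\<bar> \<le> \<kappa> * l}"
    using 1 2 flat l_le by auto
qed

text \<open>The factor \<open>\<kappa>\<close> in the width keeps the horizontal displacement times
  sin \<theta> at most l/8, and l/8 + l/4 < l/2. In the long direction L/8 + l/4 < L/2.\<close>

lemma box_subset_open_rectangle:
  "{z. \<bar>z $ 1 - c $ 1\<bar> \<le> L / (8 * \<kappa>) \<and> \<bar>z $ 2 - c $ 2\<bar> \<le> l / 4} \<subseteq> open_rectangle c \<theta> L l"
proof
  fix z :: "real^2" assume "z \<in> {z. \<bar>z $ 1 - c $ 1\<bar> \<le> L / (8 * \<kappa>) \<and> \<bar>z $ 2 - c $ 2\<bar> \<le> l / 4}"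
  then have z: "\<bar>z $ 1 - c $ 1\<bar> \<le> L / (8 * \<kappa>)" "\<bar>z $ 2 - c $ 2\<bar> \<le> l / 4" by auto
  have "L / (8 * \<kappa>) \<le> L / 8" using kappa L_pos by (intro divide_left_mono) auto
  with z have z1: "\<bar>z $ 1 - c $ 1\<bar> \<le> L / 8" by linarith
  have "\<bar>(z $ 1 - c $ 1) * cos \<theta>\<bar> \<le> L / 8 * 1" "\<bar>(z $ 2 - c $ 2) * sin \<theta>\<bar> \<le> l / 4 * 1"
    "\<bar>(z $ 2 - c $ 2) * cos \<theta>\<bar> \<le> l / 4 * 1"
    by (rule abs_mult_le; use z z1 in simp)+
  moreover have "\<bar>(z $ 1 - c $ 1) * sin \<theta>\<bar> \<le> L / (8 * \<kappa>) * sin \<theta>"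
    using z angle by (intro abs_mult_le) auto
  moreover have "L / (8 * \<kappa>) * sin \<theta> \<le> l / 8"
    using flat kappa by (simp add: field_simps)
  ultimately show "z \<in> open_rectangle c \<theta> L l"
    using l_pos l_le unfolding open_rectangle_coords mult_minus_left by linarith
qed

lemma bounded_open_rectangle: "bounded (open_rectangle c \<theta> L l)"
proof (rule bounded_subset[OF _ open_rectangle_subset_box])
  have "{z. \<bar>z $ 1 - c $ 1\<bar> \<le> L \<and> \<bar>z $ 2 - c $ 2\<bar> \<le> \<kappa> * l} \<subseteq>
      cbox (vec2 (c $ 1 - L) (c $ 2 - \<kappa> * l)) (vec2 (c $ 1 + L) (c $ 2 + \<kappa> * l))"
    by (auto simp: mem_box Basis_real2 inner_axis abs_le_iff)
  then show "bounded {z :: real^2. \<bar>z $ 1 - c $ 1\<bar> \<le> L \<and> \<bar>z $ 2 - c $ 2\<bar> \<le> \<kappa> * l}"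
    by (rule bounded_subset[OF bounded_cbox])
qed

text \<open>The bounds are the areas of the inner and the outer box, so their quotient depends on
  \<open>\<kappa>\<close> only.\<close>

lemma measure_open_rectangle:
  "open_rectangle c \<theta> L l \<in> lmeasurable"
  "measure lebesgue (open_rectangle c \<theta> L l) \<ge> L * l / (8 * \<kappa>)"
  "measure lebesgue (open_rectangle c \<theta> L l) \<le> 4 * \<kappa> * L * l"
proof -
  let ?R = "open_rectangle c \<theta> L l"
  show R: "?R \<in> lmeasurable"
    by (rule lmeasurable_open[OF bounded_open_rectangle open_open_rectangle])
  then have eq: "emeasure lborel ?R = ennreal (measure lebesgue ?R)"
    using emeasure_eq_measure2[OF R] borel_open[OF open_open_rectangle[of c \<theta> L l]] by simp
  have "ennreal (4 * (L / (8 * \<kappa>) * (l / 4))) =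
      emeasure lborel {z::real^2. \<bar>z $ 1 - c $ 1\<bar> \<le> L / (8 * \<kappa>) \<and> \<bar>z $ 2 - c $ 2\<bar> \<le> l / 4}"
    using l_pos L_pos kappa by (intro emeasure_real2_box[symmetric]) auto
  also have "\<dots> \<le> emeasure lborel ?R"
    using borel_open[OF open_open_rectangle[of c \<theta> L l]] by (intro emeasure_mono box_subset_open_rectangle) simp
  finally have "ennreal (4 * (L / (8 * \<kappa>) * (l / 4))) \<le> emeasure lborel ?R" .
  then have "4 * (L / (8 * \<kappa>) * (l / 4)) \<le> measure lebesgue ?R"
    unfolding eq by (subst (asm) ennreal_le_iff) auto
  then show "measure lebesgue ?R \<ge> L * l / (8 * \<kappa>)" by simp
  have "emeasure lborel ?R \<le> emeasure lborel {z::real^2. \<bar>z $ 1 - c $ 1\<bar> \<le> L \<and> \<bar>z $ 2 - c $ 2\<bar> \<le> \<kappa> * l}"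
    by (intro emeasure_mono open_rectangle_subset_box) measurable
  also have "\<dots> = ennreal (4 * (L * (\<kappa> * l)))"
    using l_pos L_pos kappa by (intro emeasure_real2_box) auto
  finally have "emeasure lborel ?R \<le> ennreal (4 * (L * (\<kappa> * l)))" .
  then have "measure lebesgue ?R \<le> 4 * (L * (\<kappa> * l))"
    unfolding eq using l_pos L_pos kappa by (subst (asm) ennreal_le_iff) auto
  then show "measure lebesgue ?R \<le> 4 * \<kappa> * L * l" by (simp add: mult_ac)
qed

text \<open>Two points of the inner box on the horizontal line through c have this distance. A small
  diameter thus forces a small L.\<close>

lemma diameter_open_rectangle_ge: "L / (4 * \<kappa>) \<le> diameter (open_rectangle c \<theta> L l)"
proof -
  let ?a = "vec2 (c $ 1 - L / (8 * \<kappa>)) (c $ 2)" and ?b = "vec2 (c $ 1 + L / (8 * \<kappa>)) (c $ 2)"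
  have "?a \<in> open_rectangle c \<theta> L l" "?b \<in> open_rectangle c \<theta> L l"
    using box_subset_open_rectangle[of c] l_pos L_pos kappa by auto
  then have "dist ?a ?b \<le> diameter (open_rectangle c \<theta> L l)"
    by (rule diameter_bounded_bound[OF bounded_open_rectangle])
  moreover have "\<bar>(?b - ?a) $ 1\<bar> \<le> norm (?b - ?a)" by (rule component_le_norm_cart)
  ultimately show ?thesis using L_pos kappa by (simp add: dist_norm norm_minus_commute)
qed

lemma diameter_open_rectangle_le: "diameter (open_rectangle c \<theta> L l) \<le> 4 * \<kappa> * L"
proof (rule diameter_le)
  show "open_rectangle c \<theta> L l \<noteq> {} \<or> 0 \<le> 4 * \<kappa> * L" using kappa L_pos by simp
  fix x y assume "x \<in> open_rectangle c \<theta> L l" "y \<in> open_rectangle c \<theta> L l"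
  then have "\<bar>x $ 1 - c $ 1\<bar> \<le> L" "\<bar>x $ 2 - c $ 2\<bar> \<le> \<kappa> * l" "\<bar>y $ 1 - c $ 1\<bar> \<le> L" "\<bar>y $ 2 - c $ 2\<bar> \<le> \<kappa> * l"
    using open_rectangle_subset_box[of c] by auto
  moreover have "norm (x - y) \<le> (\<Sum>i\<in>UNIV. \<bar>(x - y) $ i\<bar>)" by (rule norm_le_l1_cart)
  moreover have "\<kappa> * l \<le> \<kappa> * L" using kappa l_le by simp
  moreover have "1 * L \<le> \<kappa> * L" using kappa L_pos by (intro mult_right_mono) auto
  ultimately show "norm (x - y) \<le> 4 * \<kappa> * L" by (simp add: sum_2)
qed

end

section \<open>Differentiation of \<open>L log L\<close> by flat rectangles\<close>

lemma eventually_shrinking_filter: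
  "eventually P (shrinking_filter \<B> x) \<longleftrightarrow>
    (\<exists>d>0. \<forall>B\<in>\<B>. x \<in> B \<longrightarrow> bounded B \<longrightarrow> diameter B < d \<longrightarrow> P B)"
  unfolding shrinking_filter_def eventually_inf_principal eventually_filtercomap eventually_nhds_metric
proof safe
  fix Q d assume "0 < (d::real)" "\<forall>B. dist B 0 < d \<longrightarrow> Q B"
    "\<forall>B. Q (diameter B) \<longrightarrow> B \<in> {B \<in> \<B>. x \<in> B \<and> bounded B} \<longrightarrow> P B"
  then show "\<exists>d>0. \<forall>B\<in>\<B>. x \<in> B \<longrightarrow> bounded B \<longrightarrow> diameter B < d \<longrightarrow> P B"
    by (intro exI[of _ d]) (auto simp: dist_real_def abs_of_nonneg diameter_ge_0)
next
  fix d assume "0 < (d::real)" "\<forall>B\<in>\<B>. x \<in> B \<longrightarrow> bounded B \<longrightarrow> diameter B < d \<longrightarrow> P B"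
  then show "\<exists>Q. (\<exists>d>0. \<forall>x. dist x 0 < d \<longrightarrow> Q x) \<and>
    (\<forall>B. Q (diameter B) \<longrightarrow> B \<in> {B \<in> \<B>. x \<in> B \<and> bounded B} \<longrightarrow> P B)"
    by (intro exI[of _ "\<lambda>r. r < d"]) (auto simp: dist_real_def)
qed

text \<open>From t \<le> t (1 + log_plus t) with t the absolute value of f divided by \<mu>.\<close>

lemma L_log_L_integrable:
  assumes "f \<in> L_log_L"
  shows "integrable lebesgue f"
proof -
  obtain \<mu> where f [measurable]: "f \<in> borel_measurable lebesgue" and \<mu>: "\<mu> > 0"
    and fin: "(\<integral>\<^sup>+x. ennreal (\<bar>f x\<bar> / \<mu> * (1 + log_plus (\<bar>f x\<bar> / \<mu>))) \<partial>lebesgue) < \<infinity>"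
    using assms unfolding L_log_L_def orlicz_space_def by auto
  have "(\<integral>\<^sup>+x. ennreal (norm (f x)) \<partial>lebesgue) \<le>
      (\<integral>\<^sup>+x. ennreal \<mu> * ennreal (\<bar>f x\<bar> / \<mu> * (1 + log_plus (\<bar>f x\<bar> / \<mu>))) \<partial>lebesgue)"
  proof (rule nn_integral_mono)
    fix x
    have "\<bar>f x\<bar> / \<mu> * 1 \<le> \<bar>f x\<bar> / \<mu> * (1 + log_plus (\<bar>f x\<bar> / \<mu>))"
      using \<mu> log_plus_nonneg[of "\<bar>f x\<bar> / \<mu>"] by (intro mult_left_mono) auto
    then have "\<mu> * (\<bar>f x\<bar> / \<mu> * 1) \<le> \<mu> * (\<bar>f x\<bar> / \<mu> * (1 + log_plus (\<bar>f x\<bar> / \<mu>)))"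
      by (rule mult_left_mono) (use \<mu> in simp)
    then show "ennreal (norm (f x)) \<le> ennreal \<mu> * ennreal (\<bar>f x\<bar> / \<mu> * (1 + log_plus (\<bar>f x\<bar> / \<mu>)))"
      using \<mu> log_plus_nonneg[of "\<bar>f x\<bar> / \<mu>"] by (subst ennreal_mult[symmetric]) (auto intro: ennreal_leI)
  qed
  also have "\<dots> = ennreal \<mu> * (\<integral>\<^sup>+x. ennreal (\<bar>f x\<bar> / \<mu> * (1 + log_plus (\<bar>f x\<bar> / \<mu>))) \<partial>lebesgue)"
    by (rule nn_integral_cmult) measurable
  also have "\<dots> < \<infinity>" using fin by (auto simp: ennreal_mult_less_top)
  finally show ?thesis by (intro integrableI_bounded) auto
qed

lemma L_log_L_subset_L1_loc: "L_log_L \<subseteq> L1_loc"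
proof
  fix f assume f: "f \<in> L_log_L"
  have "set_integrable lebesgue K f" if "compact K" for K
    using integrable_mult_indicator[OF _ L_log_L_integrable[OF f], of K] lmeasurable_compact[OF that]
    unfolding set_integrable_def by (auto dest: fmeasurableD)
  with L_log_L_integrable[OF f] show "f \<in> L1_loc" by (auto simp: L1_loc_def)
qed

lemma abs_average_minus_le:
  fixes f :: "'a::euclidean_space \<Rightarrow> real"
  assumes R: "R \<in> lmeasurable" "measure lebesgue R > 0" and f: "integrable lebesgue f" and K: "K \<ge> 0"
    and le: "(\<integral>\<^sup>+z. ennreal \<bar>f z - v\<bar> * indicator R z \<partial>lebesgue) \<le> ennreal (K * measure lebesgue R)"
  shows "\<bar>(LINT z:R|lebesgue. f z) / measure lebesgue R - v\<bar> \<le> K"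
proof -
  have R': "R \<in> sets lebesgue" by (rule fmeasurableD[OF R(1)])
  have i1: "integrable lebesgue (\<lambda>z. indicator R z *\<^sub>R f z)"
    using integrable_mult_indicator[OF R' f] .
  have i2: "integrable lebesgue (\<lambda>z. indicator R z *\<^sub>R v)"
    using R by (intro integrable_scaleR_left) (auto simp: fmeasurable_def)
  have "(LINT z:R|lebesgue. f z) - measure lebesgue R * v = (LINT z|lebesgue. indicator R z *\<^sub>R f z - indicator R z *\<^sub>R v)"
    unfolding set_lebesgue_integral_def using R' by (subst Bochner_Integration.integral_diff[OF i1 i2]) simp
  then have "\<bar>(LINT z:R|lebesgue. f z) - measure lebesgue R * v\<bar> \<le> (LINT z|lebesgue. \<bar>indicator R z *\<^sub>R f z - indicator R z *\<^sub>R v\<bar>)"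
    by (metis integral_abs_bound)
  also have "\<dots> \<le> K * measure lebesgue R"
  proof -
    have "ennreal (LINT z|lebesgue. \<bar>indicator R z *\<^sub>R f z - indicator R z *\<^sub>R v\<bar>) =
      (\<integral>\<^sup>+z. ennreal \<bar>indicator R z *\<^sub>R f z - indicator R z *\<^sub>R v\<bar> \<partial>lebesgue)"
      by (rule nn_integral_eq_integral[symmetric], rule integrable_abs,
          rule Bochner_Integration.integrable_diff[OF i1 i2]) simp
    also have "\<dots> = (\<integral>\<^sup>+z. ennreal \<bar>f z - v\<bar> * indicator R z \<partial>lebesgue)"
      by (intro nn_integral_cong) (auto simp: indicator_def)
    also note le
    finally show ?thesis using K by (subst (asm) ennreal_le_iff) auto
  qed
  finally have "\<bar>(LINT z:R|lebesgue. f z) - measure lebesgue R * v\<bar> \<le> K * measure lebesgue R" .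
  moreover have "(LINT z:R|lebesgue. f z) / measure lebesgue R - v =
      ((LINT z:R|lebesgue. f z) - measure lebesgue R * v) / measure lebesgue R"
    using R(2) by (simp add: field_simps)
  ultimately show ?thesis using R(2) by (simp add: abs_divide pos_divide_le_eq)
qed

lemma (in flat_rectangle) nn_integral_open_rectangle_le:
  fixes u :: "real^2 \<Rightarrow> real"
  assumes [measurable]: "u \<in> borel_measurable borel" and p: "p \<in> open_rectangle c \<theta> L l"
    and small: "4 * \<kappa> * L < 1 / Suc n"
    and avg: "\<And>a b a' b'. (a, b) \<in> rat_intervals n \<Longrightarrow> (a', b') \<in> rat_intervals n \<Longrightarrow>
      a < p $ 1 \<and> p $ 1 < b \<and> a' < p $ 2 \<and> p $ 2 < b' \<Longrightarrow>
      (\<integral>\<^sup>+z. (\<integral>\<^sup>+w. ennreal \<bar>u (vec2 z w) - u p\<bar> * indicator {a'..b'} w \<partial>lborel) * indicator {a..b} z \<partial>lborel)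
       \<le> ennreal \<epsilon> * ennreal ((b - a) * (b' - a'))"
    and eps: "\<epsilon> > 0"
  shows "(\<integral>\<^sup>+z. ennreal \<bar>u z - u p\<bar> * indicator (open_rectangle c \<theta> L l) z \<partial>lborel)
    \<le> ennreal (\<epsilon> * (16 * \<kappa> * L * l))"
proof -
  let ?R = "open_rectangle c \<theta> L l"
  have kl: "0 < \<kappa> * l" using kappa l_pos by simp
  \<comment> \<open>The rational box lies between the outer box of the rectangle and its double, so
    it contains the rectangle and has area at most 16 \<kappa> L l. Its sides are shorter than 4
    \<kappa> L, hence than 1/(n+1).\<close>
  obtain a where a: "a \<in> \<rat>" "c $ 1 - 2 * L < a" "a < c $ 1 - L"
    using Rats_dense_in_real[of "c $ 1 - 2 * L" "c $ 1 - L"] L_pos by auto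
  obtain b where b: "b \<in> \<rat>" "c $ 1 + L < b" "b < c $ 1 + 2 * L"
    using Rats_dense_in_real[of "c $ 1 + L" "c $ 1 + 2 * L"] L_pos by auto
  obtain a' where a': "a' \<in> \<rat>" "c $ 2 - 2 * (\<kappa> * l) < a'" "a' < c $ 2 - \<kappa> * l"
    using Rats_dense_in_real[of "c $ 2 - 2 * (\<kappa> * l)" "c $ 2 - \<kappa> * l"] kl by auto
  obtain b' where b': "b' \<in> \<rat>" "c $ 2 + \<kappa> * l < b'" "b' < c $ 2 + 2 * (\<kappa> * l)"
    using Rats_dense_in_real[of "c $ 2 + \<kappa> * l" "c $ 2 + 2 * (\<kappa> * l)"] kl by auto
  have ba: "b - a < 4 * L" "b' - a' < 4 * (\<kappa> * l)" "0 < b - a" "0 < b' - a'"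
    using a b a' b' L_pos kl by linarith+
  have "1 * L \<le> \<kappa> * L" "\<kappa> * l \<le> \<kappa> * L" using kappa l_le L_pos by (auto intro: mult_right_mono)
  with ba small have "b - a < 1 / Suc n" "b' - a' < 1 / Suc n" by linarith+
  then have rat: "(a, b) \<in> rat_intervals n" "(a', b') \<in> rat_intervals n"
    using a b a' b' ba by (auto simp: rat_intervals_def)
  have sub: "z $ 1 \<in> {a..b} \<and> z $ 2 \<in> {a'..b'}" "a < z $ 1 \<and> z $ 1 < b \<and> a' < z $ 2 \<and> z $ 2 < b'" if "z \<in> ?R" for z
  proof -
    have "\<bar>z $ 1 - c $ 1\<bar> \<le> L" "\<bar>z $ 2 - c $ 2\<bar> \<le> \<kappa> * l" using open_rectangle_subset_box[of c] that by auto
    then show "z $ 1 \<in> {a..b} \<and> z $ 2 \<in> {a'..b'}" "a < z $ 1 \<and> z $ 1 < b \<and> a' < z $ 2 \<and> z $ 2 < b'"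
      using a b a' b' by (auto simp: abs_le_iff)
  qed
  have "(\<integral>\<^sup>+z. ennreal \<bar>u z - u p\<bar> * indicator ?R z \<partial>lborel) \<le>
     (\<integral>\<^sup>+z. ennreal \<bar>u z - u p\<bar> * (indicator {a'..b'} (z $ 2) * indicator {a..b} (z $ 1)) \<partial>lborel)"
    using sub(1) by (intro nn_integral_mono) (auto simp: indicator_def)
  also have "\<dots> = (\<integral>\<^sup>+z. (\<integral>\<^sup>+w. ennreal \<bar>u (vec2 z w) - u p\<bar> * indicator {a'..b'} w * indicator {a..b} z \<partial>lborel) \<partial>lborel)"
    by (subst nn_integral_real2) (auto simp: mult.assoc)
  also have "\<dots> = (\<integral>\<^sup>+z. (\<integral>\<^sup>+w. ennreal \<bar>u (vec2 z w) - u p\<bar> * indicator {a'..b'} w \<partial>lborel) * indicator {a..b} z \<partial>lborel)"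
  proof (intro nn_integral_cong nn_integral_multc)
    fix z
    have "vec2 z \<in> borel_measurable borel"
      unfolding vec2_def by (intro borel_measurable_continuous_onI continuous_intros)
    then show "(\<lambda>w. ennreal \<bar>u (vec2 z w) - u p\<bar> * indicator {a'..b'} w) \<in> borel_measurable lborel"
      by measurable
  qed
  also have "\<dots> \<le> ennreal \<epsilon> * ennreal ((b - a) * (b' - a'))"
    by (rule avg[OF rat sub(2)[OF p]])
  also have "\<dots> \<le> ennreal \<epsilon> * ennreal ((4 * L) * (4 * (\<kappa> * l)))"
    using ba L_pos by (intro mult_left_mono ennreal_leI mult_mono) auto
  also have "\<dots> = ennreal (\<epsilon> * (16 * \<kappa> * L * l))"
    using eps by (simp add: ennreal_mult'[symmetric] mult_ac)
  finally show ?thesis .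
qed

text \<open>A rectangle and a suitable rational box around it have comparable areas, so the decay of
  the mean deviation over boxes passes to the rectangles of the basis.\<close>

theorem differentiates_L_log_L:
  assumes \<kappa>: "1 \<le> \<kappa>" and \<Theta>: "\<And>\<theta>. \<theta> \<in> \<Theta> \<Longrightarrow> 0 \<le> sin \<theta> \<and> 0 \<le> cos \<theta> \<and> \<sigma> \<theta> * sin \<theta> \<le> \<kappa>"
    and "f \<in> L_log_L"
  shows "differentiates (rectangle_basis \<Theta> \<sigma>) f"
proof -
  obtain \<mu> where f [measurable]: "f \<in> borel_measurable lebesgue" and \<mu>: "\<mu> > 0"
    and fin: "(\<integral>\<^sup>+x. ennreal (\<bar>f x\<bar> / \<mu> * (1 + log_plus (\<bar>f x\<bar> / \<mu>))) \<partial>lebesgue) < \<infinity>"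
    using assms(3) unfolding L_log_L_def orlicz_space_def by auto
  \<comment> \<open>\<open>f\<close> is merely Lebesgue measurable, whereas the arguments on lines
    are for Borel functions. Dividing by \<mu> below brings the Orlicz condition to unit
    scale.\<close>
  obtain g where g [measurable]: "g \<in> borel_measurable lborel" and fg: "AE x in lborel. f x = g x"
    using completion_ex_borel_measurable_real[OF f] by auto
  define u where "u x = g x / \<mu>" for x
  have u [measurable]: "u \<in> borel_measurable borel" unfolding u_def using g by measurable
  have fu: "AE x in lborel. f x = \<mu> * u x" using fg by eventually_elim (use \<mu> in \<open>auto simp: u_def\<close>)
  have um [measurable]: "(\<lambda>(x, y). u (vec2 x y)) \<in> borel_measurable (borel \<Otimes>\<^sub>M borel)"
    by measurable
  have "(\<integral>\<^sup>+x. \<integral>\<^sup>+y. ennreal (\<bar>u (vec2 x y)\<bar> * (1 + log_plus \<bar>u (vec2 x y)\<bar>)) \<partial>lborel \<partial>lborel) =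
     (\<integral>\<^sup>+x. ennreal (\<bar>u x\<bar> * (1 + log_plus \<bar>u x\<bar>)) \<partial>lborel)"
    by (rule nn_integral_real2[symmetric]) measurable
  also have "\<dots> = (\<integral>\<^sup>+x. ennreal (\<bar>u x\<bar> * (1 + log_plus \<bar>u x\<bar>)) \<partial>lebesgue)"
    by (subst nn_integral_completion) auto
  also have "\<dots> = (\<integral>\<^sup>+x. ennreal (\<bar>f x\<bar> / \<mu> * (1 + log_plus (\<bar>f x\<bar> / \<mu>))) \<partial>lebesgue)"
    by (rule nn_integral_cong_AE, rule AE_completion, use fu in eventually_elim) (use \<mu> in \<open>auto simp: abs_mult\<close>)
  finally have fin': "(\<integral>\<^sup>+x. \<integral>\<^sup>+y. ennreal (\<bar>u (vec2 x y)\<bar> * (1 + log_plus \<bar>u (vec2 x y)\<bar>)) \<partial>lborel \<partial>lborel) < \<infinity>"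
    using fin by simp
  have "AE p in lborel. \<forall>\<epsilon>>0. \<exists>n. \<forall>(a, b)\<in>rat_intervals n. \<forall>(c, d)\<in>rat_intervals n.
    a < p $ 1 \<and> p $ 1 < b \<and> c < p $ 2 \<and> p $ 2 < d \<longrightarrow>
      (\<integral>\<^sup>+z. (\<integral>\<^sup>+w. ennreal \<bar>u (vec2 z w) - u p\<bar> * indicator {c..d} w \<partial>lborel) * indicator {a..b} z \<partial>lborel)
       \<le> ennreal \<epsilon> * ennreal ((b - a) * (d - c))"
    by (rule AE_real2I) (use strong_differentiation[OF um fin'] in simp)
  then have "AE p in lborel. ((\<lambda>B. (LINT y:B|lebesgue. f y) / measure lebesgue B) \<longlongrightarrow> f p)
      (shrinking_filter (rectangle_basis \<Theta> \<sigma>) p)"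
    using fu
  proof eventually_elim
    case (elim p)
    show ?case
    proof (rule tendstoI)
      fix e :: real assume e: "e > 0"
      \<comment> \<open>The quotient of 16 \<kappa> L l by the lower bound L l / (8 \<kappa>) for
        the area is 128 \<kappa>^2; dividing by it and by the scale \<mu> leaves the error
        e/2.\<close>
      define \<epsilon> where "\<epsilon> = e / (2 * \<mu> * (128 * \<kappa> * \<kappa>))"
      have eps: "\<epsilon> > 0" using e \<mu> \<kappa> by (simp add: \<epsilon>_def)
      obtain n where n: "\<And>a b a' b'. (a, b) \<in> rat_intervals n \<Longrightarrow> (a', b') \<in> rat_intervals n \<Longrightarrow>
        a < p $ 1 \<and> p $ 1 < b \<and> a' < p $ 2 \<and> p $ 2 < b' \<Longrightarrow>
        (\<integral>\<^sup>+z. (\<integral>\<^sup>+w. ennreal \<bar>u (vec2 z w) - u p\<bar> * indicator {a'..b'} w \<partial>lborel) * indicator {a..b} z \<partial>lborel)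
         \<le> ennreal \<epsilon> * ennreal ((b - a) * (b' - a'))"
        using elim(1)[rule_format, OF eps] by fast
      show "\<forall>\<^sub>F B in shrinking_filter (rectangle_basis \<Theta> \<sigma>) p.
        dist ((LINT y:B|lebesgue. f y) / measure lebesgue B) (f p) < e"
        unfolding eventually_shrinking_filter
      proof (intro exI conjI ballI impI)
        \<comment> \<open>The diameter is at least L / (4 \<kappa>), so this threshold gives 4
          \<kappa> L < 1/(n+1).\<close>
        show "1 / (16 * \<kappa> * \<kappa> * Suc n) > 0" using \<kappa> by simp
        fix B assume B: "B \<in> rectangle_basis \<Theta> \<sigma>" "p \<in> B" "diameter B < 1 / (16 * \<kappa> * \<kappa> * Suc n)"
        from B(1) obtain c \<theta> L l where R: "B = open_rectangle c \<theta> L l" and th: "\<theta> \<in> \<Theta>"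
          and l: "0 < l" "l \<le> L" "L / l = \<sigma> \<theta>" unfolding rectangle_basis_def by auto
        have "L * sin \<theta> = l * (\<sigma> \<theta> * sin \<theta>)" using l by (simp add: l(3)[symmetric])
        also have "\<dots> \<le> l * \<kappa>" using \<Theta>[OF th] l by (intro mult_left_mono) auto
        finally have flat: "L * sin \<theta> \<le> \<kappa> * l" by (simp only: mult.commute)
        have s: "0 \<le> sin \<theta>" "0 \<le> cos \<theta>" using \<Theta>[OF th] by auto
        interpret flat_rectangle \<kappa> \<theta> L l
          by (rule flat_rectangle.intro[OF \<kappa> s l(1) l(2) flat])
        let ?m = "measure lebesgue (open_rectangle c \<theta> L l)"
        have "0 < L * l / (8 * \<kappa>)" using l_pos L_pos kappa by simp
        then have m: "?m > 0" using measure_open_rectangle(2)[of c] by (rule less_le_trans)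
        have "L / (4 * \<kappa>) < 1 / (16 * \<kappa> * \<kappa> * Suc n)"
          using diameter_open_rectangle_ge[of c] B(3) unfolding R by (rule le_less_trans)
        have "16 * \<kappa> * \<kappa> * (L / (4 * \<kappa>)) < 16 * \<kappa> * \<kappa> * (1 / (16 * \<kappa> * \<kappa> * Suc n))"
          using \<kappa> \<open>L / (4 * \<kappa>) < _\<close> by (intro mult_strict_left_mono) auto
        also have "\<dots> = 1 / Suc n" using \<kappa> by simp
        also have "16 * \<kappa> * \<kappa> * (L / (4 * \<kappa>)) = 4 * \<kappa> * L" using \<kappa> by simp
        finally have small: "4 * \<kappa> * L < 1 / Suc n" .
        have "(\<integral>\<^sup>+z. ennreal \<bar>f z - f p\<bar> * indicator B z \<partial>lebesgue) =
           (\<integral>\<^sup>+z. ennreal \<mu> * (ennreal \<bar>u z - u p\<bar> * indicator B z) \<partial>lebesgue)"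
        proof (rule nn_integral_cong_AE, rule AE_completion, use fu in eventually_elim)
          fix z assume z: "f z = \<mu> * u z"
          have "\<bar>f z - f p\<bar> = \<mu> * \<bar>u z - u p\<bar>"
            unfolding z elim(2) using \<mu> by (simp add: right_diff_distrib[symmetric] abs_mult)
          then show "ennreal \<bar>f z - f p\<bar> * indicator B z = ennreal \<mu> * (ennreal \<bar>u z - u p\<bar> * indicator B z)"
            using \<mu> by (simp add: ennreal_mult mult.assoc)
        qed
        also have "\<dots> = (\<integral>\<^sup>+z. ennreal \<mu> * (ennreal \<bar>u z - u p\<bar> * indicator B z) \<partial>lborel)"
          using borel_open[OF open_open_rectangle[of c \<theta> L l]] R by (subst nn_integral_completion) auto
        also have "\<dots> = ennreal \<mu> * (\<integral>\<^sup>+z. ennreal \<bar>u z - u p\<bar> * indicator B z \<partial>lborel)"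
          using borel_open[OF open_open_rectangle[of c \<theta> L l]] R by (intro nn_integral_cmult) auto
        also have "\<dots> \<le> ennreal \<mu> * ennreal (\<epsilon> * (16 * \<kappa> * L * l))"
          unfolding R by (intro mult_left_mono nn_integral_open_rectangle_le[OF u _ small n eps]) (use B R in auto)
        also have "\<dots> = ennreal (\<mu> * \<epsilon> * (16 * \<kappa> * L * l))"
          using \<mu> by (simp add: ennreal_mult'[symmetric] mult_ac)
        also have "\<dots> \<le> ennreal (e / 2 * ?m)"
        proof (rule ennreal_leI)
          have "\<mu> * \<epsilon> * (16 * \<kappa> * L * l) = e / 2 * (L * l / (8 * \<kappa>))"
            using \<mu> \<kappa> by (simp add: \<epsilon>_def field_simps)
          also have "\<dots> \<le> e / 2 * ?m" using measure_open_rectangle(2)[of c] e by (intro mult_left_mono) auto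
          finally show "\<mu> * \<epsilon> * (16 * \<kappa> * L * l) \<le> e / 2 * ?m" .
        qed
        finally have "\<bar>(LINT y:B|lebesgue. f y) / measure lebesgue B - f p\<bar> \<le> e / 2"
          unfolding R using measure_open_rectangle(1)[of c] m e L_log_L_integrable[OF assms(3)]
          by (intro abs_average_minus_le) auto
        then show "dist ((LINT y:B|lebesgue. f y) / measure lebesgue B) (f p) < e"
          using e by (simp add: dist_real_def)
      qed
    qed
  qed
  then show ?thesis unfolding differentiates_def by (rule AE_completion)
qed

section \<open>Nested scales\<close>

text \<open>\<open>b j\<close> is the length of the cells of level j on the vertical axis. Such a
  cell splits into twice \<open>q j\<close> cells of level j+1, so its lower half is a union of
  exactly \<open>q j\<close> of them.\<close>

locale nested_scales =
  fixes b :: "nat \<Rightarrow> real" and q :: "nat \<Rightarrow> nat"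
  assumes b_pos: "b j > 0" and q_pos: "q j \<ge> 1" and b_step: "b j = 2 * real (q j) * b (Suc j)"
begin

text \<open>The integer \<open>\<lfloor>2 * y / b i\<rfloor>\<close> is even exactly when y lies in
  the lower half of its cell of level i. Level K is excluded.\<close>

definition lower_halves :: "nat \<Rightarrow> nat \<Rightarrow> real set" where
  "lower_halves j K = {y. \<forall>i\<in>{j..<K}. even \<lfloor>2 * y / b i\<rfloor>}"

lemma floor_coarser: "\<lfloor>y / b i\<rfloor> = \<lfloor>y / b (Suc i)\<rfloor> div (2 * int (q i))"
  "\<lfloor>2 * y / b i\<rfloor> = \<lfloor>y / b (Suc i)\<rfloor> div int (q i)"
proof -
  have "y / b i = y / b (Suc i) / real_of_int (2 * int (q i))"
    using b_step[of i] b_pos[of i] b_pos[of "Suc i"] q_pos[of i] by (simp add: field_simps)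
  then show "\<lfloor>y / b i\<rfloor> = \<lfloor>y / b (Suc i)\<rfloor> div (2 * int (q i))"
    by (simp only: floor_divide_real_eq_div of_nat_0_le_iff mult_nonneg_nonneg zero_le_numeral)
  have "2 * y / b i = y / b (Suc i) / real_of_int (int (q i))"
    using b_step[of i] b_pos[of i] b_pos[of "Suc i"] q_pos[of i] by (simp add: field_simps)
  then show "\<lfloor>2 * y / b i\<rfloor> = \<lfloor>y / b (Suc i)\<rfloor> div int (q i)"
    by (simp only: floor_divide_real_eq_div of_nat_0_le_iff)
qed

text \<open>Index of a coarser cell is an integer quotient of the index of a finer one, so the cells
  are nested.\<close>

lemma floor_cong:
  assumes "i \<le> j" "\<lfloor>y / b j\<rfloor> = \<lfloor>y' / b j\<rfloor>"
  shows "\<lfloor>y / b i\<rfloor> = \<lfloor>y' / b i\<rfloor>"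
  using assms(1)
proof (induction i rule: inc_induct)
  case base
  show ?case by (rule assms(2))
next
  case (step i)
  then show ?case unfolding floor_coarser(1)[of _ i] by simp
qed

text \<open>The condition at a level i < j depends only on the cell of level i+1, hence only on that
  of level j.\<close>

lemma lower_halves_cong:
  assumes "\<lfloor>y / b j\<rfloor> = \<lfloor>y' / b j\<rfloor>" "y \<in> lower_halves 0 j"
  shows "y' \<in> lower_halves 0 j"
proof -
  have "\<lfloor>2 * y' / b i\<rfloor> = \<lfloor>2 * y / b i\<rfloor>" if "i < j" for i
    using floor_cong[of "Suc i" j y y'] assms(1) that unfolding floor_coarser(2)[of _ i] by simp
  with assms(2) show ?thesis by (simp add: lower_halves_def)
qed

lemma lower_halves_borel [measurable]: "lower_halves j K \<in> sets borel"
  unfolding lower_halves_def by measurable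

lemma cell_borel [measurable]: "{y. \<lfloor>y / b j\<rfloor> = m} \<in> sets borel"
  by measurable

lemma cell_eq: "{y. \<lfloor>y / b j\<rfloor> = m} = {real_of_int m * b j..<(real_of_int m + 1) * b j}"
  using b_pos[of j] by (auto simp: floor_eq_iff pos_le_divide_eq pos_divide_less_eq)

text \<open>With q = \<open>q j\<close>, cell m of level j consists of the cells 2qm, ..., 2qm + 2q
  - 1 of the next level, and its lower half of the first q of them.\<close>

lemma cell_inter_lower_halves:
  assumes "j < K"
  shows "{y. \<lfloor>y / b j\<rfloor> = m} \<inter> lower_halves j K =
    (\<Union>k\<in>{2 * int (q j) * m..<2 * int (q j) * m + int (q j)}. {y. \<lfloor>y / b (Suc j)\<rfloor> = k} \<inter> lower_halves (Suc j) K)"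
proof -
  have q: "int (q j) > 0" using q_pos[of j] by simp
  have H1: "\<lfloor>y / b j\<rfloor> = m \<and> even \<lfloor>2 * y / b j\<rfloor> \<longleftrightarrow>
      \<lfloor>y / b (Suc j)\<rfloor> \<in> {2 * int (q j) * m..<2 * int (q j) * m + int (q j)}" for y
  proof -
    define k where "k = \<lfloor>y / b (Suc j)\<rfloor>"
    \<comment> \<open>Division by 2q is division by q and then by 2, so the two conditions together
      say that the quotient by q is the even number 2m.\<close>
    have "k div (2 * int (q j)) = (k div int (q j)) div 2"
      by (simp add: zdiv_zmult2_eq mult.commute)
    moreover have "n div 2 = m \<and> even n \<longleftrightarrow> n = 2 * m" for n :: int by presburger
    ultimately have "k div (2 * int (q j)) = m \<and> even (k div int (q j)) \<longleftrightarrow> k div int (q j) = 2 * m"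
      by (simp only:)
    also have "\<dots> \<longleftrightarrow> k \<in> {2 * int (q j) * m..<2 * int (q j) * m + int (q j)}"
    proof
      assume "k div int (q j) = 2 * m"
      then have "k = int (q j) * (2 * m) + k mod int (q j)" by (metis mult_div_mod_eq)
      then show "k \<in> {2 * int (q j) * m..<2 * int (q j) * m + int (q j)}"
        using pos_mod_sign[OF q, of k] pos_mod_bound[OF q, of k] by (simp add: mult_ac)
    next
      assume "k \<in> {2 * int (q j) * m..<2 * int (q j) * m + int (q j)}"
      then show "k div int (q j) = 2 * m"
        using q by (intro int_div_pos_eq[of k _ _ "k - int (q j) * (2 * m)"]) (auto simp: mult_ac)
    qed
    finally show ?thesis unfolding floor_coarser(1)[of y j] floor_coarser(2)[of y j] k_def .
  qed
  have H2: "y \<in> lower_halves j K \<longleftrightarrow> even \<lfloor>2 * y / b j\<rfloor> \<and> y \<in> lower_halves (Suc j) K" for y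
  proof -
    have "{j..<K} = insert j {Suc j..<K}" using assms by auto
    then show ?thesis by (simp add: lower_halves_def)
  qed
  show ?thesis
    unfolding set_eq_iff Int_iff UN_iff mem_Collect_eq H2 using H1 by blast
qed

text \<open>Descending from K: the \<open>q j\<close> subcells contribute equally and together have
  length b_j / 2, so each level halves the measure.\<close>

lemma emeasure_cell_inter_lower_halves:
  assumes "j \<le> K"
  shows "emeasure lborel ({y. \<lfloor>y / b j\<rfloor> = m} \<inter> lower_halves j K) = ennreal (b j / 2 ^ (K - j))"
  using assms
proof (induction j arbitrary: m rule: inc_induct)
  case base
  have "lower_halves K K = UNIV" by (auto simp: lower_halves_def)
  then show ?case using b_pos[of K] by (simp add: cell_eq algebra_simps)
next
  case (step j)
  let ?I = "{2 * int (q j) * m..<2 * int (q j) * m + int (q j)}"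
  let ?F = "\<lambda>k. {y. \<lfloor>y / b (Suc j)\<rfloor> = k} \<inter> lower_halves (Suc j) K"
  have "emeasure lborel (\<Union>k\<in>?I. ?F k) = (\<Sum>k\<in>?I. emeasure lborel (?F k))"
    by (rule sum_emeasure[symmetric]) (auto simp: disjoint_family_on_def)
  also have "\<dots> = (\<Sum>k\<in>?I. ennreal (b (Suc j) / 2 ^ (K - Suc j)))"
    using step.IH by simp
  also have "\<dots> = ennreal (real (q j) * (b (Suc j) / 2 ^ (K - Suc j)))"
    using b_pos[of "Suc j"] by (simp add: ennreal_of_nat_eq_real_of_nat ennreal_mult'[symmetric])
  also have "real (q j) * (b (Suc j) / 2 ^ (K - Suc j)) = b j / 2 ^ (K - j)"
  proof -
    have "K - j = Suc (K - Suc j)" using step.hyps by simp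
    then show ?thesis using b_step[of j] by simp
  qed
  finally show ?case using step.hyps by (simp add: cell_inter_lower_halves)
qed

section \<open>The core and its halo\<close>

definition base_set :: "nat \<Rightarrow> real set" where
  "base_set j = {y. \<lfloor>y / b 0\<rfloor> = 0} \<inter> lower_halves 0 j"

lemma base_set_borel [measurable]: "base_set j \<in> sets borel"
  unfolding base_set_def by measurable

lemma emeasure_base_set: "emeasure lborel (base_set j) = ennreal (b 0 / 2 ^ j)"
  unfolding base_set_def using emeasure_cell_inter_lower_halves[of 0 j 0] by simp

lemma base_set_subset: "base_set j \<subseteq> {0..b 0}"
  unfolding base_set_def cell_eq by auto

text \<open>The conditions defining \<open>base_set j\<close> are constant on cells of level j.
  Hence every such cell meeting \<open>base_set j\<close> carries the same measure b_j / 2^(K-j) of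
  \<open>base_set K\<close>.\<close>

lemma cell_inter_subset_base_set:
  assumes "j \<le> K" "y \<in> base_set j"
  shows "{y'. \<lfloor>y' / b j\<rfloor> = \<lfloor>y / b j\<rfloor>} \<inter> lower_halves j K \<subseteq> base_set K"
proof
  fix y' assume y': "y' \<in> {y'. \<lfloor>y' / b j\<rfloor> = \<lfloor>y / b j\<rfloor>} \<inter> lower_halves j K"
  have "\<lfloor>y' / b 0\<rfloor> = 0"
    using floor_cong[of 0 j y' y] y' assms(2) by (auto simp: base_set_def)
  moreover have "y' \<in> lower_halves 0 j"
    using lower_halves_cong[of y j y'] y' assms(2) by (auto simp: base_set_def)
  ultimately show "y' \<in> base_set K"
    using y' assms(1) unfolding base_set_def lower_halves_def by auto
qed

definition core :: "real \<Rightarrow> nat \<Rightarrow> (real^2) set" where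
  "core r K = {z. z $ 1 \<in> {0..<r} \<and> z $ 2 \<in> base_set K}"

text \<open>The j-th part is 2^j times as wide as the core, while \<open>base_set j\<close> has
  measure b_0 / 2^j: all K+1 parts have the same area r b_0, against r b_0 / 2^K for the
  core.\<close>

definition halo :: "real \<Rightarrow> nat \<Rightarrow> (real^2) set" where
  "halo r K = (\<Union>j\<le>K. {z. z $ 1 \<in> {0..<r * 2 ^ j} \<and> z $ 2 \<in> base_set j})"

lemma core_borel [measurable]: "core r K \<in> sets borel"
  unfolding core_def by measurable

lemma halo_borel [measurable]: "halo r K \<in> sets borel"
  unfolding halo_def by measurable

lemma emeasure_core: "r \<ge> 0 \<Longrightarrow> emeasure lborel (core r K) = ennreal (r * b 0 / 2 ^ K)"
  unfolding core_def using b_pos[of 0]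
  by (subst emeasure_real2_Times) (auto simp: emeasure_base_set ennreal_mult[symmetric])

text \<open>The outer half of the \<open>j\<close>-th block is disjoint from the previous blocks.\<close>

lemma emeasure_halo_ge:
  assumes "r > 0"
  shows "emeasure lborel (halo r K) \<ge> ennreal (real (K + 1) * (r * b 0 / 2))"
proof -
  define F where "F j = {z::real^2. z $ 1 \<in> {r * 2 ^ j / 2..<r * 2 ^ j} \<and> z $ 2 \<in> base_set j}" for j
  have [measurable]: "F j \<in> sets borel" for j unfolding F_def by measurable
  have disj: "disjoint_family_on F {..K}"
  proof -
    have "F i \<inter> F j = {}" if "i < j" for i j :: nat
    proof -
      have "(2::real) ^ Suc i \<le> 2 ^ j" using that by (intro power_increasing) auto
      then have "r * 2 ^ i \<le> r * 2 ^ j / 2" using assms by simp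
      then show ?thesis by (auto simp: F_def)
    qed
    then show ?thesis by (auto simp: disjoint_family_on_def) (metis disjoint_iff nat_neq_iff)
  qed
  have "emeasure lborel (F j) = ennreal (r * b 0 / 2)" for j
    unfolding F_def using assms b_pos[of 0]
    by (subst emeasure_real2_Times) (auto simp: emeasure_base_set ennreal_mult[symmetric] field_simps)
  then have "ennreal (real (K + 1) * (r * b 0 / 2)) = (\<Sum>j\<le>K. emeasure lborel (F j))"
    using assms b_pos[of 0] by (simp add: sum_ennreal[of "{..K}" "\<lambda>_. r * b 0 / 2"] del: sum_constant) (simp add: add.commute)
  also have "\<dots> = emeasure lborel (\<Union>j\<le>K. F j)"
    by (rule sum_emeasure) (auto simp: disj)
  also have "\<dots> \<le> emeasure lborel (halo r K)"
  proof (rule emeasure_mono)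
    show "(\<Union>j\<le>K. F j) \<subseteq> halo r K"
      unfolding halo_def F_def using assms by (fastforce intro: order.trans[rotated])
  qed simp
  finally show ?thesis .
qed

text \<open>The block is the rectangle of width r 2^j over the cell of level j containing the height
  of z. Its area is r 2^j b_j, so the core has density at least 2^(-K) in it, for every j
  alike.\<close>

lemma halo_block:
  assumes "z \<in> halo r K" "r > 0"
  obtains j and c :: "real^2" where "j \<le> K"
    "z \<in> {z. \<bar>z $ 1 - c $ 1\<bar> \<le> r * 2 ^ j / 2 \<and> \<bar>z $ 2 - c $ 2\<bar> \<le> b j / 2}"
    "emeasure lborel ({z. \<bar>z $ 1 - c $ 1\<bar> \<le> r * 2 ^ j / 2 \<and> \<bar>z $ 2 - c $ 2\<bar> \<le> b j / 2} \<inter> core r K)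
      \<ge> ennreal (r * b j / 2 ^ (K - j))"
proof -
  obtain j where j: "j \<le> K" "z $ 1 \<in> {0..<r * 2 ^ j}" "z $ 2 \<in> base_set j"
    using assms by (auto simp: halo_def)
  define m where "m = \<lfloor>z $ 2 / b j\<rfloor>"
  define c where "c = vec2 (r * 2 ^ j / 2) (real_of_int m * b j + b j / 2)"
  let ?Q = "{z::real^2. \<bar>z $ 1 - c $ 1\<bar> \<le> r * 2 ^ j / 2 \<and> \<bar>z $ 2 - c $ 2\<bar> \<le> b j / 2}"
  have cell: "\<bar>y - c $ 2\<bar> \<le> b j / 2" if "\<lfloor>y / b j\<rfloor> = m" for y
  proof -
    have "y \<in> {real_of_int m * b j..<(real_of_int m + 1) * b j}" using that unfolding cell_eq[symmetric] by simp
    then show ?thesis unfolding abs_le_iff by (simp add: c_def algebra_simps)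
  qed
  have hor: "\<bar>x - c $ 1\<bar> \<le> r * 2 ^ j / 2" if "0 \<le> x" "x \<le> r * 2 ^ j" for x
    unfolding abs_le_iff using that by (simp add: c_def)
  have zQ: "z \<in> ?Q"
    using j cell[of "z $ 2"] hor[of "z $ 1"] by (simp add: m_def)
  \<comment> \<open>Over the strip of width r only the lower halves from level j on need to be
    imposed: the earlier conditions hold on the whole cell because z has its height in
    \<open>base_set j\<close>.\<close>
  have "ennreal (r * b j / 2 ^ (K - j)) =
      emeasure lborel {z::real^2. z $ 1 \<in> {0..<r} \<and> z $ 2 \<in> {y. \<lfloor>y / b j\<rfloor> = m} \<inter> lower_halves j K}"
    using assms b_pos[of j] emeasure_cell_inter_lower_halves[OF j(1), of m]
    by (subst emeasure_real2_Times) (auto simp: ennreal_mult[symmetric])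
  also have "\<dots> \<le> emeasure lborel (?Q \<inter> core r K)"
  proof (rule emeasure_mono)
    have r: "r * 1 \<le> r * 2 ^ j" using assms by (intro mult_left_mono) auto
    show "{z. z $ 1 \<in> {0..<r} \<and> z $ 2 \<in> {y. \<lfloor>y / b j\<rfloor> = m} \<inter> lower_halves j K} \<subseteq> ?Q \<inter> core r K"
    proof safe
      fix x :: "real^2" assume x: "x $ 1 \<in> {0..<r}" "x $ 2 \<in> lower_halves j K" "m = \<lfloor>x $ 2 / b j\<rfloor>"
      have "x $ 1 \<le> r * 2 ^ j" using x(1) r unfolding atLeastLessThan_iff by linarith
      then show "\<bar>x $ 1 - c $ 1\<bar> \<le> r * 2 ^ j / 2" using x(1) by (intro hor) auto
      show "\<bar>x $ 2 - c $ 2\<bar> \<le> b j / 2" using x(3) by (intro cell) simp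
      show "x \<in> core r K"
        using x cell_inter_subset_base_set[OF j(1) j(3)] by (auto simp: core_def m_def)
    qed
  qed measurable
  finally show ?thesis by (rule that[OF j(1) zQ])
qed

end

section \<open>Covering by translates\<close>

lemma nn_integral_reflect_translate:
  fixes F :: "'a::euclidean_space \<Rightarrow> ennreal"
  assumes [measurable]: "F \<in> borel_measurable borel"
  shows "(\<integral>\<^sup>+v. F (x - v) \<partial>lborel) = (\<integral>\<^sup>+v. F v \<partial>lborel)"
proof -
  have "lborel = distr lborel borel (\<lambda>v. x - v)"
    using lborel_affine[of "-1" x] by (simp add: density_1)
  then have "(\<integral>\<^sup>+v. F v \<partial>lborel) = (\<integral>\<^sup>+v. F v \<partial>distr lborel borel (\<lambda>v. x - v))" by simp
  also have "\<dots> = (\<integral>\<^sup>+v. F (x - v) \<partial>lborel)" by (rule nn_integral_distr) auto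
  finally show ?thesis by simp
qed

lemma emeasure_translate:
  fixes A :: "'a::euclidean_space set"
  assumes [measurable]: "A \<in> sets borel"
  shows "emeasure lborel {x. x - v \<in> A} = emeasure lborel A"
proof -
  have "emeasure lborel A = emeasure (distr lborel borel ((+) (- v))) A"
    by (simp only: lborel_distr_plus)
  also have "\<dots> = emeasure lborel ((+) (- v) -` A \<inter> space lborel)" by (rule emeasure_distr) auto
  also have "(+) (- v) -` A \<inter> space lborel = {x. x - v \<in> A}" by auto
  finally show ?thesis by simp
qed

lemma translate_borel [measurable]:
  fixes A :: "'a::euclidean_space set"
  assumes [measurable]: "A \<in> sets borel"
  shows "{x. x - v \<in> A} \<in> sets borel"
  by measurable

definition unit_square :: "(real^2) set" where
  "unit_square = {z. \<bar>z $ 1 - 1 / 2\<bar> \<le> 1 / 2 \<and> \<bar>z $ 2 - 1 / 2\<bar> \<le> 1 / 2}"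

lemma unit_square_borel [measurable]: "unit_square \<in> sets borel"
  unfolding unit_square_def by measurable

lemma emeasure_unit_square: "emeasure lborel unit_square = 1"
  unfolding unit_square_def by (subst emeasure_real2_box) auto

text \<open>Averaging \<open>|(Y + v) \<inter> U|\<close> over the translations \<open>v\<close>.\<close>

lemma exists_good_translate:
  assumes [measurable]: "Y \<in> sets borel" "U \<in> sets borel"
    and sub: "Y \<subseteq> unit_square" "U \<subseteq> unit_square"
    and y: "emeasure lborel Y = ennreal y" "y > 0" and U: "emeasure lborel U > ennreal (1 / 2)"
  shows "\<exists>v. emeasure lborel ({x. x - v \<in> Y} \<inter> U) > ennreal (y / 8)"
proof (rule ccontr)
  assume "\<nexists>v. emeasure lborel ({x. x - v \<in> Y} \<inter> U) > ennreal (y / 8)"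
  then have le: "emeasure lborel ({x. x - v \<in> Y} \<inter> U) \<le> ennreal (y / 8)" for v
    by (simp add: not_less)
  \<comment> \<open>Translates of Y by vectors outside this square of area 4 miss
    \<open>unit_square\<close>. Averaging the product of y and the measure of U, which exceeds y/2,
    over area 4 yields the threshold y/8.\<close>
  let ?V = "{v::real^2. \<bar>v $ 1 - 0\<bar> \<le> 1 \<and> \<bar>v $ 2 - 0\<bar> \<le> 1}"
  have [measurable]: "?V \<in> sets borel" by measurable
  have "emeasure lborel U * ennreal y = (\<integral>\<^sup>+x. indicator U x * (\<integral>\<^sup>+v. indicator Y (x - v) \<partial>lborel) \<partial>lborel)"
    by (subst nn_integral_reflect_translate) (auto simp: nn_integral_multc y)
  also have "\<dots> = (\<integral>\<^sup>+x. (\<integral>\<^sup>+v. indicator U x * indicator Y (x - v) \<partial>lborel) \<partial>lborel)"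
    by (intro nn_integral_cong nn_integral_cmult[symmetric]) measurable
  also have "\<dots> = (\<integral>\<^sup>+v. (\<integral>\<^sup>+x. indicator U x * indicator Y (x - v) \<partial>lborel) \<partial>lborel)"
    by (rule lborel_pair.Fubini'[symmetric]) measurable
  also have "\<dots> \<le> (\<integral>\<^sup>+v. ennreal (y / 8) * indicator ?V v \<partial>lborel)"
  proof (rule nn_integral_mono)
    fix v :: "real^2"
    show "(\<integral>\<^sup>+x. indicator U x * indicator Y (x - v) \<partial>lborel) \<le> ennreal (y / 8) * indicator ?V v"
    proof (cases "v \<in> ?V")
      case True
      have "(\<integral>\<^sup>+x. indicator U x * indicator Y (x - v) \<partial>lborel) = (\<integral>\<^sup>+x. indicator ({x. x - v \<in> Y} \<inter> U) x \<partial>lborel)"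
        by (intro nn_integral_cong) (auto simp: indicator_def)
      also have "\<dots> = emeasure lborel ({x. x - v \<in> Y} \<inter> U)" by (rule nn_integral_indicator) measurable
      finally show ?thesis using le[of v] True by simp
    next
      case False
      have "indicator U x * indicator Y (x - v) = (0::ennreal)" for x
      proof -
        have "v \<in> ?V" if "x \<in> unit_square" "x - v \<in> unit_square"
          using that unfolding unit_square_def mem_Collect_eq vector_minus_component diff_zero by linarith
        with False sub show ?thesis by (auto simp: indicator_def)
      qed
      then show ?thesis by (simp only: nn_integral_0_iff_AE mult_zero_left nn_integral_const zero_le)
    qed
  qed
  also have "\<dots> = ennreal (y / 8) * emeasure lborel ?V" by (rule nn_integral_cmult_indicator) measurable
  also have "\<dots> = ennreal (1 / 2) * ennreal y"
  proof -
    have "emeasure lborel ?V = ennreal 4" using emeasure_real2_box[of 1 1 0 0] by simp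
    then have "ennreal (y / 8) * emeasure lborel ?V = ennreal (y / 8 * 4)"
      using y(2) by (simp only: ennreal_mult[symmetric] zero_le_numeral less_imp_le divide_nonneg_nonneg)
    also have "y / 8 * 4 = 1 / 2 * y" by simp
    also have "ennreal \<dots> = ennreal (1 / 2) * ennreal y" using y(2) by (intro ennreal_mult) auto
    finally show ?thesis .
  qed
  finally have "emeasure lborel U * ennreal y \<le> ennreal (1 / 2) * ennreal y" .
  moreover have "ennreal (1 / 2) * ennreal y < emeasure lborel U * ennreal y"
    using U y(2) by (intro ennreal_mult_strict_right_mono) auto
  ultimately show False by simp
qed

text \<open>Greedy choice: as long as less than half of the square is covered, the rest has measure
  above 1/2 and some further translate gains y/8.\<close>

lemma translates_cover:
  assumes [measurable]: "Y \<in> sets borel" and sub: "Y \<subseteq> unit_square"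
    and y: "emeasure lborel Y = ennreal y" "y > 0"
  shows "\<exists>V. finite V \<and> card V \<le> n \<and>
    (emeasure lborel (unit_square \<inter> (\<Union>v\<in>V. {x. x - v \<in> Y})) \<ge> ennreal (1 / 2) \<or>
     emeasure lborel (unit_square \<inter> (\<Union>v\<in>V. {x. x - v \<in> Y})) \<ge> ennreal (real n * (y / 8)))"
proof (induction n)
  case 0
  show ?case by (intro exI[of _ "{}"]) auto
next
  case (Suc n)
  then obtain V where V: "finite V" "card V \<le> n" and
    cov: "emeasure lborel (unit_square \<inter> (\<Union>v\<in>V. {x. x - v \<in> Y})) \<ge> ennreal (1 / 2) \<or>
     emeasure lborel (unit_square \<inter> (\<Union>v\<in>V. {x. x - v \<in> Y})) \<ge> ennreal (real n * (y / 8))" by blast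
  define C where "C = unit_square \<inter> (\<Union>v\<in>V. {x. x - v \<in> Y})"
  have [measurable]: "C \<in> sets borel" unfolding C_def using V(1) by measurable
  show ?case
  proof (cases "emeasure lborel C \<ge> ennreal (1 / 2)")
    case True
    then show ?thesis using V unfolding C_def by (intro exI[of _ V]) auto
  next
    case False
    define U where "U = unit_square - C"
    have [measurable]: "U \<in> sets borel" unfolding U_def by measurable
    have "emeasure lborel U + emeasure lborel C = 1"
    proof -
      have "emeasure lborel U + emeasure lborel C = emeasure lborel (U \<union> C)"
        by (rule plus_emeasure) (auto simp: U_def)
      also have "U \<union> C = unit_square" by (auto simp: U_def C_def)
      finally show ?thesis by (simp add: emeasure_unit_square)
    qed
    then obtain x c where x: "emeasure lborel U = ennreal x" "0 \<le> x"
      and c: "emeasure lborel C = ennreal c" "0 \<le> c" "ennreal x + ennreal c = 1"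
      by (cases "emeasure lborel U"; cases "emeasure lborel C") auto
    have "x + c = 1" using x c by (simp add: ennreal_plus[symmetric] del: ennreal_plus)
    moreover have "ennreal c < ennreal (1 / 2)" using False unfolding c(1) not_le .
    then have "c < 1 / 2" using c(2) by (simp only: ennreal_less_iff)
    ultimately have "emeasure lborel U > ennreal (1 / 2)"
      unfolding x(1) by (subst ennreal_less_iff) auto
    then obtain v where v: "emeasure lborel ({x. x - v \<in> Y} \<inter> U) > ennreal (y / 8)"
      using exists_good_translate[of Y U y] sub y by (auto simp: U_def)
    have "ennreal (real (Suc n) * (y / 8)) = ennreal (real n * (y / 8)) + ennreal (y / 8)"
    proof -
      have "real (Suc n) * (y / 8) = real n * (y / 8) + y / 8" by (simp add: algebra_simps)
      then show ?thesis using y(2) by (simp only:) (intro ennreal_plus, auto)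
    qed
    also have "\<dots> \<le> emeasure lborel C + emeasure lborel ({x. x - v \<in> Y} \<inter> U)"
      using cov False v unfolding C_def[symmetric] by (intro add_mono) auto
    also have "\<dots> = emeasure lborel (C \<union> ({x. x - v \<in> Y} \<inter> U))"
      by (rule plus_emeasure) (auto simp: U_def)
    also have "C \<union> ({x. x - v \<in> Y} \<inter> U) = unit_square \<inter> (\<Union>v\<in>insert v V. {x. x - v \<in> Y})"
      by (auto simp: C_def U_def)
    finally show ?thesis
      using V card_insert_le_m1[of "Suc n" V v] by (intro exI[of _ "insert v V"]) (auto simp: card_insert_if)
  qed
qed

section \<open>Sharpness\<close>

lemma ex_dyadic_interval:
  fixes x :: real
  assumes "x \<ge> 1"
  shows "\<exists>m::nat. 2 ^ m \<le> x \<and> x < 2 ^ (m + 1)"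
proof -
  define k where "k = nat \<lfloor>x\<rfloor>"
  have k: "k \<ge> 1" "real k \<le> x" "x < real k + 1" using assms unfolding k_def by linarith+
  obtain m where m: "2 ^ m \<le> k" "k < 2 ^ (m + 1)"
    using ex_power_ivl1[of 2 k] k(1) by auto
  have "real (2 ^ m) \<le> real k" using m(1) by (rule of_nat_mono)
  moreover have "real (k + 1) \<le> real (2 ^ (m + 1))" using m(2) by (intro of_nat_mono) simp
  ultimately have "2 ^ m \<le> x" "x < 2 ^ (m + 1)"
    using k unfolding of_nat_power of_nat_numeral of_nat_add of_nat_1 by linarith+
  then show ?thesis by blast
qed

text \<open>Abstract setting for both halves of the result. In the application
  \<open>\<kappa>\<close> is 1 / (1 - 2t); that \<open>\<Theta>\<close> is nonempty is contained in
  \<open>shape_unbounded\<close>.\<close>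

locale flat_shapes =
  fixes \<kappa> :: real and \<Theta> :: "real set" and \<sigma> :: "real \<Rightarrow> real"
  assumes kappa: "1 \<le> \<kappa>"
    and angle: "\<theta> \<in> \<Theta> \<Longrightarrow> 0 \<le> sin \<theta>" "\<theta> \<in> \<Theta> \<Longrightarrow> 0 \<le> cos \<theta>"
    and flat: "\<theta> \<in> \<Theta> \<Longrightarrow> \<sigma> \<theta> * sin \<theta> \<le> \<kappa>"
    and shape_ge: "\<theta> \<in> \<Theta> \<Longrightarrow> 1 \<le> \<sigma> \<theta>"
    and shape_unbounded: "\<exists>\<theta>\<in>\<Theta>. M \<le> \<sigma> \<theta>"
begin

lemma flat_rectangleI:
  assumes "\<theta> \<in> \<Theta>" "0 < L"
  shows "flat_rectangle \<kappa> \<theta> L (L / \<sigma> \<theta>)"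
proof (rule flat_rectangle.intro)
  have s: "\<sigma> \<theta> \<ge> 1" using shape_ge assms by simp
  then show "0 < L / \<sigma> \<theta>" "L / \<sigma> \<theta> \<le> L"
    using assms by (auto simp: pos_divide_le_eq mult_le_cancel_left1)
  have "L * sin \<theta> = (L / \<sigma> \<theta>) * (\<sigma> \<theta> * sin \<theta>)" using s by simp
  also have "\<dots> \<le> (L / \<sigma> \<theta>) * \<kappa>" using flat[OF assms(1)] assms(2) s by (intro mult_left_mono) auto
  finally show "L * sin \<theta> \<le> \<kappa> * (L / \<sigma> \<theta>)" by (simp add: mult.commute)
qed (use kappa angle assms in auto)

lemma open_rectangle_mem:
  assumes "\<theta> \<in> \<Theta>" "0 < L"
  shows "open_rectangle c \<theta> L (L / \<sigma> \<theta>) \<in> rectangle_basis \<Theta> \<sigma>"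
proof -
  interpret flat_rectangle \<kappa> \<theta> L "L / \<sigma> \<theta>" by (rule flat_rectangleI[OF assms])
  have "L / (L / \<sigma> \<theta>) = \<sigma> \<theta>" using assms(2) by simp
  then show ?thesis unfolding rectangle_basis_def using assms(1) l_pos l_le by blast
qed

lemma differentiation_basis_rectangle_basis: "differentiation_basis (rectangle_basis \<Theta> \<sigma>)"
  unfolding differentiation_basis_def
proof (intro conjI ballI allI impI)
  fix B assume "B \<in> rectangle_basis \<Theta> \<sigma>"
  then show "open B" unfolding rectangle_basis_def using open_open_rectangle by auto
next
  fix x :: "real^2" and e :: real assume e: "e > 0"
  obtain \<theta> where th: "\<theta> \<in> \<Theta>" using shape_unbounded[of 0] by blast
  define L where "L = e / (8 * \<kappa>)"
  have L: "L > 0" using e kappa by (simp add: L_def)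
  interpret flat_rectangle \<kappa> \<theta> L "L / \<sigma> \<theta>" by (rule flat_rectangleI[OF th L])
  have "4 * \<kappa> * L < e" using e kappa by (simp add: L_def)
  with diameter_open_rectangle_le[of x] have "diameter (open_rectangle x \<theta> L (L / \<sigma> \<theta>)) < e" by linarith
  moreover have "x \<in> open_rectangle x \<theta> L (L / \<sigma> \<theta>)"
    using l_pos L_pos by (simp add: open_rectangle_coords)
  ultimately show "\<exists>B\<in>rectangle_basis \<Theta> \<sigma>. x \<in> B \<and> bounded B \<and> diameter B < e"
    using open_rectangle_mem[OF th L] bounded_open_rectangle by blast
qed

text \<open>The gap of at least 2 makes the quotient 2^(m(j+1) - m(j) - 1) of consecutive block
  heights an even integer, as \<open>nested_scales\<close> demands.\<close>

lemma shape_exponents: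
  obtains m :: "nat \<Rightarrow> nat" and \<theta> :: "nat \<Rightarrow> real"
  where "\<And>j. m j + 2 \<le> m (Suc j)" "\<And>j. \<theta> j \<in> \<Theta>"
    "\<And>j. 2 ^ m j \<le> \<sigma> (\<theta> j)" "\<And>j. \<sigma> (\<theta> j) < 2 ^ (m j + 1)"
proof -
  define S where "S = {m::nat. \<exists>\<theta>\<in>\<Theta>. 2 ^ m \<le> \<sigma> \<theta> \<and> \<sigma> \<theta> < 2 ^ (m + 1)}"
  have S: "\<exists>m\<in>S. N \<le> m" for N
  proof -
    obtain \<theta> where th: "\<theta> \<in> \<Theta>" "2 ^ N \<le> \<sigma> \<theta>" using shape_unbounded by blast
    obtain m where m: "2 ^ m \<le> \<sigma> \<theta>" "\<sigma> \<theta> < 2 ^ (m + 1)"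
      using ex_dyadic_interval[OF shape_ge[OF th(1)]] by blast
    have "(2::real) ^ N < 2 ^ (m + 1)" using th(2) m(2) by linarith
    then have "N < m + 1" by (subst (asm) power_strict_increasing_iff) auto
    then show ?thesis using m th(1) by (intro bexI[of _ m]) (auto simp: S_def)
  qed
  have "\<exists>m. \<forall>j. m j \<in> S \<and> m j + 2 \<le> m (Suc j)"
    using S by (intro dependent_nat_choice) (blast, meson)
  then obtain m where m: "\<And>j. m j \<in> S" "\<And>j. m j + 2 \<le> m (Suc j)" by blast
  then have "\<forall>j. \<exists>\<theta>. \<theta> \<in> \<Theta> \<and> 2 ^ m j \<le> \<sigma> \<theta> \<and> \<sigma> \<theta> < 2 ^ (m j + 1)"
    unfolding S_def by blast
  then obtain \<theta> where "\<And>j. \<theta> j \<in> \<Theta> \<and> 2 ^ m j \<le> \<sigma> (\<theta> j) \<and> \<sigma> (\<theta> j) < 2 ^ (m j + 1)" by metis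
  with m(2) show ?thesis by (intro that[of m \<theta>]) auto
qed

text \<open>A block of width w = r 2^j and height w / 2^(m_j) has, up to a factor 2, the shape
  prescribed at the angle \<theta>_j, so a rectangle of the basis covers it with comparable area.
  Translations v are included since the basis is translation invariant and many copies will be
  placed.\<close>

lemma crystallization:
  assumes "\<delta> > 0"
  obtains T Y :: "(real^2) set" and \<tau> y :: real
  where "T \<in> sets borel" "Y \<in> sets borel" "Y \<subseteq> unit_square"
    "emeasure lborel T = ennreal \<tau>" "emeasure lborel Y = ennreal y" "0 < \<tau>" "0 < y" "y \<le> 1"
    "real (K + 1) * 2 ^ K * \<tau> \<le> 2 * y"
    "\<And>z v. z - v \<in> Y \<Longrightarrow> \<exists>R\<in>rectangle_basis \<Theta> \<sigma>. z \<in> R \<and> R \<in> lmeasurable \<and> bounded R \<and> diameter R < \<delta> \<and>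
      0 < measure lebesgue R \<and>
      measure lebesgue R \<le> 64 * \<kappa> ^ 3 * (2 ^ K * measure lebesgue (R \<inter> {x. x - v \<in> T}))"
proof -
  obtain m \<theta> where m: "\<And>j. m j + 2 \<le> m (Suc j)" and th: "\<And>j. \<theta> j \<in> \<Theta>"
    and sg: "\<And>j. 2 ^ m j \<le> \<sigma> (\<theta> j)" "\<And>j. \<sigma> (\<theta> j) < 2 ^ (m j + 1)" by (rule shape_exponents) blast
  \<comment> \<open>Every width w = r 2^j is then at most 1 and at most \<delta> / (32 \<kappa>^2),
    so the halo fits into the unit square and the diameter bound 16 \<kappa>^2 w is at most
    \<delta>/2.\<close>
  define r where "r = min 1 (\<delta> / (32 * \<kappa>\<^sup>2)) / 2 ^ K"
  have r: "r > 0" using assms kappa by (auto simp: r_def)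
  have rK: "r * 2 ^ j \<le> min 1 (\<delta> / (32 * \<kappa>\<^sup>2))" if "j \<le> K" for j
  proof -
    have "(2::real) ^ j \<le> 2 ^ K" using that by (intro power_increasing) auto
    then have "r * 2 ^ j \<le> r * 2 ^ K" using r by (intro mult_left_mono) auto
    then show ?thesis by (simp add: r_def)
  qed
  define b where "b j = r * 2 ^ j / 2 ^ m j" for j
  define q where "q j = (2::nat) ^ (m (Suc j) - m j - 2)" for j
  interpret nested_scales b q
  proof
    fix j
    show "b j > 0" using r by (simp add: b_def)
    show "q j \<ge> 1" by (simp add: q_def)
    have "(2::real) ^ m (Suc j) = 2 ^ m j * 4 * real (q j)"
    proof -
      obtain d where d: "m (Suc j) = m j + 2 + d" using m[of j] le_Suc_ex by blast
      then have "q j = 2 ^ d" by (simp add: q_def)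
      then show ?thesis unfolding d power_add by simp
    qed
    then show "b j = 2 * real (q j) * b (Suc j)" by (simp add: b_def q_def field_simps)
  qed
  define y where "y = measure lborel (halo r K)"
  have b0: "b 0 \<le> r" using r by (simp add: b_def field_simps)
  have r1: "r \<le> 1" using rK[of 0] by simp
  have sub: "halo r K \<subseteq> unit_square"
  proof
    fix z assume "z \<in> halo r K"
    then obtain j where j: "j \<le> K" "0 \<le> z $ 1" "z $ 1 < r * 2 ^ j" "z $ 2 \<in> base_set j" by (auto simp: halo_def)
    have "0 \<le> z $ 2 \<and> z $ 2 \<le> b 0" using base_set_subset[of j] j(4) by auto
    moreover have "r * 2 ^ j \<le> 1" using rK[OF j(1)] by simp
    ultimately show "z \<in> unit_square"
      using j b0 r1 unfolding unit_square_def mem_Collect_eq by linarith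
  qed
  have "emeasure lborel (halo r K) \<le> 1"
    using emeasure_mono[OF sub, of lborel] by (simp add: emeasure_unit_square)
  then have y: "emeasure lborel (halo r K) = ennreal y"
    unfolding y_def by (intro emeasure_eq_ennreal_measure) (auto simp: top_unique)
  have y1: "y \<le> 1" using \<open>emeasure lborel (halo r K) \<le> 1\<close> unfolding y by simp
  have "ennreal (real (K + 1) * (r * b 0 / 2)) \<le> ennreal y" using emeasure_halo_ge[OF r, of K] unfolding y .
  then have yge: "real (K + 1) * (r * b 0 / 2) \<le> y" by (subst (asm) ennreal_le_iff) (simp_all add: y_def)
  have pos: "0 < real (K + 1) * (r * b 0 / 2)" using r b_pos[of 0] by simp
  show ?thesis
  proof (rule that[of "core r K" "halo r K" "r * b 0 / 2 ^ K" y])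
    show "emeasure lborel (core r K) = ennreal (r * b 0 / 2 ^ K)" using r by (intro emeasure_core) simp
    show "0 < r * b 0 / 2 ^ K" using r b_pos[of 0] by simp
    show "0 < y" using pos yge by linarith
    show "real (K + 1) * 2 ^ K * (r * b 0 / 2 ^ K) \<le> 2 * y" using yge by simp
    fix z v assume "z - v \<in> halo r K"
    then obtain j and c :: "real^2" where j: "j \<le> K"
      and zQ: "z - v \<in> {z. \<bar>z $ 1 - c $ 1\<bar> \<le> r * 2 ^ j / 2 \<and> \<bar>z $ 2 - c $ 2\<bar> \<le> b j / 2}"
      and Q: "emeasure lborel ({z. \<bar>z $ 1 - c $ 1\<bar> \<le> r * 2 ^ j / 2 \<and> \<bar>z $ 2 - c $ 2\<bar> \<le> b j / 2} \<inter> core r K)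
        \<ge> ennreal (r * b j / 2 ^ (K - j))" by (rule halo_block[OF _ r])
    define w where "w = r * 2 ^ j"
    \<comment> \<open>Makes the inner box of the rectangle exactly as wide as the block: L / (8
      \<kappa>) = w / 2.\<close>
    define L where "L = 4 * \<kappa> * w"
    have w: "w > 0" using r by (simp add: w_def)
    have L: "L > 0" using w kappa by (simp add: L_def)
    have s1: "\<sigma> (\<theta> j) \<ge> 1" using shape_ge th by blast
    interpret flat_rectangle \<kappa> "\<theta> j" L "L / \<sigma> (\<theta> j)" by (rule flat_rectangleI[OF th L])
    let ?R = "open_rectangle (c + v) (\<theta> j) L (L / \<sigma> (\<theta> j))"
    let ?Q = "{z. \<bar>z $ 1 - c $ 1\<bar> \<le> r * 2 ^ j / 2 \<and> \<bar>z $ 2 - c $ 2\<bar> \<le> b j / 2}"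
    have bj: "b j = w / 2 ^ m j" by (simp add: b_def w_def)
    \<comment> \<open>The upper bound 2^(m_j + 1) on the shape makes the inner box tall enough for
      the block.\<close>
    have "b j * \<sigma> (\<theta> j) \<le> b j * 2 ^ (m j + 1)" using sg(2)[of j] b_pos[of j] by (intro mult_left_mono) auto
    also have "\<dots> = 2 * w" by (simp add: bj)
    also have "\<dots> \<le> 2 * w * \<kappa>" using kappa w by simp
    finally have "b j / 2 \<le> L / \<sigma> (\<theta> j) / 4" using s1 by (simp add: L_def field_simps)
    moreover have "r * 2 ^ j / 2 = L / (8 * \<kappa>)" using kappa by (simp add: L_def w_def)
    ultimately have QR: "x \<in> ?R" if "x - v \<in> ?Q" for x
      using that by (intro subsetD[OF box_subset_open_rectangle]) (auto simp: algebra_simps)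
    have RT: "?R \<inter> {x. x - v \<in> core r K} \<in> sets borel"
      using borel_open[OF open_open_rectangle] by measurable
    have "ennreal (r * b j / 2 ^ (K - j)) \<le> emeasure lborel {x. x - v \<in> ?Q \<inter> core r K}"
      using Q by (subst emeasure_translate) auto
    also have "\<dots> \<le> emeasure lborel (?R \<inter> {x. x - v \<in> core r K})"
      using RT QR by (intro emeasure_mono) auto
    also have "\<dots> = ennreal (measure lebesgue (?R \<inter> {x. x - v \<in> core r K}))"
    proof -
      have "?R \<inter> {x. x - v \<in> core r K} \<in> lmeasurable"
        using measure_open_rectangle(1)[of "c + v"] RT by (intro fmeasurable_Int_fmeasurable) auto
      from emeasure_eq_measure2[OF this] show ?thesis using RT by simp
    qed
    finally have "r * b j / 2 ^ (K - j) \<le> measure lebesgue (?R \<inter> {x. x - v \<in> core r K})"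
      by (subst (asm) ennreal_le_iff) auto
    then have "2 ^ K * (r * b j / 2 ^ (K - j)) \<le> 2 ^ K * measure lebesgue (?R \<inter> {x. x - v \<in> core r K})"
      by (intro mult_left_mono) auto
    moreover have "2 ^ K * (r * b j / 2 ^ (K - j)) = w * b j"
    proof -
      have "(2::real) ^ K = 2 ^ j * 2 ^ (K - j)" using j by (simp add: power_add[symmetric])
      then show ?thesis by (simp add: w_def)
    qed
    ultimately have wb: "w * b j \<le> 2 ^ K * measure lebesgue (?R \<inter> {x. x - v \<in> core r K})" by simp
    \<comment> \<open>Inserting L = 4 \<kappa> w produces the constant 64 \<kappa>^3; the lower
      bound 2^(m_j) on the shape replaces w divided by the shape by b_j.\<close>
    have "measure lebesgue ?R \<le> 4 * \<kappa> * L * (L / \<sigma> (\<theta> j))" by (rule measure_open_rectangle(3))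
    also have "\<dots> = 64 * \<kappa> ^ 3 * (w * (w / \<sigma> (\<theta> j)))" by (simp add: L_def power3_eq_cube)
    also have "\<dots> \<le> 64 * \<kappa> ^ 3 * (w * b j)"
      unfolding bj using w kappa sg(1)[of j] s1 by (intro mult_left_mono divide_left_mono) auto
    also have "\<dots> \<le> 64 * \<kappa> ^ 3 * (2 ^ K * measure lebesgue (?R \<inter> {x. x - v \<in> core r K}))"
      using wb kappa by (intro mult_left_mono) auto
    finally have m1: "measure lebesgue ?R \<le> \<dots>" .
    have "0 < L * (L / \<sigma> (\<theta> j)) / (8 * \<kappa>)" using L s1 kappa by simp
    then have m2: "0 < measure lebesgue ?R" using measure_open_rectangle(2)[of "c + v"] by linarith
    have "diameter ?R \<le> 4 * \<kappa> * L" by (rule diameter_open_rectangle_le)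
    also have "\<dots> = 16 * \<kappa>\<^sup>2 * w" by (simp add: L_def power2_eq_square)
    also have "\<dots> \<le> 16 * \<kappa>\<^sup>2 * (\<delta> / (32 * \<kappa>\<^sup>2))"
      using rK[OF j] by (intro mult_left_mono) (auto simp: w_def)
    also have "\<dots> < \<delta>" using kappa assms by simp
    finally have d: "diameter ?R < \<delta>" .
    show "\<exists>R\<in>rectangle_basis \<Theta> \<sigma>. z \<in> R \<and> R \<in> lmeasurable \<and> bounded R \<and> diameter R < \<delta> \<and>
      0 < measure lebesgue R \<and>
      measure lebesgue R \<le> 64 * \<kappa> ^ 3 * (2 ^ K * measure lebesgue (R \<inter> {x. x - v \<in> core r K}))"
      using open_rectangle_mem[OF th L] QR[OF zQ] measure_open_rectangle(1) bounded_open_rectangle d m1 m2 by blast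
  qed (use sub y y1 in auto)
qed

text \<open>About 4/y translates of Y cover half of the square. The same translates of T have total
  measure at most 5 \<tau> / y, hence at most 10 / ((K+1) 2^K), and K is chosen with 2^K comparable
  to s.\<close>

lemma bad_set:
  assumes "\<delta> > 0" "s \<ge> 2"
  obtains E G :: "(real^2) set"
  where "E \<in> sets borel" "G \<in> sets borel" "G \<subseteq> unit_square"
    "emeasure lborel E \<le> ennreal (20 / (s * ln s))" "emeasure lborel G \<ge> ennreal (1 / 2)"
    "\<And>z. z \<in> G \<Longrightarrow> \<exists>R\<in>rectangle_basis \<Theta> \<sigma>. z \<in> R \<and> R \<in> lmeasurable \<and> bounded R \<and> diameter R < \<delta> \<and>
      0 < measure lebesgue R \<and> measure lebesgue R \<le> 64 * \<kappa> ^ 3 * (s * measure lebesgue (R \<inter> E))"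
proof -
  obtain K where K: "2 ^ K \<le> s" "s < 2 ^ (K + 1)" using ex_dyadic_interval[of s] assms by auto
  obtain T Y :: "(real^2) set" and \<tau> y :: real where [measurable]: "T \<in> sets borel" "Y \<in> sets borel"
    and Y: "Y \<subseteq> unit_square"
    "emeasure lborel T = ennreal \<tau>" "emeasure lborel Y = ennreal y" "0 < \<tau>" "0 < y" "y \<le> 1"
    and ty: "real (K + 1) * 2 ^ K * \<tau> \<le> 2 * y"
    and ex: "\<And>z v. z - v \<in> Y \<Longrightarrow> \<exists>R\<in>rectangle_basis \<Theta> \<sigma>. z \<in> R \<and> R \<in> lmeasurable \<and> bounded R \<and> diameter R < \<delta> \<and>
      0 < measure lebesgue R \<and>
      measure lebesgue R \<le> 64 * \<kappa> ^ 3 * (2 ^ K * measure lebesgue (R \<inter> {x. x - v \<in> T}))"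
    by (rule crystallization[OF assms(1), of K]) blast
  \<comment> \<open>From n \<ge> 4/y follows n y / 8 \<ge> 1/2; rounding up adds at most 1 \<le>
    1/y, hence the bound 5/y.\<close>
  define n where "n = nat \<lceil>4 / y\<rceil>"
  have n: "4 / y \<le> real n" "real n \<le> 5 / y"
  proof -
    have "1 \<le> 1 / y" using Y by simp
    moreover have "0 \<le> 4 / y" using Y by simp
    ultimately show "4 / y \<le> real n" "real n \<le> 5 / y" unfolding n_def by linarith+
  qed
  obtain V where V: "finite V" "card V \<le> n" and
    cov: "emeasure lborel (unit_square \<inter> (\<Union>v\<in>V. {x. x - v \<in> Y})) \<ge> ennreal (1 / 2) \<or>
     emeasure lborel (unit_square \<inter> (\<Union>v\<in>V. {x. x - v \<in> Y})) \<ge> ennreal (real n * (y / 8))"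
    using translates_cover[of Y y n] Y by auto
  define E where "E = (\<Union>v\<in>V. {x. x - v \<in> T})"
  define G where "G = unit_square \<inter> (\<Union>v\<in>V. {x. x - v \<in> Y})"
  have E [measurable]: "E \<in> sets borel" unfolding E_def by (intro sets.finite_UN V(1) translate_borel) simp
  have G [measurable]: "G \<in> sets borel" unfolding G_def by (intro sets.Int sets.finite_UN V(1) translate_borel unit_square_borel) simp
  have ls: "ln s > 0" "s > 0" using assms by auto
  show ?thesis
  proof (rule that[OF E G])
    show "G \<subseteq> unit_square" by (auto simp: G_def)
    have "1 / 2 \<le> real n * (y / 8)" using n(1) Y by (simp add: field_simps)
    then have "ennreal (1 / 2) \<le> ennreal (real n * (y / 8))" by (rule ennreal_leI)
    then show "ennreal (1 / 2) \<le> emeasure lborel G" using cov unfolding G_def by (auto intro: order.trans)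
    have "emeasure lborel E \<le> (\<Sum>v\<in>V. emeasure lborel {x. x - v \<in> T})"
      unfolding E_def using V(1) by (intro emeasure_subadditive_finite) auto
    also have "\<dots> = of_nat (card V) * ennreal \<tau>" by (simp add: emeasure_translate Y)
    also have "\<dots> = ennreal (real (card V) * \<tau>)"
      using Y by (simp add: ennreal_mult ennreal_of_nat_eq_real_of_nat)
    also have "\<dots> \<le> ennreal (20 / (s * ln s))"
    proof (rule ennreal_leI)
      have "real (card V) * \<tau> \<le> 5 / y * \<tau>" using V(2) n(2) Y by (intro mult_right_mono) auto
      also have "\<dots> \<le> 10 / (real (K + 1) * 2 ^ K)" 
      proof -
        define P where "P = real (K + 1) * 2 ^ K"
        have "P > 0" by (simp add: P_def)
        moreover have "P * \<tau> \<le> 2 * y" using ty by (simp only: P_def)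
        ultimately show ?thesis unfolding P_def[symmetric] using Y by (simp add: field_simps)
      qed
      also have "\<dots> \<le> 20 / (s * ln s)"
      proof -
        \<comment> \<open>With ln s \<le> (K+1) ln 2 and s < 2^(K+1), the passage from 2^K to s
          turns 10 into 20.\<close>
        have "ln s \<le> ln (2 ^ (K + 1))" using K ls by simp
        also have "\<dots> = real (K + 1) * ln 2" by (rule ln_realpow)
        also have "\<dots> \<le> real (K + 1) * 1" using ln_2_less_1 by (intro mult_left_mono) auto
        finally have "ln s \<le> real (K + 1)" by simp
        then have "s * ln s \<le> 2 ^ (K + 1) * real (K + 1)" using K ls by (intro mult_mono) auto
        then have "s * ln s \<le> 2 * (real (K + 1) * 2 ^ K)" by (simp add: mult_ac)
        then have "20 / (2 * (real (K + 1) * 2 ^ K)) \<le> 20 / (s * ln s)"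
          using ls by (intro divide_left_mono) auto
        then show ?thesis by simp
      qed
      finally show "real (card V) * \<tau> \<le> 20 / (s * ln s)" .
    qed
    finally show "emeasure lborel E \<le> ennreal (20 / (s * ln s))" .
    fix z assume "z \<in> G"
    then obtain v where v: "v \<in> V" "z - v \<in> Y" by (auto simp: G_def)
    obtain R where R: "R \<in> rectangle_basis \<Theta> \<sigma>" "z \<in> R" "R \<in> lmeasurable" "bounded R" "diameter R < \<delta>"
      "0 < measure lebesgue R"
      "measure lebesgue R \<le> 64 * \<kappa> ^ 3 * (2 ^ K * measure lebesgue (R \<inter> {x. x - v \<in> T}))"
      using ex[OF v(2)] by blast
    have "2 ^ K * measure lebesgue (R \<inter> {x. x - v \<in> T}) \<le> s * measure lebesgue (R \<inter> E)"
    proof (intro mult_mono measure_mono_fmeasurable)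
      show "R \<inter> {x. x - v \<in> T} \<subseteq> R \<inter> E" using v by (auto simp: E_def)
      show "R \<inter> {x. x - v \<in> T} \<in> sets lebesgue" using R(3) by (intro sets.Int) (auto dest: fmeasurableD)
      show "R \<inter> E \<in> lmeasurable" using R(3) E by (intro fmeasurable_Int_fmeasurable) auto
    qed (use K ls in auto)
    then have "64 * \<kappa> ^ 3 * (2 ^ K * measure lebesgue (R \<inter> {x. x - v \<in> T})) \<le> 64 * \<kappa> ^ 3 * (s * measure lebesgue (R \<inter> E))"
      using kappa by (intro mult_left_mono) auto
    with R(7) have "measure lebesgue R \<le> 64 * \<kappa> ^ 3 * (s * measure lebesgue (R \<inter> E))" by (rule order.trans)
    with R show "\<exists>R\<in>rectangle_basis \<Theta> \<sigma>. z \<in> R \<and> R \<in> lmeasurable \<and> bounded R \<and> diameter R < \<delta> \<and>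
      0 < measure lebesgue R \<and> measure lebesgue R \<le> 64 * \<kappa> ^ 3 * (s * measure lebesgue (R \<inter> E))" by blast
  qed
qed

end

section \<open>A function in the Orlicz space whose means do not converge\<close>

context flat_shapes
begin

text \<open>The function is the supremum of the heights \<open>s n\<close> on the sets
  \<open>E n\<close>. Off these sets it vanishes, yet every point of \<open>G n\<close> lies in a
  rectangle of diameter below 1/(n+1) with mean at least 1 / (64 \<kappa>^3).\<close>

lemma bad_function:
  assumes \<Phi>: "young_function \<Phi>"
    and not_O: "(\<lambda>s. s * ln s) \<notin> O[at_top](\<Phi>)"
    and sub: "orlicz_space \<Phi> \<subseteq> L1_loc"
  shows "\<exists>f\<in>orlicz_space \<Phi>. \<not> differentiates (rectangle_basis \<Theta> \<sigma>) f"
proof -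
  have Phi0: "\<Phi> 0 = 0" and Phi_nonneg: "\<And>s. s \<ge> 0 \<Longrightarrow> \<Phi> s \<ge> 0"
    using \<Phi> by (auto simp: young_function_def)
  have large: "\<exists>s\<ge>M. s * ln s > C * \<Phi> s" if "M \<ge> 1" for C M
  proof (rule ccontr)
    assume "\<not> ?thesis"
    then have *: "s * ln s \<le> C * \<Phi> s" if "s \<ge> M" for s using that by (meson not_le)
    have "\<forall>\<^sub>F s in at_top. norm (s * ln s) \<le> C * norm (\<Phi> s)"
      using eventually_ge_at_top[of M]
    proof eventually_elim
      case (elim s)
      have "s * ln s \<ge> 0" using elim \<open>M \<ge> 1\<close> by simp
      then show ?case using *[OF elim] Phi_nonneg[of s] elim \<open>M \<ge> 1\<close> by simp
    qed
    then have "(\<lambda>s. s * ln s) \<in> O[at_top](\<Phi>)" by (rule bigoI)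
    with not_O show False by simp
  qed
  \<comment> \<open>The size 160 2^n, with ln s \<ge> 1, bounds the measure of \<open>E n\<close> by
    2^(-n) / 8, so these sum to at most 1/4. The second condition bounds the contribution of
    \<open>E n\<close> to the integral of \<Phi>(f) by 20 2^(-n).\<close>
  have "\<forall>n. \<exists>s\<ge>160 * 2 ^ n. s * ln s > 2 ^ n * \<Phi> s"
  proof
    fix n :: nat
    have "1 \<le> 160 * (2::real) ^ n" using one_le_power[of "2::real" n] by linarith
    then show "\<exists>s\<ge>160 * 2 ^ n. s * ln s > 2 ^ n * \<Phi> s" by (rule large)
  qed
  then obtain s :: "nat \<Rightarrow> real" where s: "\<And>n. s n \<ge> 160 * 2 ^ n" "\<And>n. s n * ln (s n) > 2 ^ n * \<Phi> (s n)"
    by metis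
  have s160: "s n \<ge> 160" for n
  proof -
    have "160 * 1 \<le> 160 * (2::real) ^ n" by (intro mult_left_mono) auto
    with s(1)[of n] show ?thesis by linarith
  qed
  have ln1: "ln (s n) \<ge> 1" for n
    using s160[of n] exp_le by (subst ln_ge_iff) auto
  have "\<forall>n. \<exists>E G. E \<in> sets borel \<and> G \<in> sets borel \<and> G \<subseteq> unit_square \<and>
    emeasure lborel E \<le> ennreal (20 / (s n * ln (s n))) \<and> emeasure lborel G \<ge> ennreal (1 / 2) \<and>
    (\<forall>z\<in>G. \<exists>R\<in>rectangle_basis \<Theta> \<sigma>. z \<in> R \<and> R \<in> lmeasurable \<and> bounded R \<and> diameter R < 1 / real (Suc n) \<and>
      0 < measure lebesgue R \<and> measure lebesgue R \<le> 64 * \<kappa> ^ 3 * (s n * measure lebesgue (R \<inter> E)))"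
  proof
    fix n
    show "\<exists>E G. E \<in> sets borel \<and> G \<in> sets borel \<and> G \<subseteq> unit_square \<and>
      emeasure lborel E \<le> ennreal (20 / (s n * ln (s n))) \<and> emeasure lborel G \<ge> ennreal (1 / 2) \<and>
      (\<forall>z\<in>G. \<exists>R\<in>rectangle_basis \<Theta> \<sigma>. z \<in> R \<and> R \<in> lmeasurable \<and> bounded R \<and> diameter R < 1 / real (Suc n) \<and>
        0 < measure lebesgue R \<and> measure lebesgue R \<le> 64 * \<kappa> ^ 3 * (s n * measure lebesgue (R \<inter> E)))"
      by (rule bad_set[of "1 / real (Suc n)" "s n"]) (use s160[of n] in \<open>simp, simp, blast\<close>)
  qed
  then obtain E G :: "nat \<Rightarrow> (real^2) set" where E [measurable]: "\<And>n. E n \<in> sets borel"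
    and G [measurable]: "\<And>n. G n \<in> sets borel" and Gsub: "\<And>n. G n \<subseteq> unit_square"
    and Em: "\<And>n. emeasure lborel (E n) \<le> ennreal (20 / (s n * ln (s n)))"
    and Gm: "\<And>n. emeasure lborel (G n) \<ge> ennreal (1 / 2)"
    and GR: "\<And>n z. z \<in> G n \<Longrightarrow> \<exists>R\<in>rectangle_basis \<Theta> \<sigma>. z \<in> R \<and> R \<in> lmeasurable \<and> bounded R \<and> diameter R < 1 / real (Suc n) \<and>
      0 < measure lebesgue R \<and> measure lebesgue R \<le> 64 * \<kappa> ^ 3 * (s n * measure lebesgue (R \<inter> E n))"
    by metis
  have Em2: "emeasure lborel (E n) \<le> ennreal ((1 / 8) * (1 / 2) ^ n)" for n
  proof -
    have "160 * 2 ^ n * 1 \<le> s n * ln (s n)" using s(1)[of n] ln1[of n] s160[of n] by (intro mult_mono) auto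
    moreover have "s n * ln (s n) > 0" using s160[of n] ln1[of n] by simp
    ultimately have "20 / (s n * ln (s n)) \<le> 20 / (160 * 2 ^ n * 1)"
      by (intro divide_left_mono) simp_all
    also have "\<dots> = (1 / 8) * (1 / 2) ^ n" by (simp add: power_divide)
    finally show ?thesis using Em[of n] by (meson ennreal_leI order.trans)
  qed
  have PhiE: "ennreal (\<Phi> (s n)) * emeasure lborel (E n) \<le> ennreal (20 * (1 / 2) ^ n)" for n
  proof -
    have pos: "s n * ln (s n) > 0" using s160[of n] ln1[of n] by simp
    have "ennreal (\<Phi> (s n)) * emeasure lborel (E n) \<le> ennreal (\<Phi> (s n)) * ennreal (20 / (s n * ln (s n)))"
      by (intro mult_left_mono Em) simp
    also have "\<dots> = ennreal (\<Phi> (s n) * (20 / (s n * ln (s n))))"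
      using Phi_nonneg[of "s n"] s160[of n] pos by (intro ennreal_mult[symmetric]) auto
    also have "\<dots> \<le> ennreal (20 * (1 / 2) ^ n)"
    proof (rule ennreal_leI)
      have "20 * (2 ^ n * \<Phi> (s n)) \<le> 20 * (s n * ln (s n))" using s(2)[of n] by simp
      then have "20 * \<Phi> (s n) \<le> 20 * (s n * ln (s n)) * (1 / 2) ^ n" by (simp add: power_divide field_simps)
      then show "\<Phi> (s n) * (20 / (s n * ln (s n))) \<le> 20 * (1 / 2) ^ n"
        using pos by (simp add: pos_divide_le_eq mult_ac)
    qed
    finally show ?thesis .
  qed
  \<comment> \<open>A supremum, not a sum: f then takes only the values 0 and \<open>s n\<close>, so
    \<Phi>(f) is at most the sum of the \<Phi>(s_n) over the sets containing the point, whatever the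
    growth of \<Phi>.\<close>
  define F where "F x = (SUP n. ennreal (s n) * indicator (E n) x)" for x
  have [measurable]: "F \<in> borel_measurable borel" unfolding F_def by measurable
  define f where "f x = enn2real (F x)" for x
  have f_meas [measurable]: "f \<in> borel_measurable borel" unfolding f_def by measurable
  \<comment> \<open>Where F is infinite, the default value 0 of \<open>enn2real\<close> keeps the
    alternative true. Where F is finite, only finitely many n occur since the heights tend to
    infinity, and the supremum is a maximum.\<close>
  have f_cases: "f x = 0 \<or> (\<exists>n. x \<in> E n \<and> f x = s n)" for x
  proof (cases "F x = top \<or> (\<forall>n. x \<notin> E n)")
    case True
    moreover have "F x = 0" if "\<forall>n. x \<notin> E n" using that by (simp add: F_def)
    ultimately have "f x = 0" by (auto simp: f_def)
    then show ?thesis ..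
  next
    case False
    then obtain B where B: "F x = ennreal B" "B \<ge> 0" by (cases "F x") auto
    define I where "I = {n. x \<in> E n}"
    have le: "s n \<le> B" if "n \<in> I" for n
    proof -
      have "ennreal (s n) \<le> F x" unfolding F_def using that by (intro SUP_upper2[of n]) (auto simp: I_def)
      then show ?thesis using B by simp
    qed
    have "I \<subseteq> {..nat \<lceil>B\<rceil>}"
    proof
      fix n assume "n \<in> I"
      have "real n \<le> 2 ^ n" by (rule less_imp_le) (rule of_nat_less_two_power)
      also have "\<dots> \<le> s n" using s(1)[of n] s160[of n] by (smt (verit) zero_le_power)
      also have "\<dots> \<le> B" using le \<open>n \<in> I\<close> .
      finally show "n \<in> {..nat \<lceil>B\<rceil>}" by simp linarith
    qed
    then have fin: "finite (s ` I)" by (intro finite_imageI) (rule finite_subset, auto)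
    have "s ` I \<noteq> {}" using False by (auto simp: I_def)
    from Max_in[OF fin this] obtain n where n: "n \<in> I" "Max (s ` I) = s n" by auto
    have "F x = ennreal (s n)"
    proof (rule antisym)
      show "F x \<le> ennreal (s n)" unfolding F_def
      proof (rule SUP_least)
        fix k
        show "ennreal (s k) * indicator (E k) x \<le> ennreal (s n)"
          using Max_ge[OF fin, of "s k"] n(2) by (auto simp: I_def indicator_def intro!: ennreal_leI)
      qed
      show "ennreal (s n) \<le> F x" unfolding F_def using n(1) by (intro SUP_upper2[of n]) (auto simp: I_def)
    qed
    then have "f x = s n" using s160[of n] by (simp add: f_def)
    then show ?thesis using n(1) by (auto simp: I_def)
  qed
  have f_nonneg: "f x \<ge> 0" for x by (simp add: f_def)
  have "(\<integral>\<^sup>+x. ennreal (\<Phi> (\<bar>f x\<bar> / 1)) \<partial>lebesgue) \<le> (\<integral>\<^sup>+x. (\<Sum>n. ennreal (\<Phi> (s n)) * indicator (E n) x) \<partial>lebesgue)"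
  proof (rule nn_integral_mono)
    fix x
    show "ennreal (\<Phi> (\<bar>f x\<bar> / 1)) \<le> (\<Sum>n. ennreal (\<Phi> (s n)) * indicator (E n) x)"
      using f_cases[of x]
    proof
      assume "\<exists>n. x \<in> E n \<and> f x = s n"
      then obtain n where n: "x \<in> E n" "f x = s n" by blast
      have "ennreal (\<Phi> (s n)) * indicator (E n) x = (\<Sum>k\<in>{n}. ennreal (\<Phi> (s k)) * indicator (E k) x)"
        by (simp only: sum.insert[OF finite.emptyI] sum.empty empty_iff not_False_eq_True add_0_right)
      also have "\<dots> \<le> (\<Sum>n. ennreal (\<Phi> (s n)) * indicator (E n) x)"
        by (rule sum_le_suminf) auto
      finally show ?thesis using n s160[of n] by simp
    qed (simp add: Phi0)
  qed
  also have "\<dots> = (\<Sum>n. \<integral>\<^sup>+x. ennreal (\<Phi> (s n)) * indicator (E n) x \<partial>lborel)"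
    by (subst nn_integral_completion, measurable) (rule nn_integral_suminf, measurable)
  also have "\<dots> = (\<Sum>n. ennreal (\<Phi> (s n)) * emeasure lborel (E n))"
    by (intro suminf_cong nn_integral_cmult_indicator) auto
  also have "\<dots> \<le> (\<Sum>n. ennreal (20 * (1 / 2) ^ n))"
    by (intro suminf_le PhiE) auto
  also have "\<dots> = ennreal (20 * (1 / (1 - 1 / 2)))"
  proof (rule suminf_ennreal_eq)
    show "(\<lambda>n. 20 * (1 / 2) ^ n) sums (20 * (1 / (1 - 1 / 2)) :: real)"
      by (intro sums_mult geometric_sums) simp
  qed simp
  also have "\<dots> < \<infinity>" by simp
  finally have "(\<integral>\<^sup>+x. ennreal (\<Phi> (\<bar>f x\<bar> / 1)) \<partial>lebesgue) < \<infinity>" .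
  then have f_orlicz: "f \<in> orlicz_space \<Phi>"
    unfolding orlicz_space_def using f_meas
    by (intro CollectI conjI exI[of _ 1] measurable_completion) simp_all
  have sumE: "(\<Sum>n. emeasure lborel (E n)) \<le> ennreal (1 / 4)"
  proof -
    have "(\<Sum>n. emeasure lborel (E n)) \<le> (\<Sum>n. ennreal ((1 / 8) * (1 / 2) ^ n))"
      by (intro suminf_le Em2) auto
    also have "\<dots> = ennreal (1 / 4)"
    proof (rule suminf_ennreal_eq)
      have "(\<lambda>n. (1 / 8) * (1 / 2) ^ n) sums (1 / 8 * (1 / (1 - 1 / 2)) :: real)"
        by (intro sums_mult geometric_sums) simp
      then show "(\<lambda>n. (1 / 8) * (1 / 2) ^ n) sums (1 / 4 :: real)" by simp
    qed simp
    finally show ?thesis .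
  qed
  \<comment> \<open>Borel-Cantelli: almost every point lies in only finitely many of the sets
    \<open>E n\<close>.\<close>
  have F_fin: "AE x in lborel. F x \<noteq> top"
  proof -
    have fin: "emeasure lborel (E n) < \<infinity>" for n using Em2[of n] by (auto intro: le_less_trans)
    have me: "measure lborel (E n) \<le> (1 / 8) * (1 / 2) ^ n" for n
      unfolding measure_def using Em2[of n] by (intro enn2real_leI) auto
    have "summable (\<lambda>n. measure lborel (E n))"
      by (rule summable_comparison_test'[of "\<lambda>n. (1 / 8) * (1 / 2) ^ n" 0]) (use me in \<open>auto intro: summable_mult\<close>)
    then have "AE x in lborel. eventually (\<lambda>n. x \<in> space lborel - E n) sequentially"
      using fin by (intro borel_cantelli_AE1) auto
    then show ?thesis
    proof eventually_elim
      case (elim x)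
      then obtain N where N: "\<And>n. n \<ge> N \<Longrightarrow> x \<notin> E n" by (auto simp: eventually_sequentially)
      have "F x \<le> (\<Sum>n<N. ennreal (s n))" unfolding F_def
      proof (rule SUP_least)
        fix n
        show "ennreal (s n) * indicator (E n) x \<le> (\<Sum>n<N. ennreal (s n))"
        proof (cases "n < N")
          case True
          have "ennreal (s n) * indicator (E n) x \<le> ennreal (s n)" by (simp add: indicator_def)
          also have "\<dots> \<le> (\<Sum>n<N. ennreal (s n))" using True by (intro member_le_sum) auto
          finally show ?thesis .
        qed (use N in simp)
      qed
      also have "\<dots> < top" by simp
      finally show ?case by simp
    qed
  qed
  \<comment> \<open>Only almost everywhere, because f is 0 where F is infinite.\<close>
  have f_ge: "AE x in lebesgue. f x \<ge> s n * indicator (E n) x" for n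
  proof (rule AE_completion, use F_fin in eventually_elim)
    fix x assume "F x \<noteq> top"
    then have "ennreal (f x) = F x" by (simp add: f_def less_top)
    moreover have "ennreal (s n * indicator (E n) x) \<le> F x"
      unfolding F_def by (rule SUP_upper2[of n]) (auto simp: indicator_def)
    ultimately have "ennreal (s n * indicator (E n) x) \<le> ennreal (f x)" by simp
    then show "s n * indicator (E n) x \<le> f x" using f_nonneg by (simp add: ennreal_le_iff)
  qed
  have avg: "(LINT y:R|lebesgue. f y) \<ge> s n * measure lebesgue (R \<inter> E n)"
    if R: "R \<in> lmeasurable" "bounded R" for R n
  proof -
    have "set_integrable lebesgue (closure R) f"
      using f_orlicz sub R(2) by (auto simp: L1_loc_def compact_closure)
    then have i: "set_integrable lebesgue R f"
      by (rule set_integrable_subset) (use R closure_subset in \<open>auto dest: fmeasurableD\<close>)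
    have RE: "R \<inter> E n \<in> lmeasurable" using R(1) E by (intro fmeasurable_Int_fmeasurable) auto
    have "s n * measure lebesgue (R \<inter> E n) = (LINT y|lebesgue. s n * indicator (R \<inter> E n) y)"
      using RE by (simp add: fmeasurableD)
    also have "\<dots> \<le> (LINT y:R|lebesgue. f y)"
      unfolding set_lebesgue_integral_def
    proof (rule integral_mono_AE)
      show "integrable lebesgue (\<lambda>y. s n * indicator (R \<inter> E n) y)"
        using RE by (intro integrable_mult_right) (auto simp: fmeasurable_def)
      show "integrable lebesgue (\<lambda>y. indicator R y *\<^sub>R f y)" using i by (simp add: set_integrable_def)
      show "AE y in lebesgue. s n * indicator (R \<inter> E n) y \<le> indicator R y *\<^sub>R f y"
        using f_ge[of n] by eventually_elim (auto simp: indicator_def)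
    qed
    finally show ?thesis .
  qed
  \<comment> \<open>The points lying in infinitely many \<open>G n\<close>, hence in arbitrarily
    small bad rectangles. Continuity from above inside the unit square preserves the lower bound
    1/2.\<close>
  define G' where "G' = (\<Inter>n. \<Union>k\<in>{n..}. G k)"
  have [measurable]: "G' \<in> sets borel" unfolding G'_def by measurable
  have G'm: "emeasure lborel G' \<ge> ennreal (1 / 2)"
  proof -
    have "(INF n. emeasure lborel (\<Union>k\<in>{n..}. G k)) = emeasure lborel G'"
      unfolding G'_def
    proof (rule INF_emeasure_decseq)
      show "range (\<lambda>n. \<Union>k\<in>{n..}. G k) \<subseteq> sets lborel" by auto
      show "decseq (\<lambda>n. \<Union>k\<in>{n..}. G k)" by (fastforce simp: decseq_def)
      fix n
      have "emeasure lborel (\<Union>k\<in>{n..}. G k) \<le> emeasure lborel unit_square"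
        using Gsub by (intro emeasure_mono) auto
      then show "emeasure lborel (\<Union>k\<in>{n..}. G k) \<noteq> \<infinity>" by (auto simp: emeasure_unit_square top_unique)
    qed
    moreover have "ennreal (1 / 2) \<le> emeasure lborel (\<Union>k\<in>{n..}. G k)" for n
      by (rule order.trans[OF Gm[of n]]) (rule emeasure_mono, auto)
    ultimately show ?thesis by (metis INF_greatest)
  qed
  have bad: "\<not> ((\<lambda>B. (LINT y:B|lebesgue. f y) / measure lebesgue B) \<longlongrightarrow> f x) (shrinking_filter (rectangle_basis \<Theta> \<sigma>) x)"
    if x: "x \<in> G'" "x \<notin> (\<Union>n. E n)" for x
  proof
    assume lim: "((\<lambda>B. (LINT y:B|lebesgue. f y) / measure lebesgue B) \<longlongrightarrow> f x) (shrinking_filter (rectangle_basis \<Theta> \<sigma>) x)"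
    have fx: "f x = 0" using f_cases[of x] x(2) by auto
    \<comment> \<open>The lower bound for the means over bad rectangles, the same for every n,
      whereas f x = 0.\<close>
    define e where "e = 1 / (64 * \<kappa> ^ 3)"
    have e: "e > 0" using kappa by (simp add: e_def)
    from tendstoD[OF lim e] obtain d where d: "d > 0"
      "\<And>B. B \<in> rectangle_basis \<Theta> \<sigma> \<Longrightarrow> x \<in> B \<Longrightarrow> bounded B \<Longrightarrow> diameter B < d \<Longrightarrow>
        dist ((LINT y:B|lebesgue. f y) / measure lebesgue B) (f x) < e"
      unfolding eventually_shrinking_filter by blast
    obtain N where N: "1 / real (Suc N) < d" using nat_approx_posE[OF d(1)] by auto
    obtain n where n: "n \<ge> N" "x \<in> G n" using x(1) by (auto simp: G'_def)
    obtain R where R: "R \<in> rectangle_basis \<Theta> \<sigma>" "x \<in> R" "R \<in> lmeasurable" "bounded R"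
      "diameter R < 1 / real (Suc n)" "0 < measure lebesgue R"
      "measure lebesgue R \<le> 64 * \<kappa> ^ 3 * (s n * measure lebesgue (R \<inter> E n))"
      using GR[OF n(2)] by blast
    have "1 / real (Suc n) \<le> 1 / real (Suc N)" using n(1) by (intro divide_left_mono) auto
    then have "dist ((LINT y:R|lebesgue. f y) / measure lebesgue R) (f x) < e"
      using R N by (intro d(2)) auto
    then have "(LINT y:R|lebesgue. f y) / measure lebesgue R < e" unfolding fx dist_real_def diff_zero by (rule le_less_trans[OF abs_ge_self])
    then have "(LINT y:R|lebesgue. f y) < e * measure lebesgue R" using R(6) by (simp add: pos_divide_less_eq)
    also have "\<dots> \<le> s n * measure lebesgue (R \<inter> E n)"
      using R(7) kappa by (simp add: e_def field_simps)
    also have "\<dots> \<le> (LINT y:R|lebesgue. f y)" by (rule avg[OF R(3,4)])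
    finally show False by simp
  qed
  have "\<not> differentiates (rectangle_basis \<Theta> \<sigma>) f"
  proof
    assume "differentiates (rectangle_basis \<Theta> \<sigma>) f"
    \<comment> \<open>Differentiation would make this bad set null, although \<open>G'\<close> has
      measure at least 1/2 and the union of the \<open>E n\<close> at most 1/4.\<close>
    then have "AE x in lborel. x \<notin> G' - (\<Union>n. E n)"
      unfolding differentiates_def AE_completion_iff by eventually_elim (use bad in auto)
    then have "emeasure lborel (G' - (\<Union>n. E n)) = 0"
      by (subst (asm) AE_iff_measurable[of "G' - (\<Union>n. E n)"]) auto
    have "ennreal (1 / 2) \<le> emeasure lborel ((G' - (\<Union>n. E n)) \<union> (\<Union>n. E n))"
      by (rule order.trans[OF G'm]) (rule emeasure_mono, auto)
    also have "\<dots> \<le> emeasure lborel (G' - (\<Union>n. E n)) + emeasure lborel (\<Union>n. E n)"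
      by (rule emeasure_subadditive) auto
    also have "\<dots> \<le> 0 + (\<Sum>n. emeasure lborel (E n))"
      using \<open>emeasure lborel (G' - (\<Union>n. E n)) = 0\<close>
      by (intro add_mono emeasure_subadditive_countably) auto
    also have "\<dots> \<le> ennreal (1 / 4)" using sumE by simp
    finally show False by (subst (asm) ennreal_le_iff) auto
  qed
  with f_orlicz show ?thesis by blast
qed

theorem differentiates_exactly: "differentiates_exactly_L_log_L (rectangle_basis \<Theta> \<sigma>)"
  unfolding differentiates_exactly_L_log_L_def differentiates_space_def
proof (intro conjI allI impI ballI)
  show "L_log_L \<subseteq> L1_loc" by (rule L_log_L_subset_L1_loc)
  fix f assume "f \<in> L_log_L"
  then show "differentiates (rectangle_basis \<Theta> \<sigma>) f"
    by (intro differentiates_L_log_L[OF kappa]) (use angle flat in auto)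
next
  fix \<Phi> assume "young_function \<Phi>"
    "orlicz_space \<Phi> \<subseteq> L1_loc \<and> Ball (orlicz_space \<Phi>) (differentiates (rectangle_basis \<Theta> \<sigma>))"
  then show "(\<lambda>s. s * ln s) \<in> O[at_top](\<Phi>)" using bad_function[of \<Phi>] by blast
qed

end

section \<open>The shapes determined by \<open>rho\<close>\<close>

lemma sigma_star_eq:
  assumes "0 < \<theta>" "\<theta> < pi / 2"
  shows "sigma_star t \<theta> = cot \<theta> / (1 - 2 * t)"
proof -
  have s: "sin \<theta> > 0" "cos \<theta> > 0" using assms by (auto intro: sin_gt_zero cos_gt_zero)
  have s2: "sin (2 * \<theta>) > 0" using assms by (intro sin_gt_zero) auto
  \<comment> \<open>The root is 1 / sin 2\<theta> since the sine is positive, and the half-angle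
    formula turns (cos 2\<theta> + 1) / sin 2\<theta> into cot \<theta>.\<close>
  have "1 + (cot (2 * \<theta>))\<^sup>2 = ((sin (2 * \<theta>))\<^sup>2 + (cos (2 * \<theta>))\<^sup>2) / (sin (2 * \<theta>))\<^sup>2"
    using s2 by (simp add: cot_def power_divide add_divide_distrib del: sin_cos_squared_add)
  then have "1 + (cot (2 * \<theta>))\<^sup>2 = (1 / sin (2 * \<theta>))\<^sup>2" by (simp add: power_divide)
  then have "sqrt (1 + (cot (2 * \<theta>))\<^sup>2) = 1 / sin (2 * \<theta>)" using s2 by simp
  then have "cot (2 * \<theta>) + sqrt (1 + (cot (2 * \<theta>))\<^sup>2) = (cos (2 * \<theta>) + 1) / sin (2 * \<theta>)"
    by (simp add: cot_def add_divide_distrib)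
  also have "cos (2 * \<theta>) + 1 = 2 * cos \<theta> * cos \<theta>" by (simp add: cos_double_cos power2_eq_square)
  also have "2 * cos \<theta> * cos \<theta> / sin (2 * \<theta>) = cot \<theta>"
    using s by (simp add: sin_double cot_def)
  finally show ?thesis by (simp add: sigma_star_def)
qed

text \<open>If the shapes stayed bounded by \<open>M\<close> along angles tending to \<open>0\<close>, then \<^const>\<open>rho\<close> would
  tend to \<open>1 / (1 - 2 * t)\<close>, which is smaller than \<open>\<rho>\<^sub>0\<close>.\<close>

lemma rho_bounded_shape_less:
  assumes c: "0 < 1 - 2 * t" and r: "1 / (1 - 2 * t) < r"
  shows "\<exists>\<epsilon>>0. \<forall>\<theta> s. 0 < \<theta> \<longrightarrow> \<theta> < \<epsilon> \<longrightarrow> 1 \<le> s \<longrightarrow> s \<le> M \<longrightarrow> rho t \<theta> s < r"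
proof -
  define c where "c = 1 - 2 * t"
  have c0: "c > 0" using assms by (simp add: c_def)
  \<comment> \<open>r times a lower bound of the denominator minus an upper bound of the numerator,
    both uniform over shapes between 1 and M. It is continuous, and its value r c - 1 at 0 is
    positive.\<close>
  define g where "g \<theta> = r * (c * cos (2 * \<theta>) - 1 / 2 * (c\<^sup>2 * M) * sin (2 * \<theta>)) - (1 + 1 / 2 * (M + 1) * sin (2 * \<theta>))" for \<theta> :: real
  have "isCont g 0" unfolding g_def by (intro continuous_intros)
  moreover have "g 0 > 0" using r c0 unfolding c_def[symmetric] by (simp add: g_def pos_divide_less_eq)
  ultimately have "\<forall>\<^sub>F \<theta> in at 0. g \<theta> > 0" unfolding isCont_def by (rule order_tendstoD)
  then obtain d where d: "d > 0" "\<And>\<theta>. \<theta> \<noteq> 0 \<Longrightarrow> \<bar>\<theta>\<bar> < d \<Longrightarrow> g \<theta> > 0"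
    unfolding eventually_at by (auto simp: dist_real_def)
  have r0: "r > 0" using r c by (meson divide_pos_pos less_trans zero_less_one)
  show ?thesis
  proof (intro exI[of _ "min d (pi / 2)"] conjI allI impI)
    show "0 < min d (pi / 2)" using d by simp
    fix \<theta> s :: real assume th: "0 < \<theta>" "\<theta> < min d (pi / 2)" and s: "1 \<le> s" "s \<le> M"
    have sp: "sin (2 * \<theta>) > 0" using th by (intro sin_gt_zero) auto
    have num: "1 + 1 / 2 * (s + 1 / s) * sin (2 * \<theta>) \<le> 1 + 1 / 2 * (M + 1) * sin (2 * \<theta>)"
    proof -
      have "1 / s \<le> 1" using s by simp
      with s have "s + 1 / s \<le> M + 1" by linarith
      then show ?thesis using s sp by (intro add_left_mono mult_right_mono mult_left_mono) auto
    qed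
    have den: "c * cos (2 * \<theta>) - 1 / 2 * (c\<^sup>2 * M) * sin (2 * \<theta>) \<le>
        c * cos (2 * \<theta>) + 1 / 2 * (1 / s - c\<^sup>2 * s) * sin (2 * \<theta>)"
    proof -
      have "c\<^sup>2 * s \<le> c\<^sup>2 * M" using s by (intro mult_left_mono) auto
      moreover have "0 \<le> 1 / s" using s by simp
      ultimately have "- (c\<^sup>2 * M) \<le> 1 / s - c\<^sup>2 * s" by linarith
      then have "1 / 2 * - (c\<^sup>2 * M) * sin (2 * \<theta>) \<le> 1 / 2 * (1 / s - c\<^sup>2 * s) * sin (2 * \<theta>)"
        using sp by (intro mult_right_mono mult_left_mono) auto
      then show ?thesis by simp
    qed
    define D where "D = c * cos (2 * \<theta>) + 1 / 2 * (1 / s - c\<^sup>2 * s) * sin (2 * \<theta>)"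
    have "g \<theta> > 0" using d(2)[of \<theta>] th by simp
    then have "1 + 1 / 2 * (M + 1) * sin (2 * \<theta>) < r * (c * cos (2 * \<theta>) - 1 / 2 * (c\<^sup>2 * M) * sin (2 * \<theta>))"
      by (simp add: g_def)
    also have "\<dots> \<le> r * D" unfolding D_def using den r0 by (intro mult_left_mono) auto
    finally have lt: "1 + 1 / 2 * (s + 1 / s) * sin (2 * \<theta>) < r * D" using num by linarith
    \<comment> \<open>Positivity of the denominator comes out of the comparison itself: the positive
      numerator is below r D.\<close>
    have "0 < 1 + 1 / 2 * (s + 1 / s) * sin (2 * \<theta>)" using s sp by (intro add_pos_pos mult_pos_pos) auto
    with lt have "0 < r * D" by linarith
    then have "D > 0" using r0 by (simp add: zero_less_mult_iff)
    then show "rho t \<theta> s < r"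
      using lt unfolding rho_def c_def[symmetric] D_def by (simp only: pos_divide_less_eq)
  qed
qed

theorem corollary3:
  fixes t \<rho>\<^sub>0 :: real and \<Theta> :: "real set" and \<sigma> :: "real \<Rightarrow> real"
  assumes "0 < t" and "t < 1 / 2"
    and "\<Theta> \<subseteq> {0<..<pi / 6}" and "0 islimpt \<Theta>"
    and "\<rho>\<^sub>0 \<ge> 4 * ((1 - t) / (1 - 2 * t))\<^sup>2"
    and "\<And>\<theta>. \<theta> \<in> \<Theta> \<Longrightarrow> \<sigma> \<theta> > 1"
    and "\<And>\<theta>. \<theta> \<in> \<Theta> \<Longrightarrow> 1 / (1 - 2 * t) \<le> \<sigma> \<theta> \<and> \<sigma> \<theta> < sigma_star t \<theta>"
    and "\<And>\<theta>. \<theta> \<in> \<Theta> \<Longrightarrow> rho t \<theta> (\<sigma> \<theta>) = \<rho>\<^sub>0"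
  shows "differentiation_basis (rectangle_basis \<Theta> \<sigma>) \<and>
         differentiates_exactly_L_log_L (rectangle_basis \<Theta> \<sigma>)"
proof -
  have c: "0 < 1 - 2 * t" "1 - 2 * t < 1" using assms(1,2) by auto
  have c1: "1 \<le> 1 / (1 - 2 * t)" using c by simp
  have angle: "0 < sin \<theta>" "0 < cos \<theta>" "0 < \<theta>" "\<theta> < pi / 2" if "\<theta> \<in> \<Theta>" for \<theta>
  proof -
    have "0 < \<theta>" "\<theta> < pi / 6" using that assms(3) by auto
    then show "0 < \<theta>" "\<theta> < pi / 2" using pi_gt_zero by linarith+
    then show "0 < sin \<theta>" "0 < cos \<theta>" by (auto intro: sin_gt_zero cos_gt_zero)
  qed
  have "1 / (1 - 2 * t) < \<rho>\<^sub>0"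
  proof -
    \<comment> \<open>With c = 1 - 2t the lower bound for \<open>\<rho>\<^sub>0\<close> is ((1 + c)
      / c)^2, which exceeds 1 / c because c < (1 + c)^2.\<close>
    have "4 * ((1 - t) / (1 - 2 * t))\<^sup>2 = (1 + (1 - 2 * t))\<^sup>2 / (1 - 2 * t)\<^sup>2"
      by (simp add: power_divide power2_eq_square algebra_simps)
    moreover have "1 / (1 - 2 * t) < (1 + (1 - 2 * t))\<^sup>2 / (1 - 2 * t)\<^sup>2"
    proof -
      have "c < (1 + c)\<^sup>2" if "0 < c" for c :: real using that by (simp add: power2_sum add_pos_pos)
      from this[OF c(1)] have "(1 - 2 * t) / (1 - 2 * t)\<^sup>2 < (1 + (1 - 2 * t))\<^sup>2 / (1 - 2 * t)\<^sup>2"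
        by (rule divide_strict_right_mono) (use c in simp)
      then show ?thesis using c by (simp add: power2_eq_square)
    qed
    ultimately show ?thesis using assms(5) by linarith
  qed
  interpret flat_shapes "1 / (1 - 2 * t)" \<Theta> \<sigma>
  proof (rule flat_shapes.intro[OF c1])
    fix \<theta> assume th: "\<theta> \<in> \<Theta>"
    show "0 \<le> sin \<theta>" "0 \<le> cos \<theta>" "1 \<le> \<sigma> \<theta>" using angle[OF th] assms(6)[OF th] by auto
    have "\<sigma> \<theta> * sin \<theta> \<le> cot \<theta> / (1 - 2 * t) * sin \<theta>"
      using assms(7)[OF th] sigma_star_eq[of \<theta> t] angle[OF th] by (intro mult_right_mono) auto
    also have "\<dots> = cos \<theta> / (1 - 2 * t)" using angle[OF th] by (simp add: cot_def)
    also have "\<dots> \<le> 1 / (1 - 2 * t)" using c by (intro divide_right_mono) auto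
    finally show "\<sigma> \<theta> * sin \<theta> \<le> 1 / (1 - 2 * t)" .
  next
    fix M :: real
    obtain \<epsilon> where e: "\<epsilon> > 0" "\<And>\<theta> s. 0 < \<theta> \<Longrightarrow> \<theta> < \<epsilon> \<Longrightarrow> 1 \<le> s \<Longrightarrow> s \<le> M \<Longrightarrow> rho t \<theta> s < \<rho>\<^sub>0"
      using rho_bounded_shape_less[OF c(1) \<open>1 / (1 - 2 * t) < \<rho>\<^sub>0\<close>, of M] by blast
    obtain \<theta> where th: "\<theta> \<in> \<Theta>" "dist \<theta> 0 < \<epsilon>"
      using assms(4) e(1) unfolding islimpt_approachable by blast
    \<comment> \<open>At so small an angle a shape of at most M would make \<open>rho\<close>
      smaller than \<open>\<rho>\<^sub>0\<close>, contrary to the equation that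
      \<open>\<sigma>\<close> satisfies.\<close>
    have "\<not> \<sigma> \<theta> \<le> M"
      using e(2)[of \<theta> "\<sigma> \<theta>"] th angle[OF th(1)] assms(6)[OF th(1)] assms(8)[OF th(1)] by (auto simp: dist_real_def)
    then show "\<exists>\<theta>\<in>\<Theta>. M \<le> \<sigma> \<theta>" using th(1) by force
  qed
  show ?thesis using differentiation_basis_rectangle_basis differentiates_exactly ..
qed

end
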